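(* Let $S$ be a nonzero Noetherian ring, let $2\le 2t\le n$, let $X$ be a generic alternating $n\times n$ matrix over $S$, and let $I=\mathrm{Pf}_{2t}(X)\subseteq S[X]$. Then $I$ satisfies $G_\infty$ if and only if one of the following conditions holds: (i) $2t=2$; (ii) $2t=n$; (iii) $2t=n-2$; (iv) $2t=n-1$. Otherwise, the maximal $s$ for which $I$ satisfies $G_s$ is $s=\binom{n-2t+4}{2}$.
   Context: A generic alternating matrix over $S$ is an alternating matrix ($X^T=-X$ with zero diagonal) whose entries above the diagonal are distinct indeterminates over $S$; $S[X]$ is the polynomial ring over $S$ in these entries. $\mathrm{Pf}_{2t}(X)$ is the ideal generated by the Pfaffians of the $2t\times 2t$ principal submatrices of $X$. An ideal $I$ of a Noetherian ring $R$ satisfies $G_s$ if $\mu_{R_{\mathfrak p}}(I_{\mathfrak p})\le\dim R_{\mathfrak p}$ for every prime $\mathfrak p\in V(I)$ with $\dim R_{\mathfrak p}\le s-1$, where $\mu$ is the minimal number of generators; $I$ satisfies $G_\infty$ if it satisfies $G_s$ for every $s$. *)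

theory Defs
  imports
    "HOL-Algebra.Indexed_Polynomials"
    "HOL-Library.Extended_Nat"
    "HOL-Combinatorics.Permutations"
    "Jordan_Normal_Form.DL_Submatrix"
begin

section \<open>Multivariate polynomial rings\<close>

text \<open>
  \<^theory>\<open>HOL-Algebra.Indexed_Polynomials\<close> supplies the polynomials over a ring as
  finitely supported coefficient functions on monomials (multisets of variables), together
  with constants, variables and addition, but only multiplication by a single variable.
  The general product is the convolution over the factorizations \<open>m = a + (m - a)\<close>.
\<close>

definition mpoly_mult ::
  "('a, 'b) ring_scheme \<Rightarrow> ('v multiset \<Rightarrow> 'a) \<Rightarrow> ('v multiset \<Rightarrow> 'a) \<Rightarrow> ('v multiset \<Rightarrow> 'a)"
  where "mpoly_mult S P Q = (\<lambda>m. \<Oplus>\<^bsub>S\<^esub>a\<in>{a. a \<subseteq># m}. P a \<otimes>\<^bsub>S\<^esub> Q (m - a))"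

definition mpoly_ring :: "('a, 'b) ring_scheme \<Rightarrow> 'v set \<Rightarrow> ('v multiset \<Rightarrow> 'a) ring"
  where "mpoly_ring S V =
    \<lparr> carrier = ring.indexed_pset S V (carrier S),
      monoid.mult = mpoly_mult S,
      monoid.one = ring.indexed_const S \<one>\<^bsub>S\<^esub>,
      ring.zero = ring.indexed_const S \<zero>\<^bsub>S\<^esub>,
      ring.add = ring.indexed_padd S \<rparr>"


section \<open>Pfaffians\<close>

text \<open>
  Each perfect matching of \<open>{..<2 * k}\<close> is represented by exactly one permutation \<open>\<sigma>\<close>: its
  edges are \<open>{\<sigma> (2 * i), \<sigma> (2 * i + 1)}\<close>, each listed with the smaller endpoint first, and
  the edges are ordered by their smaller endpoints.
\<close>

definition matching_perms :: "nat \<Rightarrow> (nat \<Rightarrow> nat) set"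
  where "matching_perms k = {\<sigma>. \<sigma> permutes {..<2 * k}
    \<and> (\<forall>i<k. \<sigma> (2 * i) < \<sigma> (2 * i + 1))
    \<and> (\<forall>i j. i < j \<and> j < k \<longrightarrow> \<sigma> (2 * i) < \<sigma> (2 * j))}"

text \<open>Meant for alternating matrices of even size.\<close>

definition pfaffian :: "('a, 'b) ring_scheme \<Rightarrow> 'a mat \<Rightarrow> 'a"
  where "pfaffian R A =
    (\<Oplus>\<^bsub>R\<^esub>\<sigma>\<in>matching_perms (dim_row A div 2).
       let x = (\<Otimes>\<^bsub>R\<^esub>i\<in>{..<dim_row A div 2}. A $$ (\<sigma> (2 * i), \<sigma> (2 * i + 1)))
       in if evenperm \<sigma> then x else \<ominus>\<^bsub>R\<^esub> x)"

definition pfaffian_ideal :: "('a, 'b) ring_scheme \<Rightarrow> nat \<Rightarrow> 'a mat \<Rightarrow> 'a set"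
  where "pfaffian_ideal R m A =
    Idl\<^bsub>R\<^esub> {pfaffian R (submatrix A J J) | J. J \<subseteq> {..<dim_row A} \<and> card J = m}"

text \<open>The indeterminates of the generic alternating matrix are indexed by the positions
  strictly above the diagonal.\<close>

definition upper_positions :: "nat \<Rightarrow> (nat \<times> nat) set"
  where "upper_positions n = {(i, j). i < j \<and> j < n}"

definition generic_alt_ring :: "('a, 'b) ring_scheme \<Rightarrow> nat \<Rightarrow> ((nat \<times> nat) multiset \<Rightarrow> 'a) ring"
  where "generic_alt_ring S n = mpoly_ring S (upper_positions n)"

definition generic_alt_mat :: "('a, 'b) ring_scheme \<Rightarrow> nat \<Rightarrow> ((nat \<times> nat) multiset \<Rightarrow> 'a) mat"
  where "generic_alt_mat S n = mat n n (\<lambda>(i, j).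
    if i < j then ring.indexed_var S (i, j)
    else if j < i then \<ominus>\<^bsub>generic_alt_ring S n\<^esub> ring.indexed_var S (j, i)
    else \<zero>\<^bsub>generic_alt_ring S n\<^esub>)"


section \<open>Localization\<close>

text \<open>Fractions \<open>a / s\<close> with \<open>s\<close> in a multiplicative set \<open>W\<close> of a commutative ring.
  The factor \<open>w\<close> is needed since \<open>R\<close> may have zero divisors.\<close>

definition frac_rel ::
  "('a, 'b) ring_scheme \<Rightarrow> 'a set \<Rightarrow> (('a \<times> 'a) \<times> ('a \<times> 'a)) set"
  where "frac_rel R W = {((a, s), (b, u)).
    a \<in> carrier R \<and> s \<in> W \<and> b \<in> carrier R \<and> u \<in> W
    \<and> (\<exists>w\<in>W. w \<otimes>\<^bsub>R\<^esub> (u \<otimes>\<^bsub>R\<^esub> a \<ominus>\<^bsub>R\<^esub> s \<otimes>\<^bsub>R\<^esub> b) = \<zero>\<^bsub>R\<^esub>)}"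

definition fraction :: "('a, 'b) ring_scheme \<Rightarrow> 'a set \<Rightarrow> 'a \<Rightarrow> 'a \<Rightarrow> ('a \<times> 'a) set"
  where "fraction R W a s = frac_rel R W `` {(a, s)}"

definition localization :: "('a, 'b) ring_scheme \<Rightarrow> 'a set \<Rightarrow> ('a \<times> 'a) set ring"
  where "localization R W =
    \<lparr> carrier = (carrier R \<times> W) // frac_rel R W,
      monoid.mult = (\<lambda>A B. \<Union>x\<in>A. \<Union>y\<in>B.
        fraction R W (fst x \<otimes>\<^bsub>R\<^esub> fst y) (snd x \<otimes>\<^bsub>R\<^esub> snd y)),
      monoid.one = fraction R W \<one>\<^bsub>R\<^esub> \<one>\<^bsub>R\<^esub>,
      ring.zero = fraction R W \<zero>\<^bsub>R\<^esub> \<one>\<^bsub>R\<^esub>,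
      ring.add = (\<lambda>A B. \<Union>x\<in>A. \<Union>y\<in>B.
        fraction R W (snd y \<otimes>\<^bsub>R\<^esub> fst x \<oplus>\<^bsub>R\<^esub> snd x \<otimes>\<^bsub>R\<^esub> fst y) (snd x \<otimes>\<^bsub>R\<^esub> snd y)) \<rparr>"

definition local_ring_at :: "('a, 'b) ring_scheme \<Rightarrow> 'a set \<Rightarrow> ('a \<times> 'a) set ring"
  where "local_ring_at R p = localization R (carrier R - p)"

definition local_ideal_at :: "('a, 'b) ring_scheme \<Rightarrow> 'a set \<Rightarrow> 'a set \<Rightarrow> ('a \<times> 'a) set set"
  where "local_ideal_at R p I = {fraction R (carrier R - p) a s | a s. a \<in> I \<and> s \<in> carrier R - p}"


section \<open>Krull dimension, number of generators, and the condition \<open>G\<^sub>s\<close>\<close>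

text \<open>Only used for nonzero rings; the zero ring would get dimension 0.\<close>

definition krull_dim :: "('a, 'b) ring_scheme \<Rightarrow> enat"
  where "krull_dim R = Sup {enat k | k. \<exists>P :: nat \<Rightarrow> 'a set.
    (\<forall>i\<le>k. primeideal (P i) R) \<and> (\<forall>i<k. P i \<subset> P (Suc i))}"

text \<open>The value is \<open>\<infinity>\<close> for ideals that are not finitely generated.\<close>

definition min_num_gens :: "('a, 'b) ring_scheme \<Rightarrow> 'a set \<Rightarrow> enat"
  where "min_num_gens R I =
    Inf {enat (card A) | A. A \<subseteq> carrier R \<and> finite A \<and> I = Idl\<^bsub>R\<^esub> A}"

text \<open>The bound \<open>dim R\<^sub>p \<le> s - 1\<close> is written without subtraction, so that \<open>G\<^sub>0\<close> is vacuous.\<close>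

definition satisfies_G :: "('a, 'b) ring_scheme \<Rightarrow> 'a set \<Rightarrow> nat \<Rightarrow> bool"
  where "satisfies_G R I s \<longleftrightarrow>
    (\<forall>p. primeideal p R \<and> I \<subseteq> p \<and> krull_dim (local_ring_at R p) + 1 \<le> enat s
      \<longrightarrow> min_num_gens (local_ring_at R p) (local_ideal_at R p I) \<le> krull_dim (local_ring_at R p))"

definition satisfies_G_inf :: "('a, 'b) ring_scheme \<Rightarrow> 'a set \<Rightarrow> bool"
  where "satisfies_G_inf R I \<longleftrightarrow> (\<forall>s. satisfies_G R I s)"

end

theory Submission
  imports Defs "HOL-Library.Product_Lexorder" "HOL-Library.Multiset_Order"
begin

text \<open>
  Let \<open>p\<close> be a prime containing \<open>I\<close>, and let \<open>2 r\<close> be the largest size of a Pfaffian \<open>d = Pf(K)\<close> not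
  in \<open>p\<close>; thus \<open>r < t\<close>. The Pfaffians \<open>y\<^sub>i\<^sub>j = Pf(i, j, K)\<close> have the form \<open>d x\<^sub>i\<^sub>j + b\<^sub>i\<^sub>j\<close>, where \<open>b\<^sub>i\<^sub>j\<close>
  does not involve the variables with both indices outside \<open>K\<close>. After localization at \<open>p\<close> the matrix
  \<open>T = (y\<^sub>i\<^sub>j)\<close> of size \<open>m = n - 2 r\<close> is therefore generic, its entries lie in \<open>p\<close>, and \<open>I\<close> becomes
  \<open>Pf\<^sub>2\<^sub>t\<^sub>-\<^sub>2\<^sub>r(T)\<close>. Hence \<open>I\<close> is generated locally by \<open>m choose (2 t - 2 r)\<close> elements while \<open>p\<close> has
  height at least \<open>m choose 2\<close>. This gives \<open>G\<^sub>s\<close> as claimed, since the first number is at most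
  the second unless \<open>4 \<le> 2 t - 2 r \<le> m - 3\<close>.

  For the failure take \<open>r = t - 2\<close>, \<open>m = n - 2 t + 4\<close>, and the prime generated by the entries of \<open>T\<close>
  and a minimal prime of \<open>S\<close>. There the \<open>4 \<times> 4\<close> Pfaffians of \<open>T\<close> are minimal generators, and the
  height is exactly \<open>m choose 2\<close>, which is less than \<open>m choose 4\<close> if \<open>m \<ge> 7\<close>. The upper bound
  on the height does not need dimension theory: along a longer chain of primes, choose \<open>w i\<close> in the
  \<open>(i + 1)\<close>st prime but not in the \<open>i\<close>th, and add the variables of \<open>x\<close>
  with an index in \<open>K\<close>; these are more elements than variables, so they are algebraically
  dependent, and the lexicographically lowest term of the relation contradicts primality.
\<close>

text \<open>That \<open>T\<close> is generic is used without constructing an isomorphism. The chart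
  is only a homomorphism \<theta> from S[X] to A[T], where A is a localization of S[X] itself; it
  sends the variables with an index in K to constants and each Pf(i, j, K) with i < j outside K to
  the variable T_ij. Primes of A[T] are pulled back along \<theta>, which yields both the chains
  that bound heights from below and the prime at which the condition fails. That I becomes a
  Pfaffian ideal of T is a Schur complement argument. Since d is not a unit in S[X], it is done with
  formal vectors: each e_i gets a companion, d e_i minus a combination of the e_k with k in K,
  orthogonal to these e_k. Powers of d are cancelled only modulo ideals that allow it. The bound C(n
  - 2t + 4, 2) arises because for r = t - 1 the bounds on generators and height coincide, so such
  primes never violate the condition, while every smaller r forces height at least C(n - 2t + 4, 2)
  and G_s tests only primes of height below s. The prime of S is taken minimal so that S adds
  nothing to the height.\<close>

section \<open>Arithmetic of multivariate polynomials\<close>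

definition mpoly_monom :: "('a, 'b) ring_scheme \<Rightarrow> 'a \<Rightarrow> 'v multiset \<Rightarrow> 'v multiset \<Rightarrow> 'a"
  where "mpoly_monom S k m = (\<lambda>m'. if m' = m then k else \<zero>\<^bsub>S\<^esub>)"

definition mset_prod :: "('a, 'b) monoid_scheme \<Rightarrow> ('v \<Rightarrow> 'a) \<Rightarrow> 'v multiset \<Rightarrow> 'a"
  where "mset_prod G v m = finprod G (\<lambda>x. v x [^]\<^bsub>G\<^esub> count m x) (set_mset m)"

definition mpoly_eval :: "('a, 'b) ring_scheme \<Rightarrow> ('c, 'd) ring_scheme \<Rightarrow> ('a \<Rightarrow> 'c) \<Rightarrow> ('v \<Rightarrow> 'c) \<Rightarrow> ('v multiset \<Rightarrow> 'a) \<Rightarrow> 'c"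
  where "mpoly_eval S T h v f = finsum T (\<lambda>m. h (f m) \<otimes>\<^bsub>T\<^esub> mset_prod T v m) {m. f m \<noteq> \<zero>\<^bsub>S\<^esub>}"

lemma finite_submultisets: "finite {a. a \<subseteq># (m::'v multiset)}"
proof (rule finite_subset[of _ "mset ` {xs. set xs \<subseteq> set_mset m \<and> length xs \<le> size m}"])
  show "{a. a \<subseteq># m} \<subseteq> mset ` {xs. set xs \<subseteq> set_mset m \<and> length xs \<le> size m}"
  proof
    fix a assume "a \<in> {a. a \<subseteq># m}"
    then have a: "a \<subseteq># m" by simp
    obtain xs where xs: "mset xs = a" using ex_mset by blast
    then have "set xs \<subseteq> set_mset m" "length xs \<le> size m"
      using a set_mset_mono[OF a] size_mset_mono[OF a] by auto
    then show "a \<in> mset ` {xs. set xs \<subseteq> set_mset m \<and> length xs \<le> size m}" using xs by blast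
  qed
qed (intro finite_imageI finite_lists_length_le finite_set_mset)

lemma diff_diff_submset: "a \<subseteq># m \<Longrightarrow> m - (m - a) = (a :: 'v multiset)"
  by (rule multiset_eqI) (simp add: mset_subset_eq_count)

context comm_monoid begin

lemma mset_prod_closed [simp]:
  assumes "\<And>x. x \<in># m \<Longrightarrow> v x \<in> carrier G"
  shows "mset_prod G v m \<in> carrier G"
  unfolding mset_prod_def by (rule finprod_closed) (use assms in auto)

lemma mset_prod_empty [simp]: "mset_prod G v {#} = \<one>"
  by (simp add: mset_prod_def)

lemma mset_prod_add_mset:
  assumes "v i \<in> carrier G" "\<And>x. x \<in># m \<Longrightarrow> v x \<in> carrier G"
  shows "mset_prod G v (add_mset i m) = v i \<otimes> mset_prod G v m"
proof -
  \<comment> \<open>Whether or not \<open>i\<close> is new, the two index sets agree away from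
    \<open>i\<close>, so its factor is split off first.\<close>
  let ?B = "set_mset m - {i}"
  have "mset_prod G v (add_mset i m) = finprod G (\<lambda>x. v x [^] count (add_mset i m) x) (insert i ?B)"
    unfolding mset_prod_def by (rule arg_cong2[where f="finprod G"]) auto
  also have "\<dots> = v i [^] count (add_mset i m) i \<otimes> finprod G (\<lambda>x. v x [^] count (add_mset i m) x) ?B"
    by (rule finprod_insert) (use assms in auto)
  also have "finprod G (\<lambda>x. v x [^] count (add_mset i m) x) ?B = finprod G (\<lambda>x. v x [^] count m x) ?B"
    by (rule finprod_cong') (use assms in auto)
  also have "v i [^] count (add_mset i m) i = v i \<otimes> v i [^] count m i"
    using assms by (simp add: m_comm)
  also have "(v i \<otimes> v i [^] count m i) \<otimes> finprod G (\<lambda>x. v x [^] count m x) ?B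
      = v i \<otimes> (v i [^] count m i \<otimes> finprod G (\<lambda>x. v x [^] count m x) ?B)"
    by (rule m_assoc) (use assms in \<open>auto intro!: finprod_closed\<close>)
  also have "v i [^] count m i \<otimes> finprod G (\<lambda>x. v x [^] count m x) ?B = mset_prod G v m"
  proof (cases "i \<in># m")
    case True
    have "finprod G (\<lambda>x. v x [^] count m x) (insert i ?B) = v i [^] count m i \<otimes> finprod G (\<lambda>x. v x [^] count m x) ?B"
      by (rule finprod_insert) (use assms in auto)
    then show ?thesis using True by (simp add: mset_prod_def insert_absorb)
  next
    case False
    then have "count m i = 0" by (simp add: not_in_iff)
    then show ?thesis using assms False mset_prod_closed[of m v] by (simp add: mset_prod_def)
  qed
  finally show ?thesis .
qed

end

context ring begin

text \<open>Turns the inductive description of polynomials into finite support, which is what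
  coefficient arguments need. Conversely, a function of finite support is rebuilt by adding back one
  monomial at a time.\<close>

lemma indexed_pset_iff:
  fixes V :: "'v set"
  shows "f \<in> indexed_pset V (carrier R) \<longleftrightarrow>
    (\<forall>m. f m \<in> carrier R) \<and> finite {m. f m \<noteq> \<zero>} \<and> (\<forall>m. f m \<noteq> \<zero> \<longrightarrow> set_mset m \<subseteq> V)"
proof
  assume "f \<in> indexed_pset V (carrier R)"
  then show "(\<forall>m. f m \<in> carrier R) \<and> finite {m. f m \<noteq> \<zero>} \<and> (\<forall>m. f m \<noteq> \<zero> \<longrightarrow> set_mset m \<subseteq> V)"
  proof induction
    case (indexed_const k)
    have "{m. indexed_const k m \<noteq> \<zero>} \<subseteq> {{#}}" by (auto simp: indexed_const_def)
    then have "finite {m. indexed_const k m \<noteq> \<zero>}" by (rule finite_subset) simp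
    then show ?case using indexed_const by (auto simp: indexed_const_def)
  next
    case (indexed_padd P Q)
    have "{m. indexed_padd P Q m \<noteq> \<zero>} \<subseteq> {m. P m \<noteq> \<zero>} \<union> {m. Q m \<noteq> \<zero>}"
      using indexed_padd by (auto simp: indexed_padd_def)
    then have "finite {m. indexed_padd P Q m \<noteq> \<zero>}"
      by (rule finite_subset) (use indexed_padd in simp)
    moreover have "P m \<noteq> \<zero> \<or> Q m \<noteq> \<zero>" if "indexed_padd P Q m \<noteq> \<zero>" for m
      using that indexed_padd by (auto simp: indexed_padd_def)
    ultimately show ?case using indexed_padd by (auto simp: indexed_padd_def) blast+
  next
    case (indexed_pmult P i)
    have "{m. indexed_pmult P i m \<noteq> \<zero>} \<subseteq> add_mset i ` {m. P m \<noteq> \<zero>}"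
      by (auto simp: indexed_pmult_def image_iff split: if_splits) (metis insert_DiffM)
    then have "finite {m. indexed_pmult P i m \<noteq> \<zero>}"
      by (rule finite_subset) (use indexed_pmult in simp)
    moreover have "set_mset m \<subseteq> V" if "indexed_pmult P i m \<noteq> \<zero>" for m
    proof -
      have "i \<in># m" "P (m - {#i#}) \<noteq> \<zero>" using that by (auto simp: indexed_pmult_def split: if_splits)
      then have "set_mset (m - {#i#}) \<subseteq> V" using indexed_pmult by blast
      then have "set_mset (add_mset i (m - {#i#})) \<subseteq> V" using indexed_pmult by simp
      then show ?thesis using \<open>i \<in># m\<close> by simp
    qed
    ultimately show ?case using indexed_pmult by (auto simp: indexed_pmult_def)
  qed
next
  have mon: "mpoly_monom R k m \<in> indexed_pset V (carrier R)" if "k \<in> carrier R" "set_mset m \<subseteq> V" for k m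
    using that(2)
  proof (induction m)
    case empty
    have "mpoly_monom R k ({#} :: 'v multiset) = indexed_const k" by (auto simp: mpoly_monom_def indexed_const_def)
    then show ?case using that by (simp add: indexed_pset.indexed_const)
  next
    case (add i m)
    have "mpoly_monom R k (add_mset i m) = indexed_pmult (mpoly_monom R k m) i"
      by (auto simp: mpoly_monom_def indexed_pmult_def fun_eq_iff)
    then show ?case using add by (simp add: indexed_pset.indexed_pmult)
  qed
  assume f: "(\<forall>m. f m \<in> carrier R) \<and> finite {m. f m \<noteq> \<zero>} \<and> (\<forall>m. f m \<noteq> \<zero> \<longrightarrow> set_mset m \<subseteq> V)"
  have "finite F \<Longrightarrow> {m. f m \<noteq> \<zero>} = F \<Longrightarrow> (\<forall>m. f m \<in> carrier R) \<Longrightarrow> (\<forall>m. f m \<noteq> \<zero> \<longrightarrow> set_mset m \<subseteq> V)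
    \<Longrightarrow> f \<in> indexed_pset V (carrier R)" for F
  proof (induction F arbitrary: f rule: finite_induct)
    case empty
    then have "f = indexed_const \<zero>" by (auto simp: indexed_const_def)
    then show ?case by (simp add: indexed_pset.indexed_const)
  next
    case (insert m F)
    let ?g = "f(m := \<zero>)"
    have "{m. ?g m \<noteq> \<zero>} = F" using insert by auto
    moreover have "\<forall>m. ?g m \<in> carrier R" using insert by auto
    moreover have "\<forall>m. ?g m \<noteq> \<zero> \<longrightarrow> set_mset m \<subseteq> V" using insert by auto
    ultimately have g: "?g \<in> indexed_pset V (carrier R)" using insert.IH by blast
    have "f = indexed_padd (mpoly_monom R (f m) m) ?g"
      using insert by (auto simp: indexed_padd_def mpoly_monom_def fun_eq_iff)
    moreover have "f m \<noteq> \<zero>" using insert by blast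
    ultimately show ?case using g mon[of "f m" m] insert by (metis indexed_pset.indexed_padd)
  qed
  then show "f \<in> indexed_pset V (carrier R)" using f by blast
qed

lemma mpoly_carrier: "carrier (mpoly_ring R V) = indexed_pset V (carrier R)"
  by (simp add: mpoly_ring_def)

lemma mpoly_mult_eq: "f \<otimes>\<^bsub>mpoly_ring R V\<^esub> g = mpoly_mult R f g"
  by (simp add: mpoly_ring_def)

lemma mpoly_zero: "\<zero>\<^bsub>mpoly_ring R V\<^esub> = indexed_const \<zero>"
  by (simp add: mpoly_ring_def)

lemma mpoly_one: "\<one>\<^bsub>mpoly_ring R V\<^esub> = indexed_const \<one>"
  by (simp add: mpoly_ring_def)

lemma mpoly_add: "f \<oplus>\<^bsub>mpoly_ring R V\<^esub> g = indexed_padd f g"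
  by (simp add: mpoly_ring_def)

lemma mpoly_coeff_closed: "f \<in> carrier (mpoly_ring R V) \<Longrightarrow> f m \<in> carrier R"
  by (simp add: mpoly_carrier indexed_pset_iff)

lemma mpoly_finite_support: "f \<in> carrier (mpoly_ring R V) \<Longrightarrow> finite {m. f m \<noteq> \<zero>}"
  by (simp add: mpoly_carrier indexed_pset_iff)

lemma mpoly_support_vars: "f \<in> carrier (mpoly_ring R V) \<Longrightarrow> f m \<noteq> \<zero> \<Longrightarrow> set_mset m \<subseteq> V"
  by (simp add: mpoly_carrier indexed_pset_iff)

lemma mpoly_const_closed [simp]: "k \<in> carrier R \<Longrightarrow> indexed_const k \<in> carrier (mpoly_ring R V)"
  by (simp add: mpoly_carrier indexed_pset.indexed_const)

lemma mpoly_monom_closed [simp]: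
  "k \<in> carrier R \<Longrightarrow> set_mset m \<subseteq> V \<Longrightarrow> mpoly_monom R k m \<in> carrier (mpoly_ring R V)"
  by (auto simp: mpoly_carrier indexed_pset_iff mpoly_monom_def)

lemma indexed_var_eq_monom: "indexed_var i = mpoly_monom R \<one> {#i#}"
proof
  fix m
  have "i \<in># m \<Longrightarrow> (m - {#i#} = {#}) = (m = {#i#})"
    by (metis add_mset_remove_trivial insert_DiffM)
  then show "indexed_var i m = mpoly_monom R \<one> {#i#} m"
    by (auto simp: indexed_var_def indexed_pmult_def indexed_const_def mpoly_monom_def)
qed

lemma mpoly_var_closed [simp]: "i \<in> V \<Longrightarrow> indexed_var i \<in> carrier (mpoly_ring R V)"
  by (simp add: indexed_var_eq_monom)

lemma mpoly_mult_monom: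
  assumes "k \<in> carrier R" "\<And>m. g m \<in> carrier R"
  shows "mpoly_mult R (mpoly_monom R k a) g m = (if a \<subseteq># m then k \<otimes> g (m - a) else \<zero>)"
proof (cases "a \<subseteq># m")
  case True
  have "mpoly_mult R (mpoly_monom R k a) g m
    = (\<Oplus>b\<in>{b. b \<subseteq># m}. if a = b then k \<otimes> g (m - b) else \<zero>)"
    unfolding mpoly_mult_def by (rule add.finprod_cong') (use assms in \<open>auto simp: mpoly_monom_def\<close>)
  also have "\<dots> = k \<otimes> g (m - a)"
    by (rule add.finprod_singleton) (use assms True finite_submultisets in auto)
  finally show ?thesis using True by simp
next
  case False
  have "mpoly_mult R (mpoly_monom R k a) g m = (\<Oplus>b\<in>{b. b \<subseteq># m}. \<zero>)"
    unfolding mpoly_mult_def by (rule add.finprod_cong') (use assms False in \<open>auto simp: mpoly_monom_def\<close>)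
  then show ?thesis using False by simp
qed

lemma mpoly_mult_const:
  fixes g :: "'v multiset \<Rightarrow> 'a"
  assumes "k \<in> carrier R" "\<And>m. g m \<in> carrier R"
  shows "mpoly_mult R (indexed_const k) g m = k \<otimes> g m"
proof -
  have "indexed_const k = mpoly_monom R k ({#} :: 'v multiset)" by (auto simp: mpoly_monom_def indexed_const_def)
  then show ?thesis using mpoly_mult_monom[of k g "{#}" m] assms by simp
qed

text \<open>Submultisets of \<open>m\<close> containing \<open>i\<close> correspond to submultisets
  of \<open>m - {#i#}\<close>, and the others contribute zero. With this rule, closure and
  associativity follow by induction on the first factor instead of a rearrangement of double
  sums.\<close>

lemma mpoly_mult_pmult:
  assumes "\<And>m. f m \<in> carrier R" "\<And>m. g m \<in> carrier R"
  shows "mpoly_mult R (indexed_pmult f i) g = indexed_pmult (mpoly_mult R f g) i"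
proof
  fix m
  show "mpoly_mult R (indexed_pmult f i) g m = indexed_pmult (mpoly_mult R f g) i m"
  proof (cases "i \<in># m")
    case True
    define n where "n = m - {#i#}"
    have m: "m = add_mset i n" using True by (simp add: n_def)
    have "mpoly_mult R (indexed_pmult f i) g m
      = (\<Oplus>a\<in>{a. a \<subseteq># m}. indexed_pmult f i a \<otimes> g (m - a))" by (simp add: mpoly_mult_def)
    also have "\<dots> = (\<Oplus>a\<in>add_mset i ` {a. a \<subseteq># n}. indexed_pmult f i a \<otimes> g (m - a))"
    proof (rule add.finprod_mono_neutral_cong_right)
      show "finite {a. a \<subseteq># m}" by (rule finite_submultisets)
      show "add_mset i ` {a. a \<subseteq># n} \<subseteq> {a. a \<subseteq># m}" by (auto simp: m)
      show "\<And>a. a \<in> {a. a \<subseteq># m} - add_mset i ` {a. a \<subseteq># n} \<Longrightarrow> indexed_pmult f i a \<otimes> g (m - a) = \<zero>"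
      proof -
        fix a assume a: "a \<in> {a. a \<subseteq># m} - add_mset i ` {a. a \<subseteq># n}"
        have "i \<notin># a"
        proof
          assume "i \<in># a"
          then have "a = add_mset i (a - {#i#})" by simp
          moreover have "a - {#i#} \<subseteq># n" using a by (simp add: n_def subset_eq_diff_conv) (metis True add_mset_diff_bothsides calculation diff_empty insert_DiffM mset_subset_eq_add_mset_cancel m)
          ultimately show False using a by blast
        qed
        then show "indexed_pmult f i a \<otimes> g (m - a) = \<zero>" using assms by (simp add: indexed_pmult_def)
      qed
    qed (use assms in \<open>auto simp: indexed_pmult_def\<close>)
    also have "\<dots> = (\<Oplus>a\<in>{a. a \<subseteq># n}. indexed_pmult f i (add_mset i a) \<otimes> g (m - add_mset i a))"
      by (rule add.finprod_reindex) (use assms in \<open>auto simp: indexed_pmult_def inj_on_def\<close>)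
    also have "\<dots> = (\<Oplus>a\<in>{a. a \<subseteq># n}. f a \<otimes> g (n - a))"
      by (rule add.finprod_cong') (use assms in \<open>auto simp: indexed_pmult_def m\<close>)
    also have "\<dots> = indexed_pmult (mpoly_mult R f g) i m"
      by (simp add: indexed_pmult_def True mpoly_mult_def n_def)
    finally show ?thesis .
  next
    case False
    have "mpoly_mult R (indexed_pmult f i) g m = (\<Oplus>b\<in>{b. b \<subseteq># m}. \<zero>)"
      unfolding mpoly_mult_def
    proof (rule add.finprod_cong')
      fix a assume "a \<in> {b. b \<subseteq># m}"
      then have "i \<notin># a" using False mset_subset_eqD[of a m i] by auto
      then show "indexed_pmult f i a \<otimes> g (m - a) = \<zero>" using assms by (simp add: indexed_pmult_def)
    qed auto
    then show ?thesis using False by (simp add: indexed_pmult_def)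
  qed
qed

lemma mpoly_mult_padd:
  assumes "\<And>m. f m \<in> carrier R" "\<And>m. f' m \<in> carrier R" "\<And>m. g m \<in> carrier R"
  shows "mpoly_mult R (indexed_padd f f') g = indexed_padd (mpoly_mult R f g) (mpoly_mult R f' g)"
proof
  fix m
  have "mpoly_mult R (indexed_padd f f') g m = (\<Oplus>a\<in>{a. a \<subseteq># m}. f a \<otimes> g (m - a) \<oplus> f' a \<otimes> g (m - a))"
    unfolding mpoly_mult_def
    by (rule add.finprod_cong') (use assms in \<open>auto simp: indexed_padd_def l_distr\<close>)
  also have "\<dots> = indexed_padd (mpoly_mult R f g) (mpoly_mult R f' g) m"
    unfolding indexed_padd_def mpoly_mult_def by (rule add.finprod_multf) (use assms in auto)
  finally show "mpoly_mult R (indexed_padd f f') g m = indexed_padd (mpoly_mult R f g) (mpoly_mult R f' g) m" .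
qed

end

context cring begin

lemma mpoly_mult_comm:
  fixes f g :: "'v multiset \<Rightarrow> 'a"
  assumes "\<And>m. f m \<in> carrier R" "\<And>m. g m \<in> carrier R"
  shows "mpoly_mult R f g = mpoly_mult R g f"
proof
  fix m :: "'v multiset"
  have inj: "inj_on (\<lambda>a. m - a) {a. a \<subseteq># m}"
    by (rule inj_on_inverseI[where g="\<lambda>a. m - a"]) (simp add: diff_diff_submset)
  have img: "(\<lambda>a. m - a) ` {a. a \<subseteq># m} = {a. a \<subseteq># m}"
  proof (intro equalityI subsetI)
    fix a assume "a \<in> {a. a \<subseteq># m}"
    then have "a = m - (m - a)" by (simp add: diff_diff_submset)
    then show "a \<in> (\<lambda>a. m - a) ` {a. a \<subseteq># m}" by (rule image_eqI) simp
  qed auto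
  have "mpoly_mult R f g m = (\<Oplus>a\<in>(\<lambda>a. m - a) ` {a. a \<subseteq># m}. f a \<otimes> g (m - a))"
    by (simp add: img mpoly_mult_def)
  also have "\<dots> = (\<Oplus>a\<in>{a. a \<subseteq># m}. f (m - a) \<otimes> g (m - (m - a)))"
    by (rule add.finprod_reindex) (use assms inj in auto)
  also have "\<dots> = (\<Oplus>a\<in>{a. a \<subseteq># m}. g a \<otimes> f (m - a))"
  proof (rule add.finprod_cong')
    fix a assume "a \<in> {a. a \<subseteq># m}"
    then have "m - (m - a) = a" by (simp add: diff_diff_submset)
    then show "f (m - a) \<otimes> g (m - (m - a)) = g a \<otimes> f (m - a)" using assms by (simp add: m_comm)
  qed (use assms in auto)
  finally show "mpoly_mult R f g m = mpoly_mult R g f m" by (simp add: mpoly_mult_def)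
qed

lemma mpoly_mult_coeff_closed [simp]:
  assumes "\<And>m. f m \<in> carrier R" "\<And>m. g m \<in> carrier R"
  shows "mpoly_mult R f g m \<in> carrier R"
  unfolding mpoly_mult_def using assms by (auto intro!: finsum_closed)

lemma mpoly_mult_closed:
  assumes "f \<in> indexed_pset V (carrier R)" "g \<in> indexed_pset V (carrier R)"
  shows "mpoly_mult R f g \<in> indexed_pset V (carrier R)"
  using assms(1)
proof induction
  case (indexed_const k)
  have "g m \<in> carrier R" for m using assms(2) by (simp add: indexed_pset_iff)
  then have e: "mpoly_mult R (indexed_const k) g = (\<lambda>m. k \<otimes> g m)"
    using mpoly_mult_const[OF indexed_const] by auto
  have sub: "{m. k \<otimes> g m \<noteq> \<zero>} \<subseteq> {m. g m \<noteq> \<zero>}" using indexed_const by auto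
  have "finite {m. k \<otimes> g m \<noteq> \<zero>}" by (rule finite_subset[OF sub]) (use assms(2) in \<open>simp add: indexed_pset_iff\<close>)
  then show ?case unfolding e using sub assms(2) indexed_const by (auto simp: indexed_pset_iff)
next
  case (indexed_padd P Q)
  have "P m \<in> carrier R" "Q m \<in> carrier R" "g m \<in> carrier R" for m
    using indexed_padd assms(2) by (simp_all add: indexed_pset_iff)
  then show ?case using indexed_padd by (simp add: mpoly_mult_padd indexed_pset.indexed_padd)
next
  case (indexed_pmult P i)
  have "P m \<in> carrier R" "g m \<in> carrier R" for m
    using indexed_pmult assms(2) by (simp_all add: indexed_pset_iff)
  then show ?case using indexed_pmult by (simp add: mpoly_mult_pmult indexed_pset.indexed_pmult)
qed

lemma mpoly_mult_assoc:
  assumes "f \<in> indexed_pset V (carrier R)" "g \<in> indexed_pset V (carrier R)" "h \<in> indexed_pset V (carrier R)"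
  shows "mpoly_mult R (mpoly_mult R f g) h = mpoly_mult R f (mpoly_mult R g h)"
proof -
  have g: "g m \<in> carrier R" and h: "h m \<in> carrier R" for m
    using assms(2,3) by (simp_all add: indexed_pset_iff)
  note [simp] = g h
  show ?thesis using assms(1)
  proof induction
    case (indexed_const k)
    note [simp] = indexed_const
    have e: "mpoly_mult R (indexed_const k) g = (\<lambda>m. k \<otimes> g m)" by (auto simp: mpoly_mult_const)
    show ?case
    proof
      fix m
      have "mpoly_mult R (\<lambda>m. k \<otimes> g m) h m = (\<Oplus>a\<in>{a. a \<subseteq># m}. k \<otimes> (g a \<otimes> h (m - a)))"
        unfolding mpoly_mult_def by (rule add.finprod_cong') (auto simp: m_assoc)
      also have "\<dots> = k \<otimes> mpoly_mult R g h m"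
        unfolding mpoly_mult_def by (rule finsum_rdistr[symmetric]) (auto simp: finite_submultisets)
      finally show "mpoly_mult R (mpoly_mult R (indexed_const k) g) h m = mpoly_mult R (indexed_const k) (mpoly_mult R g h) m"
        by (simp add: e mpoly_mult_const)
    qed
  next
    case (indexed_padd P Q)
    have [simp]: "P m \<in> carrier R" "Q m \<in> carrier R" for m
      using indexed_padd by (simp_all add: indexed_pset_iff)
    show ?case using indexed_padd by (simp add: mpoly_mult_padd)
  next
    case (indexed_pmult P i)
    have [simp]: "P m \<in> carrier R" for m
      using indexed_pmult by (simp_all add: indexed_pset_iff)
    show ?case using indexed_pmult by (simp add: mpoly_mult_pmult)
  qed
qed

lemma mpoly_ring_cring: "cring (mpoly_ring R V)"
proof -
  let ?P = "mpoly_ring R V"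
  have c: "f m \<in> carrier R" if "f \<in> indexed_pset V (carrier R)" for f m
    using that by (simp add: indexed_pset_iff)
  have "abelian_group ?P"
  proof (rule abelian_groupI)
    fix f assume "f \<in> carrier ?P"
    then have f: "f \<in> indexed_pset V (carrier R)" by (simp add: mpoly_carrier)
    have eq: "{m. \<ominus> f m \<noteq> \<zero>} = {m. f m \<noteq> \<zero>}" using c[OF f] by auto
    have "(\<lambda>m. \<ominus> f m) \<in> indexed_pset V (carrier R)"
      using f c[OF f] unfolding indexed_pset_iff eq by auto
    moreover have "indexed_padd (\<lambda>m. \<ominus> f m) f = indexed_const \<zero>"
      using c[OF f] by (auto simp: indexed_padd_def indexed_const_def l_neg)
    ultimately show "\<exists>y\<in>carrier ?P. y \<oplus>\<^bsub>?P\<^esub> f = \<zero>\<^bsub>?P\<^esub>"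
      by (auto simp: mpoly_carrier mpoly_add mpoly_zero)
  next
    fix f g assume "f \<in> carrier ?P" "g \<in> carrier ?P"
    then show "f \<oplus>\<^bsub>?P\<^esub> g \<in> carrier ?P" by (simp add: mpoly_carrier mpoly_add indexed_pset.indexed_padd)
  next
    fix f assume "f \<in> carrier ?P"
    then show "\<zero>\<^bsub>?P\<^esub> \<oplus>\<^bsub>?P\<^esub> f = f" by (auto simp: mpoly_add mpoly_zero indexed_padd_def indexed_const_def fun_eq_iff mpoly_coeff_closed)
  qed (auto simp: mpoly_add mpoly_zero indexed_padd_def indexed_zero_def fun_eq_iff a_ac mpoly_carrier c
      simp del: indexed_zero_def simp flip: indexed_zero_def intro: indexed_pset.indexed_const)
  moreover have "comm_monoid ?P"
  proof (rule comm_monoidI)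
    fix f g assume "f \<in> carrier ?P" "g \<in> carrier ?P"
    then show "f \<otimes>\<^bsub>?P\<^esub> g = g \<otimes>\<^bsub>?P\<^esub> f" unfolding mpoly_mult_eq by (intro mpoly_mult_comm) (auto intro: mpoly_coeff_closed)
  next
    fix f assume "f \<in> carrier ?P"
    then show "\<one>\<^bsub>?P\<^esub> \<otimes>\<^bsub>?P\<^esub> f = f" unfolding mpoly_mult_eq mpoly_one by (auto simp: mpoly_mult_const mpoly_coeff_closed)
  qed (auto simp: mpoly_carrier mpoly_mult_eq mpoly_one mpoly_mult_closed mpoly_mult_assoc indexed_pset.indexed_const)
  moreover have "(f \<oplus>\<^bsub>?P\<^esub> g) \<otimes>\<^bsub>?P\<^esub> h = f \<otimes>\<^bsub>?P\<^esub> h \<oplus>\<^bsub>?P\<^esub> g \<otimes>\<^bsub>?P\<^esub> h"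
    if "f \<in> carrier ?P" "g \<in> carrier ?P" "h \<in> carrier ?P" for f g h
    unfolding mpoly_mult_eq mpoly_add by (rule mpoly_mult_padd) (use that in \<open>auto intro: mpoly_coeff_closed\<close>)
  ultimately show ?thesis by (rule cringI)
qed

lemma mpoly_minus:
  assumes "f \<in> carrier (mpoly_ring R V)"
  shows "(\<ominus>\<^bsub>mpoly_ring R V\<^esub> f) m = \<ominus> f m"
proof -
  interpret P: cring "mpoly_ring R V" by (rule mpoly_ring_cring)
  have "(\<ominus>\<^bsub>mpoly_ring R V\<^esub> f) \<oplus>\<^bsub>mpoly_ring R V\<^esub> f = \<zero>\<^bsub>mpoly_ring R V\<^esub>" using assms by (rule P.l_neg)
  then have "(\<ominus>\<^bsub>mpoly_ring R V\<^esub> f) m \<oplus> f m = \<zero>"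
    by (simp add: mpoly_add mpoly_zero indexed_padd_def indexed_const_def fun_eq_iff split: if_splits)
  moreover have "(\<ominus>\<^bsub>mpoly_ring R V\<^esub> f) m \<in> carrier R" using assms P.a_inv_closed by (auto intro: mpoly_coeff_closed)
  ultimately show ?thesis using assms by (metis minus_equality mpoly_coeff_closed)
qed

lemma mpoly_finsum:
  assumes "finite A" "\<And>a. a \<in> A \<Longrightarrow> F a \<in> carrier (mpoly_ring R V)"
  shows "finsum (mpoly_ring R V) F A m = (\<Oplus>a\<in>A. F a m)"
  using assms
proof (induction A rule: finite_induct)
  case empty
  interpret P: cring "mpoly_ring R V" by (rule mpoly_ring_cring)
  show ?case by (simp add: mpoly_zero indexed_const_def)
next
  case (insert a A)
  interpret P: cring "mpoly_ring R V" by (rule mpoly_ring_cring)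
  have "finsum (mpoly_ring R V) F (insert a A) = F a \<oplus>\<^bsub>mpoly_ring R V\<^esub> finsum (mpoly_ring R V) F A"
    by (rule P.finsum_insert) (use insert in auto)
  moreover have "(\<Oplus>a\<in>insert a A. F a m) = F a m \<oplus> (\<Oplus>a\<in>A. F a m)"
    by (rule finsum_insert) (use insert in \<open>auto intro: mpoly_coeff_closed\<close>)
  ultimately show ?case using insert by (simp add: mpoly_add indexed_padd_def)
qed

lemma mpoly_pmult_eq:
  assumes "f \<in> carrier (mpoly_ring R V)"
  shows "indexed_pmult f i = indexed_var i \<otimes>\<^bsub>mpoly_ring R V\<^esub> f"
proof -
  have "mpoly_mult R (indexed_var i) f = indexed_pmult (mpoly_mult R (indexed_const \<one>) f) i"
    unfolding indexed_var_def by (rule mpoly_mult_pmult) (use assms in \<open>auto simp: indexed_const_def mpoly_coeff_closed\<close>)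
  moreover have "mpoly_mult R (indexed_const \<one>) f = f" using assms by (auto simp: mpoly_mult_const mpoly_coeff_closed)
  ultimately show ?thesis by (simp add: mpoly_mult_eq)
qed

lemma mpoly_induct [consumes 1, case_names const add var]:
  assumes "f \<in> carrier (mpoly_ring R V)"
    and "\<And>k. k \<in> carrier R \<Longrightarrow> Q (indexed_const k)"
    and "\<And>f g. f \<in> carrier (mpoly_ring R V) \<Longrightarrow> g \<in> carrier (mpoly_ring R V) \<Longrightarrow> Q f \<Longrightarrow> Q g \<Longrightarrow> Q (f \<oplus>\<^bsub>mpoly_ring R V\<^esub> g)"
    and "\<And>f i. f \<in> carrier (mpoly_ring R V) \<Longrightarrow> i \<in> V \<Longrightarrow> Q f \<Longrightarrow> Q (indexed_var i \<otimes>\<^bsub>mpoly_ring R V\<^esub> f)"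
  shows "Q f"
  using assms(1) unfolding mpoly_carrier
proof (induction)
  case (indexed_const k) then show ?case by (rule assms(2))
next
  case (indexed_padd f g) then show ?case using assms(3)[of f g] by (simp add: mpoly_carrier mpoly_add)
next
  case (indexed_pmult f i) then show ?case using assms(4)[of f i] mpoly_pmult_eq[of f V i] by (simp add: mpoly_carrier)
qed

lemma indexed_const_hom: "ring_hom_cring R (mpoly_ring R V) indexed_const"
proof -
  interpret P: cring "mpoly_ring R V" by (rule mpoly_ring_cring)
  show ?thesis
  proof (rule ring_hom_cringI[OF is_cring mpoly_ring_cring ring_hom_memI])
    fix x y assume xy: "x \<in> carrier R" "y \<in> carrier R"
    show "indexed_const (x \<otimes> y) = indexed_const x \<otimes>\<^bsub>mpoly_ring R V\<^esub> indexed_const y"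
      using xy by (auto simp: mpoly_mult_eq mpoly_mult_const indexed_const_def fun_eq_iff)
        (subst mpoly_mult_const[unfolded indexed_const_def], auto)+
    show "indexed_const (x \<oplus> y) = indexed_const x \<oplus>\<^bsub>mpoly_ring R V\<^esub> indexed_const y"
      using xy by (auto simp: mpoly_add indexed_padd_const)
  qed (auto simp: mpoly_one)
qed

end

section \<open>Evaluation of polynomials\<close>

locale mpoly_evaluation = S: cring S + T: cring T + h: ring_hom_cring S T h
  for S :: "('a, 'b) ring_scheme" (structure) and T :: "('c, 'd) ring_scheme" (structure) and h +
  fixes V :: "'v set" and v :: "'v \<Rightarrow> 'c"
  assumes v_closed: "i \<in> V \<Longrightarrow> v i \<in> carrier T"
begin

abbreviation "P \<equiv> mpoly_ring S V"
abbreviation "ev \<equiv> mpoly_eval S T h v"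

lemma mset_prod_v [simp]: "set_mset m \<subseteq> V \<Longrightarrow> mset_prod T v m \<in> carrier T"
  using v_closed by (intro T.mset_prod_closed) auto

text \<open>Supports shrink under cancellation, so the defining sums of two polynomials and of their
  sum have to be compared over a common finite superset.\<close>

lemma eval_superset:
  assumes "f \<in> carrier P" "finite A" "{m. f m \<noteq> \<zero>\<^bsub>S\<^esub>} \<subseteq> A" "\<And>m. m \<in> A \<Longrightarrow> set_mset m \<subseteq> V"
  shows "ev f = finsum T (\<lambda>m. h (f m) \<otimes>\<^bsub>T\<^esub> mset_prod T v m) A"
  unfolding mpoly_eval_def
  by (rule T.add.finprod_mono_neutral_cong_left)
    (use assms S.mpoly_coeff_closed[OF assms(1)] in \<open>auto simp: mset_prod_v S.mpoly_support_vars[OF assms(1)] subset_iff\<close>)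

lemma term_closed:
  assumes "f \<in> carrier P" "f m \<noteq> \<zero>\<^bsub>S\<^esub>"
  shows "h (f m) \<otimes>\<^bsub>T\<^esub> mset_prod T v m \<in> carrier T"
  using assms S.mpoly_support_vars[OF assms] S.mpoly_coeff_closed[OF assms(1)] by auto

lemma eval_closed [simp]: "f \<in> carrier P \<Longrightarrow> ev f \<in> carrier T"
  unfolding mpoly_eval_def by (rule T.finsum_closed) (auto intro!: term_closed)

lemma eval_add:
  assumes "f \<in> carrier P" "g \<in> carrier P"
  shows "ev (f \<oplus>\<^bsub>P\<^esub> g) = ev f \<oplus>\<^bsub>T\<^esub> ev g"
proof -
  interpret P: cring P by (rule S.mpoly_ring_cring)
  let ?A = "{m. f m \<noteq> \<zero>\<^bsub>S\<^esub>} \<union> {m. g m \<noteq> \<zero>\<^bsub>S\<^esub>}"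
  have fin: "finite ?A" using assms by (simp add: S.mpoly_finite_support)
  have vars: "m \<in> ?A \<Longrightarrow> set_mset m \<subseteq> V" for m using assms S.mpoly_support_vars by blast
  have "ev (f \<oplus>\<^bsub>P\<^esub> g) = finsum T (\<lambda>m. h ((f \<oplus>\<^bsub>P\<^esub> g) m) \<otimes>\<^bsub>T\<^esub> mset_prod T v m) ?A"
    by (rule eval_superset[OF P.a_closed[OF assms]]) (use assms fin vars in \<open>auto simp: S.mpoly_add S.indexed_padd_def\<close>)
  also have "\<dots> = finsum T (\<lambda>m. h (f m) \<otimes>\<^bsub>T\<^esub> mset_prod T v m \<oplus>\<^bsub>T\<^esub> h (g m) \<otimes>\<^bsub>T\<^esub> mset_prod T v m) ?A"
    by (rule T.add.finprod_cong') (use assms vars in \<open>auto simp: S.mpoly_add S.indexed_padd_def T.l_distr S.mpoly_coeff_closed[OF assms(1)] S.mpoly_coeff_closed[OF assms(2)]\<close>)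
  also have "\<dots> = finsum T (\<lambda>m. h (f m) \<otimes>\<^bsub>T\<^esub> mset_prod T v m) ?A \<oplus>\<^bsub>T\<^esub> finsum T (\<lambda>m. h (g m) \<otimes>\<^bsub>T\<^esub> mset_prod T v m) ?A"
    by (rule T.finsum_addf) (use assms vars S.mpoly_coeff_closed[OF assms(1)] S.mpoly_coeff_closed[OF assms(2)] in auto)
  also have "\<dots> = ev f \<oplus>\<^bsub>T\<^esub> ev g"
    using eval_superset[OF assms(1) fin] eval_superset[OF assms(2) fin] vars by auto
  finally show ?thesis .
qed

lemma eval_const [simp]:
  assumes "k \<in> carrier S"
  shows "ev (S.indexed_const k) = h k"
proof -
  have "ev (S.indexed_const k) = finsum T (\<lambda>m. h (S.indexed_const k m) \<otimes>\<^bsub>T\<^esub> mset_prod T v m) {{#}}"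
    by (rule eval_superset[OF S.mpoly_const_closed[OF assms]]) (auto simp: S.indexed_const_def)
  then show ?thesis using assms by (simp add: S.indexed_const_def)
qed

lemma eval_pmult:
  assumes "f \<in> carrier P" "i \<in> V"
  shows "ev (S.indexed_pmult f i) = v i \<otimes>\<^bsub>T\<^esub> ev f"
proof -
  have c: "f m \<in> carrier S" for m using assms(1) by (rule S.mpoly_coeff_closed)
  have cl: "S.indexed_pmult f i \<in> carrier P"
    using assms by (simp add: S.mpoly_carrier S.indexed_pset.indexed_pmult)
  have fin: "finite {m. f m \<noteq> \<zero>\<^bsub>S\<^esub>}" using assms by (simp add: S.mpoly_finite_support)
  have vars: "f m \<noteq> \<zero>\<^bsub>S\<^esub> \<Longrightarrow> set_mset m \<subseteq> V" for m using assms S.mpoly_support_vars by blast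
  have "ev (S.indexed_pmult f i) = finsum T (\<lambda>m. h (S.indexed_pmult f i m) \<otimes>\<^bsub>T\<^esub> mset_prod T v m) (add_mset i ` {m. f m \<noteq> \<zero>\<^bsub>S\<^esub>})"
  proof (rule eval_superset[OF cl])
    show "{m. S.indexed_pmult f i m \<noteq> \<zero>\<^bsub>S\<^esub>} \<subseteq> add_mset i ` {m. f m \<noteq> \<zero>\<^bsub>S\<^esub>}"
      by (auto simp: S.indexed_pmult_def image_iff split: if_splits) (metis insert_DiffM)
  qed (use fin assms in \<open>auto dest: subsetD[OF vars]\<close>)
  also have "\<dots> = finsum T (\<lambda>m. h (S.indexed_pmult f i (add_mset i m)) \<otimes>\<^bsub>T\<^esub> mset_prod T v (add_mset i m)) {m. f m \<noteq> \<zero>\<^bsub>S\<^esub>}"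
    by (rule T.add.finprod_reindex) (use vars assms c in \<open>auto simp: inj_on_def S.indexed_pmult_def\<close>)
  also have "\<dots> = finsum T (\<lambda>m. v i \<otimes>\<^bsub>T\<^esub> (h (f m) \<otimes>\<^bsub>T\<^esub> mset_prod T v m)) {m. f m \<noteq> \<zero>\<^bsub>S\<^esub>}"
  proof (rule T.add.finprod_cong')
    fix m assume "m \<in> {m. f m \<noteq> \<zero>\<^bsub>S\<^esub>}"
    then have m: "set_mset m \<subseteq> V" using vars by auto
    then have "mset_prod T v (add_mset i m) = v i \<otimes>\<^bsub>T\<^esub> mset_prod T v m"
      by (intro T.mset_prod_add_mset) (use v_closed assms in auto)
    then show "h (S.indexed_pmult f i (add_mset i m)) \<otimes>\<^bsub>T\<^esub> mset_prod T v (add_mset i m) = v i \<otimes>\<^bsub>T\<^esub> (h (f m) \<otimes>\<^bsub>T\<^esub> mset_prod T v m)"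
      using m c v_closed[OF assms(2)] by (simp add: S.indexed_pmult_def T.m_lcomm)
  qed (use c v_closed assms in \<open>auto simp: vars term_closed\<close>)
  also have "\<dots> = v i \<otimes>\<^bsub>T\<^esub> ev f"
    unfolding mpoly_eval_def by (rule T.finsum_rdistr[symmetric]) (use fin vars c v_closed assms in auto)
  finally show ?thesis .
qed

lemma eval_var [simp]:
  assumes "i \<in> V"
  shows "ev (S.indexed_var i) = v i"
  using eval_pmult[of "S.indexed_const \<one>\<^bsub>S\<^esub>" i] assms v_closed unfolding S.indexed_var_def by simp

lemma eval_hom: "ring_hom_cring P T ev"
proof -
  interpret P: cring P by (rule S.mpoly_ring_cring)
  show ?thesis
  proof (rule ring_hom_cringI[OF P.is_cring T.is_cring ring_hom_memI])
    fix f g assume fg: "f \<in> carrier P" "g \<in> carrier P"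
    \<comment> \<open>Induction on \<open>f\<close> leaves only products with a constant or with a
      variable.\<close>
    show "ev (f \<otimes>\<^bsub>P\<^esub> g) = ev f \<otimes>\<^bsub>T\<^esub> ev g" using fg(1)
    proof (induction rule: S.mpoly_induct)
      case (const k)
      have c: "g m \<in> carrier S" for m using fg(2) by (rule S.mpoly_coeff_closed)
      have "ev (S.indexed_const k \<otimes>\<^bsub>P\<^esub> g) = finsum T (\<lambda>m. h ((S.indexed_const k \<otimes>\<^bsub>P\<^esub> g) m) \<otimes>\<^bsub>T\<^esub> mset_prod T v m) {m. g m \<noteq> \<zero>\<^bsub>S\<^esub>}"
        by (rule eval_superset[OF P.m_closed[OF S.mpoly_const_closed[OF const] fg(2)]])
          (use const c S.mpoly_support_vars[OF fg(2)] S.mpoly_finite_support[OF fg(2)] in \<open>auto simp: S.mpoly_mult_const S.mpoly_mult_eq\<close>)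
      also have "\<dots> = finsum T (\<lambda>m. h k \<otimes>\<^bsub>T\<^esub> (h (g m) \<otimes>\<^bsub>T\<^esub> mset_prod T v m)) {m. g m \<noteq> \<zero>\<^bsub>S\<^esub>}"
        by (rule T.add.finprod_cong')
          (use fg const c S.mpoly_support_vars[OF fg(2)] in \<open>auto simp: S.mpoly_mult_const S.mpoly_mult_eq T.m_assoc\<close>)
      also have "\<dots> = h k \<otimes>\<^bsub>T\<^esub> ev g"
        unfolding mpoly_eval_def by (rule T.finsum_rdistr[symmetric])
          (use fg const c S.mpoly_support_vars[OF fg(2)] S.mpoly_finite_support[OF fg(2)] in auto)
      finally show ?case using const by simp
    next
      case (add a b)
      then show ?case using fg by (simp add: P.l_distr T.l_distr eval_add)
    next
      case (var a i)
      then have "ev (S.indexed_var i \<otimes>\<^bsub>P\<^esub> a) = v i \<otimes>\<^bsub>T\<^esub> ev a"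
        using eval_pmult[of a i] S.mpoly_pmult_eq[of a V i] by simp
      moreover have "ev (S.indexed_var i \<otimes>\<^bsub>P\<^esub> a \<otimes>\<^bsub>P\<^esub> g) = v i \<otimes>\<^bsub>T\<^esub> ev (a \<otimes>\<^bsub>P\<^esub> g)"
        using var fg eval_pmult[of "a \<otimes>\<^bsub>P\<^esub> g" i] S.mpoly_pmult_eq[of "a \<otimes>\<^bsub>P\<^esub> g" V i] P.m_assoc[of "S.indexed_var i" a g] by simp
      ultimately show ?case using var fg v_closed by (simp add: T.m_assoc)
    qed
  qed (auto simp: eval_add S.mpoly_one)
qed

end

section \<open>Height and local generation\<close>

text \<open>Phrased with primes of \<open>R\<close> inside \<open>p\<close>, so that chains can be
  built and refuted without entering the local ring; \<open>height_ge_iff\<close>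
  translates.\<close>

definition height_ge :: "('a, 'b) ring_scheme \<Rightarrow> 'a set \<Rightarrow> nat \<Rightarrow> bool"
  where "height_ge R p k \<longleftrightarrow> (\<exists>P. (\<forall>i\<le>k. primeideal (P i) R) \<and> (\<forall>i<k. P i \<subset> P (Suc i)) \<and> P k \<subseteq> p)"

text \<open>Generation of the localized ideal with denominators cleared: the generators stay in
  \<open>I\<close> itself, and \<open>locally_generated_iff\<close> relates this to
  \<open>min_num_gens\<close>.\<close>

definition locally_generated :: "('a, 'b) ring_scheme \<Rightarrow> 'a set \<Rightarrow> 'a set \<Rightarrow> nat \<Rightarrow> bool"
  where "locally_generated R p I k \<longleftrightarrow> (\<exists>A\<subseteq>I. finite A \<and> card A \<le> k
    \<and> (\<forall>x\<in>I. \<exists>s\<in>carrier R - p. s \<otimes>\<^bsub>R\<^esub> x \<in> Idl\<^bsub>R\<^esub> A))"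

context cring begin

lemma idealI_cring:
  assumes "J \<subseteq> carrier R" "\<zero> \<in> J" "\<And>a b. a \<in> J \<Longrightarrow> b \<in> J \<Longrightarrow> a \<oplus> b \<in> J"
    and mult: "\<And>a r. a \<in> J \<Longrightarrow> r \<in> carrier R \<Longrightarrow> r \<otimes> a \<in> J"
  shows "ideal J R"
proof (rule idealI[OF ring_axioms])
  show "subgroup J (add_monoid R)"
  proof (rule group.subgroupI[OF a_group])
    fix a assume a: "a \<in> J"
    then have "\<ominus> a = (\<ominus> \<one>) \<otimes> a" using assms(1) by (simp add: l_minus subset_iff)
    then have "\<ominus> a \<in> J" using mult[OF a, of "\<ominus> \<one>"] by simp
    then show "inv\<^bsub>add_monoid R\<^esub> a \<in> J" by (simp add: a_inv_def)
  qed (use assms in auto)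
qed (use assms m_comm subsetD[OF assms(1)] in auto)

text \<open>This is transitivity of equality of fractions. The middle denominator \<open>u\<close>
  has to join the multiplier, because the two hypotheses can only be linked through \<open>b\<close>
  after multiplying by it.\<close>

lemma frac_trans_identity:
  assumes "a \<in> carrier R" "b \<in> carrier R" "c \<in> carrier R" "s \<in> carrier R" "u \<in> carrier R" "v \<in> carrier R"
    "w \<in> carrier R" "w' \<in> carrier R"
    and "w \<otimes> (u \<otimes> a) = w \<otimes> (s \<otimes> b)" "w' \<otimes> (v \<otimes> b) = w' \<otimes> (u \<otimes> c)"
  shows "(w \<otimes> w' \<otimes> u) \<otimes> (v \<otimes> a) = (w \<otimes> w' \<otimes> u) \<otimes> (s \<otimes> c)"
proof -
  have "(w \<otimes> w' \<otimes> u) \<otimes> (v \<otimes> a) = (w \<otimes> (u \<otimes> a)) \<otimes> (w' \<otimes> v)" using assms(1-8) by (simp add: l_distr r_distr m_ac a_ac)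
  also have "\<dots> = (w \<otimes> (s \<otimes> b)) \<otimes> (w' \<otimes> v)" by (simp only: assms)
  also have "\<dots> = (w \<otimes> s) \<otimes> (w' \<otimes> (v \<otimes> b))" using assms(1-8) by (simp add: l_distr r_distr m_ac a_ac)
  also have "\<dots> = (w \<otimes> s) \<otimes> (w' \<otimes> (u \<otimes> c))" by (simp only: assms)
  also have "\<dots> = (w \<otimes> w' \<otimes> u) \<otimes> (s \<otimes> c)" using assms(1-8) by (simp add: l_distr r_distr m_ac a_ac)
  finally show ?thesis .
qed

lemma frac_mult_identity:
  assumes "a \<in> carrier R" "b \<in> carrier R" "s \<in> carrier R" "u \<in> carrier R" "w \<in> carrier R"
    "a' \<in> carrier R" "b' \<in> carrier R" "s' \<in> carrier R" "u' \<in> carrier R" "w' \<in> carrier R"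
    and "w \<otimes> (u \<otimes> a) = w \<otimes> (s \<otimes> b)" "w' \<otimes> (u' \<otimes> a') = w' \<otimes> (s' \<otimes> b')"
  shows "(w \<otimes> w') \<otimes> ((u \<otimes> u') \<otimes> (a \<otimes> a')) = (w \<otimes> w') \<otimes> ((s \<otimes> s') \<otimes> (b \<otimes> b'))"
proof -
  have "(w \<otimes> w') \<otimes> ((u \<otimes> u') \<otimes> (a \<otimes> a')) = (w \<otimes> (u \<otimes> a)) \<otimes> (w' \<otimes> (u' \<otimes> a'))" using assms(1-10) by (simp add: l_distr r_distr m_ac a_ac)
  also have "\<dots> = (w \<otimes> (s \<otimes> b)) \<otimes> (w' \<otimes> (s' \<otimes> b'))" by (simp only: assms)
  also have "\<dots> = (w \<otimes> w') \<otimes> ((s \<otimes> s') \<otimes> (b \<otimes> b'))" using assms(1-10) by (simp add: l_distr r_distr m_ac a_ac)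
  finally show ?thesis .
qed

lemma frac_add_identity:
  assumes "a \<in> carrier R" "b \<in> carrier R" "s \<in> carrier R" "u \<in> carrier R" "w \<in> carrier R"
    "a' \<in> carrier R" "b' \<in> carrier R" "s' \<in> carrier R" "u' \<in> carrier R" "w' \<in> carrier R"
    and "w \<otimes> (u \<otimes> a) = w \<otimes> (s \<otimes> b)" "w' \<otimes> (u' \<otimes> a') = w' \<otimes> (s' \<otimes> b')"
  shows "(w \<otimes> w') \<otimes> ((u \<otimes> u') \<otimes> (s' \<otimes> a \<oplus> s \<otimes> a')) = (w \<otimes> w') \<otimes> ((s \<otimes> s') \<otimes> (u' \<otimes> b \<oplus> u \<otimes> b'))"
proof -
  have "(w \<otimes> w') \<otimes> ((u \<otimes> u') \<otimes> (s' \<otimes> a \<oplus> s \<otimes> a'))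
    = (w \<otimes> (u \<otimes> a)) \<otimes> (w' \<otimes> u' \<otimes> s') \<oplus> (w' \<otimes> (u' \<otimes> a')) \<otimes> (w \<otimes> u \<otimes> s)" using assms(1-10) by (simp add: l_distr r_distr m_ac a_ac)
  also have "\<dots> = (w \<otimes> (s \<otimes> b)) \<otimes> (w' \<otimes> u' \<otimes> s') \<oplus> (w' \<otimes> (s' \<otimes> b')) \<otimes> (w \<otimes> u \<otimes> s)" by (simp only: assms)
  also have "\<dots> = (w \<otimes> w') \<otimes> ((s \<otimes> s') \<otimes> (u' \<otimes> b \<oplus> u \<otimes> b'))" using assms(1-10) by (simp add: l_distr r_distr m_ac a_ac)
  finally show ?thesis .
qed

lemma frac_assoc_identity:
  assumes "a \<in> carrier R" "s \<in> carrier R" "b \<in> carrier R" "t \<in> carrier R" "c \<in> carrier R" "u \<in> carrier R"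
  shows "u \<otimes> (t \<otimes> a \<oplus> s \<otimes> b) \<oplus> (s \<otimes> t) \<otimes> c = (t \<otimes> u) \<otimes> a \<oplus> s \<otimes> (u \<otimes> b \<oplus> t \<otimes> c)"
  using assms by (simp add: l_distr r_distr m_ac a_ac)

lemma frac_distr_identity:
  assumes "a \<in> carrier R" "s \<in> carrier R" "b \<in> carrier R" "t \<in> carrier R" "c \<in> carrier R" "u \<in> carrier R"
  shows "((s \<otimes> u) \<otimes> (t \<otimes> u)) \<otimes> ((t \<otimes> a \<oplus> s \<otimes> b) \<otimes> c) = ((s \<otimes> t) \<otimes> u) \<otimes> ((t \<otimes> u) \<otimes> (a \<otimes> c) \<oplus> (s \<otimes> u) \<otimes> (b \<otimes> c))"
  using assms by (simp add: l_distr r_distr m_ac a_ac)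

end

section \<open>Localization at a prime\<close>

locale localization_at_prime = primeideal p R for p and R (structure)
begin

abbreviation "W \<equiv> carrier R - p"
abbreviation "fr \<equiv> fraction R W"
abbreviation "L \<equiv> local_ring_at R p"

lemma W_one: "\<one> \<in> W"
  using I_notcarr one_imp_carrier by auto

lemma W_mult: "s \<in> W \<Longrightarrow> u \<in> W \<Longrightarrow> s \<otimes> u \<in> W"
  using I_prime by auto

lemma W_carr: "s \<in> W \<Longrightarrow> s \<in> carrier R"
  by auto

lemma rel_iff:
  "((a, s), (b, u)) \<in> frac_rel R W \<longleftrightarrow> a \<in> carrier R \<and> s \<in> W \<and> b \<in> carrier R \<and> u \<in> W
    \<and> (\<exists>w\<in>W. w \<otimes> (u \<otimes> a) = w \<otimes> (s \<otimes> b))"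
proof -
  have "(w \<otimes> (u \<otimes> a \<ominus> s \<otimes> b) = \<zero>) \<longleftrightarrow> w \<otimes> (u \<otimes> a) = w \<otimes> (s \<otimes> b)"
    if "a \<in> carrier R" "s \<in> W" "b \<in> carrier R" "u \<in> W" "w \<in> W" for w
  proof -
    have "w \<otimes> (u \<otimes> a \<ominus> s \<otimes> b) = w \<otimes> (u \<otimes> a) \<ominus> w \<otimes> (s \<otimes> b)"
      using that by (simp add: a_minus_def r_distr r_minus)
    then show ?thesis using that by (simp add: r_right_minus_eq)
  qed
  then show ?thesis unfolding frac_rel_def by auto
qed

lemma equiv_frac: "equiv (carrier R \<times> W) (frac_rel R W)"
proof (rule equivI)
  show "frac_rel R W \<subseteq> (carrier R \<times> W) \<times> (carrier R \<times> W)" by (auto simp: frac_rel_def)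
  show "refl_on (carrier R \<times> W) (frac_rel R W)"
    by (rule refl_onI) (use W_one in \<open>auto simp: rel_iff\<close>)
  show "sym (frac_rel R W)"
  proof (rule symI)
    fix x y assume xy: "(x, y) \<in> frac_rel R W"
    obtain a s b u where [simp]: "x = (a, s)" "y = (b, u)" by (metis prod.exhaust)
    show "(y, x) \<in> frac_rel R W" using xy by (simp only: rel_iff \<open>x = _\<close> \<open>y = _\<close>) metis
  qed
  show "trans (frac_rel R W)"
  proof (rule transI)
    fix x y z assume xy: "(x, y) \<in> frac_rel R W" and yz: "(y, z) \<in> frac_rel R W"
    obtain a s b u c v where [simp]: "x = (a, s)" "y = (b, u)" "z = (c, v)" by (metis prod.exhaust)
    obtain w w' where w: "w \<in> W" "w' \<in> W" "w \<otimes> (u \<otimes> a) = w \<otimes> (s \<otimes> b)" "w' \<otimes> (v \<otimes> b) = w' \<otimes> (u \<otimes> c)"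
      using xy yz by (auto simp: rel_iff)
    have c: "a \<in> carrier R" "b \<in> carrier R" "c \<in> carrier R" "s \<in> W" "u \<in> W" "v \<in> W"
      using xy yz by (auto simp: rel_iff)
    have "(w \<otimes> w' \<otimes> u) \<otimes> (v \<otimes> a) = (w \<otimes> w' \<otimes> u) \<otimes> (s \<otimes> c)"
      by (rule frac_trans_identity[OF _ _ _ _ _ _ _ _ w(3,4)]) (use w(1,2) c in simp_all)
    moreover have "w \<otimes> w' \<otimes> u \<in> W" using w c W_mult by blast
    ultimately show "(x, z) \<in> frac_rel R W" using c by (auto simp only: rel_iff \<open>x = _\<close> \<open>z = _\<close>)
  qed
qed

lemma frac_eq_iff:
  assumes "a \<in> carrier R" "s \<in> W" "b \<in> carrier R" "u \<in> W"
  shows "fr a s = fr b u \<longleftrightarrow> (\<exists>w\<in>W. w \<otimes> (u \<otimes> a) = w \<otimes> (s \<otimes> b))"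
proof -
  have "fr a s = fr b u \<longleftrightarrow> ((a, s), (b, u)) \<in> frac_rel R W"
    unfolding fraction_def by (rule eq_equiv_class_iff[OF equiv_frac]) (use assms in auto)
  then show ?thesis using assms by (simp only: rel_iff) blast
qed

lemma frac_eqI:
  assumes "a \<in> carrier R" "s \<in> W" "b \<in> carrier R" "u \<in> W" "u \<otimes> a = s \<otimes> b"
  shows "fr a s = fr b u"
  unfolding frac_eq_iff[OF assms(1-4)] using W_one assms(5) by (auto intro!: bexI[of _ \<one>])

lemma L_carrier: "carrier L = {fr a s | a s. a \<in> carrier R \<and> s \<in> W}"
  unfolding local_ring_at_def localization_def fraction_def quotient_def by auto

lemma frac_closed [simp]: "a \<in> carrier R \<Longrightarrow> s \<in> W \<Longrightarrow> fr a s \<in> carrier L"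
  unfolding L_carrier by blast

lemma L_cases:
  assumes "x \<in> carrier L"
  obtains a s where "a \<in> carrier R" "s \<in> W" "x = fr a s"
  using assms unfolding L_carrier by blast

lemma L_mult:
  assumes "a \<in> carrier R" "s \<in> W" "b \<in> carrier R" "u \<in> W"
  shows "fr a s \<otimes>\<^bsub>L\<^esub> fr b u = fr (a \<otimes> b) (s \<otimes> u)"
proof -
  let ?f = "\<lambda>x y. fr (fst x \<otimes> fst y) (snd x \<otimes> snd y)"
  have "congruent2 (frac_rel R W) (frac_rel R W) ?f"
  proof (rule congruent2I')
    fix x1 x2 y1 y2 assume 1: "(x1, x2) \<in> frac_rel R W" and 2: "(y1, y2) \<in> frac_rel R W"
    obtain a s b u a' s' b' u' where [simp]: "x1 = (a, s)" "x2 = (b, u)" "y1 = (a', s')" "y2 = (b', u')"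
      by (metis prod.exhaust)
    obtain w w' where w: "w \<in> W" "w' \<in> W" "w \<otimes> (u \<otimes> a) = w \<otimes> (s \<otimes> b)" "w' \<otimes> (u' \<otimes> a') = w' \<otimes> (s' \<otimes> b')"
      using 1 2 by (auto simp: rel_iff)
    have c: "a \<in> carrier R" "b \<in> carrier R" "s \<in> W" "u \<in> W" "a' \<in> carrier R" "b' \<in> carrier R" "s' \<in> W" "u' \<in> W"
      using 1 2 by (auto simp: rel_iff)
    have "(w \<otimes> w') \<otimes> ((u \<otimes> u') \<otimes> (a \<otimes> a')) = (w \<otimes> w') \<otimes> ((s \<otimes> s') \<otimes> (b \<otimes> b'))"
      by (rule frac_mult_identity[OF _ _ _ _ _ _ _ _ _ _ w(3,4)]) (use w(1,2) c in simp_all)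
    moreover have "w \<otimes> w' \<in> W" "s \<otimes> s' \<in> W" "u \<otimes> u' \<in> W" using w c W_mult by blast+
    ultimately show "?f x1 y1 = ?f x2 y2"
      using c frac_eq_iff[of "a \<otimes> a'" "s \<otimes> s'" "b \<otimes> b'" "u \<otimes> u'"] by (auto simp: W_carr simp del: Diff_iff)
  qed
  from UN_equiv_class2[OF equiv_frac equiv_frac this, of "(a, s)" "(b, u)"]
  show ?thesis using assms by (simp add: local_ring_at_def localization_def fraction_def)
qed

lemma L_add:
  assumes "a \<in> carrier R" "s \<in> W" "b \<in> carrier R" "u \<in> W"
  shows "fr a s \<oplus>\<^bsub>L\<^esub> fr b u = fr (u \<otimes> a \<oplus> s \<otimes> b) (s \<otimes> u)"
proof -
  let ?f = "\<lambda>x y. fr (snd y \<otimes> fst x \<oplus> snd x \<otimes> fst y) (snd x \<otimes> snd y)"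
  have "congruent2 (frac_rel R W) (frac_rel R W) ?f"
  proof (rule congruent2I')
    fix x1 x2 y1 y2 assume 1: "(x1, x2) \<in> frac_rel R W" and 2: "(y1, y2) \<in> frac_rel R W"
    obtain a s b u a' s' b' u' where [simp]: "x1 = (a, s)" "x2 = (b, u)" "y1 = (a', s')" "y2 = (b', u')"
      by (metis prod.exhaust)
    obtain w w' where w: "w \<in> W" "w' \<in> W" "w \<otimes> (u \<otimes> a) = w \<otimes> (s \<otimes> b)" "w' \<otimes> (u' \<otimes> a') = w' \<otimes> (s' \<otimes> b')"
      using 1 2 by (auto simp: rel_iff)
    have c: "a \<in> carrier R" "b \<in> carrier R" "s \<in> W" "u \<in> W" "a' \<in> carrier R" "b' \<in> carrier R" "s' \<in> W" "u' \<in> W"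
      using 1 2 by (auto simp: rel_iff)
    have "(w \<otimes> w') \<otimes> ((u \<otimes> u') \<otimes> (s' \<otimes> a \<oplus> s \<otimes> a')) = (w \<otimes> w') \<otimes> ((s \<otimes> s') \<otimes> (u' \<otimes> b \<oplus> u \<otimes> b'))"
      by (rule frac_add_identity[OF _ _ _ _ _ _ _ _ _ _ w(3,4)]) (use w(1,2) c in simp_all)
    moreover have "w \<otimes> w' \<in> W" "s \<otimes> s' \<in> W" "u \<otimes> u' \<in> W" using w c W_mult by blast+
    ultimately show "?f x1 y1 = ?f x2 y2"
      using c frac_eq_iff[of "s' \<otimes> a \<oplus> s \<otimes> a'" "s \<otimes> s'" "u' \<otimes> b \<oplus> u \<otimes> b'" "u \<otimes> u'"] by (auto simp: W_carr simp del: Diff_iff)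
  qed
  from UN_equiv_class2[OF equiv_frac equiv_frac this, of "(a, s)" "(b, u)"]
  show ?thesis using assms by (simp add: local_ring_at_def localization_def fraction_def)
qed

lemma L_one: "\<one>\<^bsub>L\<^esub> = fr \<one> \<one>"
  by (simp add: local_ring_at_def localization_def)

lemma L_zero: "\<zero>\<^bsub>L\<^esub> = fr \<zero> \<one>"
  by (simp add: local_ring_at_def localization_def)

lemma frac_zero: "s \<in> W \<Longrightarrow> fr \<zero> s = fr \<zero> \<one>"
  by (rule frac_eqI) (use W_one in auto)

lemma L_cring: "cring L"
proof (rule cringI)
  show "abelian_group L"
  proof (rule abelian_groupI)
    fix x y assume "x \<in> carrier L" "y \<in> carrier L"
    then obtain a s b t where x: "a \<in> carrier R" "s \<in> W" "x = fr a s" "b \<in> carrier R" "t \<in> W" "y = fr b t"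
      by (metis L_cases)
    then show "x \<oplus>\<^bsub>L\<^esub> y \<in> carrier L" using W_mult[of s t] by (simp add: L_add W_carr del: Diff_iff)
    show "x \<oplus>\<^bsub>L\<^esub> y = y \<oplus>\<^bsub>L\<^esub> x" using x by (simp add: L_add m_comm[of s t] a_comm W_carr del: Diff_iff)
    fix z assume "z \<in> carrier L"
    then obtain c u where z: "c \<in> carrier R" "u \<in> W" "z = fr c u" by (metis L_cases)
    have "x \<oplus>\<^bsub>L\<^esub> y \<oplus>\<^bsub>L\<^esub> z = fr (u \<otimes> (t \<otimes> a \<oplus> s \<otimes> b) \<oplus> (s \<otimes> t) \<otimes> c) (s \<otimes> t \<otimes> u)"
      using x z W_mult[of s t] by (simp add: L_add W_carr del: Diff_iff)
    moreover have "x \<oplus>\<^bsub>L\<^esub> (y \<oplus>\<^bsub>L\<^esub> z) = fr ((t \<otimes> u) \<otimes> a \<oplus> s \<otimes> (u \<otimes> b \<oplus> t \<otimes> c)) (s \<otimes> (t \<otimes> u))"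
      using x z W_mult[of t u] by (simp add: L_add W_carr del: Diff_iff)
    ultimately show "x \<oplus>\<^bsub>L\<^esub> y \<oplus>\<^bsub>L\<^esub> z = x \<oplus>\<^bsub>L\<^esub> (y \<oplus>\<^bsub>L\<^esub> z)"
      using x z frac_assoc_identity[of a s b t c u] by (simp add: m_assoc)
  next
    show "\<zero>\<^bsub>L\<^esub> \<in> carrier L" using W_one by (simp add: L_zero)
  next
    fix x assume "x \<in> carrier L"
    then obtain a s where x: "a \<in> carrier R" "s \<in> W" "x = fr a s" by (metis L_cases)
    then show "\<zero>\<^bsub>L\<^esub> \<oplus>\<^bsub>L\<^esub> x = x" using W_one by (simp add: L_zero L_add W_carr del: Diff_iff)
    have "fr (\<ominus> a) s \<oplus>\<^bsub>L\<^esub> x = fr (s \<otimes> (\<ominus> a) \<oplus> s \<otimes> a) (s \<otimes> s)"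
      using x by (simp add: L_add W_carr del: Diff_iff)
    also have "s \<otimes> (\<ominus> a) \<oplus> s \<otimes> a = \<zero>" using x by (simp add: r_minus l_neg)
    also have "fr \<zero> (s \<otimes> s) = \<zero>\<^bsub>L\<^esub>" using x W_mult[of s s] by (simp add: L_zero frac_zero W_carr del: Diff_iff)
    finally show "\<exists>y\<in>carrier L. y \<oplus>\<^bsub>L\<^esub> x = \<zero>\<^bsub>L\<^esub>" using x by (intro bexI[of _ "fr (\<ominus> a) s"]) auto
  qed
  show "comm_monoid L"
  proof (rule comm_monoidI)
    fix x y assume "x \<in> carrier L" "y \<in> carrier L"
    then obtain a s b t where x: "a \<in> carrier R" "s \<in> W" "x = fr a s" "b \<in> carrier R" "t \<in> W" "y = fr b t"
      by (metis L_cases)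
    then show "x \<otimes>\<^bsub>L\<^esub> y \<in> carrier L" using W_mult[of s t] by (simp add: L_mult W_carr del: Diff_iff)
    show "x \<otimes>\<^bsub>L\<^esub> y = y \<otimes>\<^bsub>L\<^esub> x" using x by (simp add: L_mult m_comm[of s t] m_comm[of a b] W_carr del: Diff_iff)
    fix z assume "z \<in> carrier L"
    then obtain c u where z: "c \<in> carrier R" "u \<in> W" "z = fr c u" by (metis L_cases)
    show "x \<otimes>\<^bsub>L\<^esub> y \<otimes>\<^bsub>L\<^esub> z = x \<otimes>\<^bsub>L\<^esub> (y \<otimes>\<^bsub>L\<^esub> z)"
      using x z W_mult[of s t] W_mult[of t u] by (simp add: L_mult m_assoc W_carr del: Diff_iff)
  next
    show "\<one>\<^bsub>L\<^esub> \<in> carrier L" using W_one by (simp add: L_one)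
  next
    fix x assume "x \<in> carrier L"
    then obtain a s where x: "a \<in> carrier R" "s \<in> W" "x = fr a s" by (metis L_cases)
    then show "\<one>\<^bsub>L\<^esub> \<otimes>\<^bsub>L\<^esub> x = x" using W_one by (simp add: L_one L_mult W_carr del: Diff_iff)
  qed
  fix x y z assume "x \<in> carrier L" "y \<in> carrier L" "z \<in> carrier L"
  then obtain a s b t c u where x: "a \<in> carrier R" "s \<in> W" "x = fr a s" "b \<in> carrier R" "t \<in> W" "y = fr b t"
     "c \<in> carrier R" "u \<in> W" "z = fr c u"
    by (metis L_cases)
  have m: "s \<otimes> t \<in> W" "s \<otimes> u \<in> W" "t \<otimes> u \<in> W" using W_mult x by blast+
  have "(x \<oplus>\<^bsub>L\<^esub> y) \<otimes>\<^bsub>L\<^esub> z = fr ((t \<otimes> a \<oplus> s \<otimes> b) \<otimes> c) ((s \<otimes> t) \<otimes> u)"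
    using x m by (simp add: L_mult L_add W_carr del: Diff_iff)
  also have "\<dots> = fr ((t \<otimes> u) \<otimes> (a \<otimes> c) \<oplus> (s \<otimes> u) \<otimes> (b \<otimes> c)) ((s \<otimes> u) \<otimes> (t \<otimes> u))"
    by (rule frac_eqI) (use x m W_mult in \<open>auto simp: W_carr simp del: Diff_iff simp: frac_distr_identity\<close>)
  also have "\<dots> = x \<otimes>\<^bsub>L\<^esub> z \<oplus>\<^bsub>L\<^esub> y \<otimes>\<^bsub>L\<^esub> z"
    using x m by (simp add: L_mult L_add W_carr del: Diff_iff)
  finally show "(x \<oplus>\<^bsub>L\<^esub> y) \<otimes>\<^bsub>L\<^esub> z = x \<otimes>\<^bsub>L\<^esub> z \<oplus>\<^bsub>L\<^esub> y \<otimes>\<^bsub>L\<^esub> z" .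
qed

sublocale L: cring L by (rule L_cring)

abbreviation "\<iota> \<equiv> \<lambda>a. fr a \<one>"

lemma iota_hom: "ring_hom_cring R L \<iota>"
proof (rule ring_hom_cringI[OF is_cring L_cring ring_hom_memI])
  fix x y assume "x \<in> carrier R" "y \<in> carrier R"
  then show "\<iota> (x \<otimes> y) = \<iota> x \<otimes>\<^bsub>L\<^esub> \<iota> y" "\<iota> (x \<oplus> y) = \<iota> x \<oplus>\<^bsub>L\<^esub> \<iota> y"
    using W_one by (simp_all add: L_mult L_add)
qed (use W_one in \<open>auto simp: L_one\<close>)

sublocale \<iota>: ring_hom_cring R L \<iota> by (rule iota_hom)

lemma frac_eq_mult:
  assumes "a \<in> carrier R" "s \<in> W"
  shows "fr a s = \<iota> a \<otimes>\<^bsub>L\<^esub> fr \<one> s"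
  using assms W_one by (simp add: L_mult W_carr del: Diff_iff)

lemma frac_inverse:
  assumes "s \<in> W"
  shows "\<iota> s \<otimes>\<^bsub>L\<^esub> fr \<one> s = \<one>\<^bsub>L\<^esub>"
proof -
  have "\<iota> s \<otimes>\<^bsub>L\<^esub> fr \<one> s = fr (s \<otimes> \<one>) (\<one> \<otimes> s)" by (rule L_mult) (use assms W_one in auto)
  also have "\<dots> = fr \<one> \<one>" by (rule frac_eqI) (use assms W_one in auto)
  finally show ?thesis unfolding L_one .
qed

lemma frac_cancel:
  assumes "a \<in> carrier R" "s \<in> W" "w \<in> W"
  shows "fr a s = fr (w \<otimes> a) (w \<otimes> s)"
  by (rule frac_eqI) (use assms W_mult[of w s] in \<open>auto simp: m_ac\<close>)

text \<open>Equal fractions agree only after multiplication by an element of \<open>W\<close>, so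
  the numerator decides membership only up to such a multiplier; \<open>prime_mem_iff\<close>
  removes it for primes inside \<open>p\<close>.\<close>

lemma frac_mem_iff:
  assumes J: "ideal J R" and "a \<in> carrier R" "s \<in> W"
  shows "fr a s \<in> local_ideal_at R p J \<longleftrightarrow> (\<exists>w\<in>W. w \<otimes> a \<in> J)"
proof
  interpret J: ideal J R by fact
  assume "fr a s \<in> local_ideal_at R p J"
  then obtain b u where b: "fr a s = fr b u" "b \<in> J" "u \<in> W" by (auto simp: local_ideal_at_def)
  then obtain w where w: "w \<in> W" "w \<otimes> (u \<otimes> a) = w \<otimes> (s \<otimes> b)"
    using frac_eq_iff[of a s b u] assms J.Icarr by auto
  have "w \<otimes> (s \<otimes> b) \<in> J" using w b assms by (auto intro!: J.I_l_closed)
  then have "(w \<otimes> u) \<otimes> a \<in> J" using w b assms by (simp add: m_assoc)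
  then show "\<exists>w\<in>W. w \<otimes> a \<in> J" using W_mult w b by blast
next
  assume "\<exists>w\<in>W. w \<otimes> a \<in> J"
  then obtain w where "w \<in> W" "w \<otimes> a \<in> J" by blast
  then show "fr a s \<in> local_ideal_at R p J"
    using frac_cancel[of a s w] assms W_mult[of w s] unfolding local_ideal_at_def by blast
qed

lemma local_ideal_carrier:
  assumes "ideal J R"
  shows "local_ideal_at R p J \<subseteq> carrier L"
proof -
  interpret J: ideal J R by fact
  show ?thesis unfolding local_ideal_at_def using frac_closed J.Icarr by blast
qed

lemma local_ideal:
  assumes J: "ideal J R"
  shows "ideal (local_ideal_at R p J) L"
proof -
  interpret J: ideal J R by fact
  have add: "x \<oplus>\<^bsub>L\<^esub> y \<in> local_ideal_at R p J" if xy: "x \<in> local_ideal_at R p J" "y \<in> local_ideal_at R p J" for x y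
  proof -
    obtain a s b u where x: "x = fr a s" "a \<in> J" "s \<in> W" "y = fr b u" "b \<in> J" "u \<in> W"
      using xy by (auto simp: local_ideal_at_def)
    have "u \<otimes> a \<oplus> s \<otimes> b \<in> J" using x by (auto intro!: J.I_l_closed J.a_closed)
    then show ?thesis using x W_mult[of s u] by (auto simp: L_add local_ideal_at_def W_carr simp del: Diff_iff)
  qed
  have mult: "y \<otimes>\<^bsub>L\<^esub> x \<in> local_ideal_at R p J" if xy: "x \<in> local_ideal_at R p J" "y \<in> carrier L" for x y
  proof -
    obtain a s where x: "x = fr a s" "a \<in> J" "s \<in> W" using xy by (auto simp: local_ideal_at_def)
    obtain b u where y: "y = fr b u" "b \<in> carrier R" "u \<in> W" using xy by (metis L_cases)
    have "b \<otimes> a \<in> J" using x y by (auto intro!: J.I_l_closed)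
    then show ?thesis using x y W_mult[of u s] by (auto simp: L_mult local_ideal_at_def W_carr simp del: Diff_iff)
  qed
  have sub: "local_ideal_at R p J \<subseteq> carrier L" by (rule local_ideal_carrier[OF J])
  have "\<zero>\<^bsub>L\<^esub> \<in> local_ideal_at R p J"
    unfolding L_zero local_ideal_at_def using W_one J.zero_closed by blast
  then show ?thesis by (intro L.idealI_cring sub add mult)
qed

lemma prime_mem_iff:
  assumes P: "primeideal P R" "P \<subseteq> p" and "a \<in> carrier R" "s \<in> W"
  shows "fr a s \<in> local_ideal_at R p P \<longleftrightarrow> a \<in> P"
proof -
  interpret P: primeideal P R by fact
  show ?thesis unfolding frac_mem_iff[OF P.is_ideal assms(3,4)]
  proof
    assume "\<exists>w\<in>W. w \<otimes> a \<in> P"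
    then show "a \<in> P" using P.I_prime assms by blast
  next
    assume "a \<in> P" then show "\<exists>w\<in>W. w \<otimes> a \<in> P" using W_one P.I_l_closed by blast
  qed
qed

lemma local_prime:
  assumes P: "primeideal P R" "P \<subseteq> p"
  shows "primeideal (local_ideal_at R p P) L"
proof -
  interpret P: primeideal P R by fact
  show ?thesis
  proof (rule primeidealI[OF local_ideal[OF P.is_ideal] L_cring])
    have "\<one>\<^bsub>L\<^esub> \<notin> local_ideal_at R p P"
    proof -
      have "\<one> \<notin> P" using W_one P(2) by blast
      then show ?thesis using prime_mem_iff[OF P one_closed W_one] unfolding L_one by blast
    qed
    then show "carrier L \<noteq> local_ideal_at R p P" using L.one_closed by blast
    fix x y assume "x \<in> carrier L" "y \<in> carrier L" and xy: "x \<otimes>\<^bsub>L\<^esub> y \<in> local_ideal_at R p P"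
    then obtain a s b t where x: "a \<in> carrier R" "s \<in> W" "x = fr a s" "b \<in> carrier R" "t \<in> W" "y = fr b t"
      by (metis L_cases)
    have "a \<otimes> b \<in> P" using xy x W_mult[of s t] prime_mem_iff[OF P, of "a \<otimes> b" "s \<otimes> t"] by (simp add: L_mult W_carr del: Diff_iff)
    then have "a \<in> P \<or> b \<in> P" using P.I_prime x by blast
    then show "x \<in> local_ideal_at R p P \<or> y \<in> local_ideal_at R p P"
      using x prime_mem_iff[OF P] by (simp add: W_carr del: Diff_iff)
  qed
qed

lemma contraction_prime:
  assumes "primeideal Q L"
  shows "primeideal {a \<in> carrier R. \<iota> a \<in> Q} R"
proof -
  interpret Q: primeideal Q L by fact
  have "\<one>\<^bsub>L\<^esub> \<notin> Q" using Q.I_notcarr Q.one_imp_carrier by auto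
  have "ideal {a \<in> carrier R. \<iota> a \<in> Q} R"
    by (rule idealI_cring) (use Q.zero_closed in \<open>auto simp: Q.a_closed Q.I_l_closed\<close>)
  then show ?thesis
  proof (rule primeidealI[OF _ is_cring])
    show "carrier R \<noteq> {a \<in> carrier R. \<iota> a \<in> Q}"
      using \<open>\<one>\<^bsub>L\<^esub> \<notin> Q\<close> \<iota>.hom_one one_closed by (metis (no_types, lifting) mem_Collect_eq)
  qed (use Q.I_prime in auto)
qed

text \<open>A fraction in \<open>Q\<close> but not in \<open>P\<close> has a numerator with the same
  property, since its denominator is a unit in \<open>L\<close>.\<close>

lemma contraction_strict:
  assumes "primeideal P L" "primeideal Q L" "P \<subset> Q"
  shows "{a \<in> carrier R. \<iota> a \<in> P} \<subset> {a \<in> carrier R. \<iota> a \<in> Q}"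
proof -
  interpret P: primeideal P L by fact
  interpret Q: primeideal Q L by fact
  obtain x where x: "x \<in> Q" "x \<notin> P" using assms(3) by blast
  then obtain a s where a: "a \<in> carrier R" "s \<in> W" "x = fr a s" using Q.Icarr by (metis L_cases)
  have "\<iota> a = \<iota> s \<otimes>\<^bsub>L\<^esub> x" using a W_one by (simp add: L_mult W_carr del: Diff_iff) (rule frac_eqI, use W_one in \<open>auto simp: m_ac\<close>)
  then have "\<iota> a \<in> Q" using x a by (simp add: Q.I_l_closed)
  moreover have "\<iota> a \<notin> P"
  proof
    assume "\<iota> a \<in> P"
    then have "\<iota> a \<otimes>\<^bsub>L\<^esub> fr \<one> s \<in> P" using a by (simp add: P.I_r_closed W_carr del: Diff_iff)
    then show False using frac_eq_mult[OF a(1,2)] a x by simp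
  qed
  ultimately show ?thesis using assms(3) a by blast
qed

lemma contraction_le:
  assumes "primeideal Q L"
  shows "{a \<in> carrier R. \<iota> a \<in> Q} \<subseteq> p"
proof
  interpret Q: primeideal Q L by fact
  fix a assume a: "a \<in> {a \<in> carrier R. \<iota> a \<in> Q}"
  show "a \<in> p"
  proof (rule ccontr)
    assume "a \<notin> p"
    then have "\<iota> a \<otimes>\<^bsub>L\<^esub> fr \<one> a = \<one>\<^bsub>L\<^esub>" using frac_inverse[of a] a by auto
    moreover have "\<iota> a \<otimes>\<^bsub>L\<^esub> fr \<one> a \<in> Q" using a \<open>a \<notin> p\<close> by (intro Q.I_r_closed) auto
    ultimately show False using Q.I_notcarr Q.one_imp_carrier by auto
  qed
qed

lemma height_ge_iff: "enat k \<le> krull_dim L \<longleftrightarrow> height_ge R p k"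
proof
  let ?A = "{enat k | k. \<exists>P :: nat \<Rightarrow> _ set. (\<forall>i\<le>k. primeideal (P i) L) \<and> (\<forall>i<k. P i \<subset> P (Suc i))}"
  assume "enat k \<le> krull_dim L"
  then have le: "enat k \<le> Sup ?A" by (simp add: krull_dim_def)
  show "height_ge R p k"
  proof (cases k)
    case 0
    then show ?thesis using primeideal_axioms unfolding height_ge_def by (intro exI[of _ "\<lambda>_. p"]) auto
  next
    case (Suc k')
    \<comment> \<open>The supremum may be infinite. Some chain is longer than \<open>k'\<close>, and
      its first \<open>k + 1\<close> members are enough.\<close>
    have "\<exists>x\<in>?A. enat k' < x"
    proof (rule ccontr)
      assume "\<not> (\<exists>x\<in>?A. enat k' < x)"
      then have "x \<le> enat k'" if "x \<in> ?A" for x using that by (meson not_le)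
      then have "Sup ?A \<le> enat k'" by (rule Sup_least)
      from order.trans[OF le this] Suc show False by simp
    qed
    then obtain j P where j: "k' < j" and P: "\<forall>i\<le>j. primeideal (P i) L" "\<forall>i<j. P i \<subset> P (Suc i)"
      by auto
    show ?thesis unfolding height_ge_def
    proof (intro exI[of _ "\<lambda>i. {a \<in> carrier R. \<iota> a \<in> P i}"] conjI allI impI)
      show "primeideal {a \<in> carrier R. \<iota> a \<in> P i} R" if "i \<le> k" for i
        using that P j Suc by (intro contraction_prime) simp
      show "{a \<in> carrier R. \<iota> a \<in> P i} \<subset> {a \<in> carrier R. \<iota> a \<in> P (Suc i)}" if "i < k" for i
        using that P j Suc by (intro contraction_strict) auto
      show "{a \<in> carrier R. \<iota> a \<in> P k} \<subseteq> p" using P j Suc by (intro contraction_le) auto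
    qed
  qed
next
  assume "height_ge R p k"
  then obtain P where P: "\<forall>i\<le>k. primeideal (P i) R" "\<forall>i<k. P i \<subset> P (Suc i)" "P k \<subseteq> p"
    unfolding height_ge_def by blast
  have sub: "P i \<subseteq> p" if "i \<le> k" for i
    using that
  proof (induction "k - i" arbitrary: i)
    case 0 then show ?case using P by simp
  next
    case (Suc d)
    then have "P (Suc i) \<subseteq> p" by (intro Suc(1)) auto
    moreover have "i < k" using Suc by simp
    ultimately show ?case using P(2) by blast
  qed
  have "\<exists>Q :: nat \<Rightarrow> _ set. (\<forall>i\<le>k. primeideal (Q i) L) \<and> (\<forall>i<k. Q i \<subset> Q (Suc i))"
  proof (intro exI[of _ "\<lambda>i. local_ideal_at R p (P i)"] conjI allI impI)
    show "primeideal (local_ideal_at R p (P i)) L" if "i \<le> k" for i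
      using that P sub by (intro local_prime) auto
    fix i assume i: "i < k"
    interpret Pi: primeideal "P (Suc i)" R using P i by simp
    obtain a where a: "a \<in> P (Suc i)" "a \<notin> P i" using P i by blast
    have "\<iota> a \<in> local_ideal_at R p (P (Suc i))" "\<iota> a \<notin> local_ideal_at R p (P i)"
      using a prime_mem_iff[of "P i" a \<one>] prime_mem_iff[of "P (Suc i)" a \<one>] P i sub[of i] sub[of "Suc i"] W_one Pi.Icarr
      by auto
    moreover have "local_ideal_at R p (P i) \<subseteq> local_ideal_at R p (P (Suc i))"
      using P i unfolding local_ideal_at_def by blast
    ultimately show "local_ideal_at R p (P i) \<subset> local_ideal_at R p (P (Suc i))" by blast
  qed
  then show "enat k \<le> krull_dim L" unfolding krull_dim_def by (intro Sup_upper) blast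
qed

text \<open>Local generators may be replaced by their numerators because denominators are units;
  conversely, the images of elements that generate up to multipliers outside \<open>p\<close>
  generate the localized ideal.\<close>

lemma locally_generated_iff:
  assumes I: "ideal I R"
  shows "min_num_gens L (local_ideal_at R p I) \<le> enat k \<longleftrightarrow> locally_generated R p I k"
proof
  interpret I: ideal I R by fact
  let ?I = "local_ideal_at R p I"
  let ?A = "{enat (card A) | A. A \<subseteq> carrier L \<and> finite A \<and> ?I = Idl\<^bsub>L\<^esub> A}"
  assume "min_num_gens L ?I \<le> enat k"
  then have le: "Inf ?A \<le> enat k" by (simp add: min_num_gens_def)
  \<comment> \<open>An empty set would have infimum \<infinity>; a nonempty set of
    \<open>enat\<close> contains its infimum, so an optimal generating set exists.\<close>
  have "?A \<noteq> {}"
  proof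
    assume "?A = {}"
    then show False using le by (simp only: Inf_empty) (simp add: top_enat_def)
  qed
  then obtain x where "x \<in> ?A" by blast
  then have "Inf ?A \<in> ?A" by (rule wellorder_InfI)
  then obtain B where B: "B \<subseteq> carrier L" "finite B" "?I = Idl\<^bsub>L\<^esub> B" "card B \<le> k" using le by force
  have "\<exists>a\<in>I. \<exists>s\<in>W. b = fr a s" if "b \<in> B" for b
  proof -
    have "b \<in> ?I" using that B L.genideal_self[of B] by blast
    then show ?thesis by (auto simp: local_ideal_at_def)
  qed
  then obtain f where f: "\<And>b. b \<in> B \<Longrightarrow> f b \<in> I \<and> (\<exists>s\<in>W. b = fr (f b) s)" by metis
  have fB: "f ` B \<subseteq> carrier R" using f I.Icarr by auto
  have JI: "ideal (Idl (f ` B)) R" by (rule genideal_ideal[OF fB])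
  have "B \<subseteq> local_ideal_at R p (Idl (f ` B))"
    using f genideal_self[OF fB] unfolding local_ideal_at_def by fastforce
  then have sub: "?I \<subseteq> local_ideal_at R p (Idl (f ` B))"
    unfolding B(3) by (rule L.genideal_minimal[OF local_ideal[OF JI]])
  have "\<forall>x\<in>I. \<exists>s\<in>W. s \<otimes> x \<in> Idl (f ` B)"
  proof
    fix x assume x: "x \<in> I"
    then have "\<iota> x \<in> ?I" using W_one by (auto simp: local_ideal_at_def)
    then show "\<exists>s\<in>W. s \<otimes> x \<in> Idl (f ` B)"
      using sub frac_mem_iff[OF JI I.Icarr[OF x] W_one] by blast
  qed
  moreover have "f ` B \<subseteq> I" using f by blast
  moreover have "card (f ` B) \<le> k" using card_image_le[OF B(2), of f] B(4) by simp
  ultimately show "locally_generated R p I k" unfolding locally_generated_def using B(2) by blast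
next
  interpret I: ideal I R by fact
  let ?I = "local_ideal_at R p I"
  assume "locally_generated R p I k"
  then obtain A where A: "A \<subseteq> I" "finite A" "card A \<le> k" "\<And>x. x \<in> I \<Longrightarrow> \<exists>s\<in>W. s \<otimes> x \<in> Idl A"
    unfolding locally_generated_def by blast
  have AR: "A \<subseteq> carrier R" using A I.Icarr by blast
  have AL: "\<iota> ` A \<subseteq> carrier L" using AR W_one by (auto simp: W_carr simp del: Diff_iff)
  let ?J = "Idl\<^bsub>L\<^esub> (\<iota> ` A)"
  interpret J: ideal ?J L by (rule L.genideal_ideal[OF AL])
  have "?I = ?J"
  proof
    show "?J \<subseteq> ?I"
    proof (rule L.genideal_minimal[OF local_ideal[OF I]])
      show "\<iota> ` A \<subseteq> ?I" using A W_one unfolding local_ideal_at_def by blast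
    qed
    have con: "ideal {a \<in> carrier R. \<iota> a \<in> ?J} R"
      by (rule idealI_cring) (use J.zero_closed in \<open>auto simp: J.a_closed J.I_l_closed\<close>)
    have IdlA: "Idl A \<subseteq> {a \<in> carrier R. \<iota> a \<in> ?J}"
      by (rule genideal_minimal[OF con]) (use AR L.genideal_self[OF AL] in auto)
    show "?I \<subseteq> ?J"
    proof
      fix x assume "x \<in> ?I"
      then obtain a s where a: "x = fr a s" "a \<in> I" "s \<in> W" by (auto simp: local_ideal_at_def)
      then obtain w where w: "w \<in> W" "w \<otimes> a \<in> Idl A" using A by blast
      have "x = fr (w \<otimes> a) (w \<otimes> s)" using frac_cancel[of a s w] a w by auto
      also have "\<dots> = \<iota> (w \<otimes> a) \<otimes>\<^bsub>L\<^esub> fr \<one> (w \<otimes> s)" by (rule frac_eq_mult) (use a w W_mult[of w s] in auto)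
      also have "\<dots> \<in> ?J" using IdlA w a W_mult[of w s] by (intro J.I_r_closed frac_closed) auto
      finally show "x \<in> ?J" .
    qed
  qed
  then have "min_num_gens L ?I \<le> enat (card (\<iota> ` A))"
    unfolding min_num_gens_def using AL A(2) by (intro Inf_lower) blast
  also have "\<dots> \<le> enat k" using card_image_le[OF A(2), of \<iota>] A(3) by simp
  finally show "min_num_gens L ?I \<le> enat k" .
qed

end

text \<open>A single number \<open>k\<close> separates the two sides of the condition, being at
  least the number of generators and at most the height. Primes of height \<open>s\<close> or more
  are not tested.\<close>

lemma satisfies_G_I:
  assumes "ideal I R"
    and "\<And>p. primeideal p R \<Longrightarrow> I \<subseteq> p \<Longrightarrow> height_ge R p s \<or> (\<exists>k. height_ge R p k \<and> locally_generated R p I k)"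
  shows "satisfies_G R I s"
  unfolding satisfies_G_def
proof (intro allI impI, elim conjE)
  fix p assume p: "primeideal p R" "I \<subseteq> p" "krull_dim (local_ring_at R p) + 1 \<le> enat s"
  interpret localization_at_prime p R using p(1) by (simp add: localization_at_prime_def)
  have "\<not> height_ge R p s"
  proof
    assume "height_ge R p s"
    then have "enat s \<le> krull_dim L" by (simp add: height_ge_iff)
    then have "enat s + 1 \<le> krull_dim L + 1" by (rule add_right_mono)
    also have "\<dots> \<le> enat s" by fact
    finally show False by (simp add: one_enat_def)
  qed
  then obtain k where "height_ge R p k" "locally_generated R p I k" using assms(2) p by blast
  then show "min_num_gens L (local_ideal_at R p I) \<le> krull_dim L"
    unfolding height_ge_iff[symmetric] locally_generated_iff[OF assms(1), symmetric] by (rule order.trans[rotated])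
qed

text \<open>The prime has height at most \<open>N\<close> but needs more than \<open>N\<close>
  generators, so it violates \<open>satisfies_G\<close> as soon as \<open>s\<close> is large enough
  for it to be tested.\<close>

lemma satisfies_G_bound:
  assumes "ideal I R" "primeideal p R" "I \<subseteq> p" "\<not> height_ge R p (Suc N)" "\<not> locally_generated R p I N"
    and "satisfies_G R I s"
  shows "s \<le> N"
proof (rule ccontr)
  assume s: "\<not> s \<le> N"
  interpret localization_at_prime p R using assms(2) by (simp add: localization_at_prime_def)
  have d: "krull_dim L < enat (Suc N)" using assms(4) by (simp add: height_ge_iff[symmetric])
  then obtain j where j: "krull_dim L = enat j" "j \<le> N" by (cases "krull_dim L") auto
  then have "krull_dim L + 1 \<le> enat s" using s by (simp add: one_enat_def)
  then have "min_num_gens L (local_ideal_at R p I) \<le> krull_dim L" using assms unfolding satisfies_G_def by blast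
  also have "\<dots> \<le> enat N" using j by simp
  finally show False using assms(5) locally_generated_iff[OF assms(1)] by simp
qed

section \<open>Pfaffians of lists\<close>

text \<open>\<open>row_contract R r f [z\<^sub>1, \<dots>, z\<^sub>k]\<close> is the alternating sum of \<open>r z\<^sub>i\<close> times \<open>f\<close> at the list
  without \<open>z\<^sub>i\<close>, so that \<open>pf_list\<close> is the expansion of the Pfaffian along its first row.\<close>

fun row_contract :: "('a, 'b) ring_scheme \<Rightarrow> ('v \<Rightarrow> 'a) \<Rightarrow> ('v list \<Rightarrow> 'a) \<Rightarrow> 'v list \<Rightarrow> 'a" where
  "row_contract R r f [] = \<zero>\<^bsub>R\<^esub>"
| "row_contract R r f (z # zs) = (r z \<otimes>\<^bsub>R\<^esub> f zs) \<oplus>\<^bsub>R\<^esub> (\<ominus>\<^bsub>R\<^esub> row_contract R r (\<lambda>u. f (z # u)) zs)"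

text \<open>As a congruence rule it makes \<open>pf_list\<close> terminate: the recursive calls
  hidden in \<open>row_contract\<close> act on lists one shorter than \<open>zs\<close>.\<close>

lemma row_contract_cong [fundef_cong]:
  assumes "zs = zs'" "\<And>z. z \<in> set zs' \<Longrightarrow> r z = r' z"
    and "\<And>u. length zs' = Suc (length u) \<Longrightarrow> set u \<subseteq> set zs' \<Longrightarrow> f u = f' u"
  shows "row_contract R r f zs = row_contract R r' f' zs'"
  unfolding assms(1) using assms(2,3)
proof (induction zs' arbitrary: f f')
  case (Cons z zs)
  have "row_contract R r (\<lambda>u. f (z # u)) zs = row_contract R r' (\<lambda>u. f' (z # u)) zs"
  proof (rule Cons.IH)
    fix u assume "length zs = Suc (length u)" "set u \<subseteq> set zs"
    then show "f (z # u) = f' (z # u)" by (intro Cons.prems(2)) auto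
  qed (use Cons.prems in auto)
  moreover have "f zs = f' zs" by (rule Cons.prems(2)) auto
  ultimately show ?case using Cons.prems(1) by simp
qed simp

fun pf_list :: "('a, 'b) ring_scheme \<Rightarrow> ('v \<Rightarrow> 'v \<Rightarrow> 'a) \<Rightarrow> 'v list \<Rightarrow> 'a" where
  "pf_list R b [] = \<one>\<^bsub>R\<^esub>"
| "pf_list R b (x # zs) = row_contract R (b x) (pf_list R b) zs"

context cring begin

abbreviation "ctr \<equiv> row_contract R"

lemma ctr_closed:
  "(\<And>z. z \<in> set zs \<Longrightarrow> r z \<in> carrier R) \<Longrightarrow> (\<And>u. set u \<subseteq> set zs \<Longrightarrow> f u \<in> carrier R) \<Longrightarrow> ctr r f zs \<in> carrier R"
proof (induction zs arbitrary: f)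
  case (Cons z zs)
  have "ctr r (\<lambda>u. f (z # u)) zs \<in> carrier R"
  proof (rule Cons.IH)
    fix u assume "set u \<subseteq> set zs"
    then show "f (z # u) \<in> carrier R" by (intro Cons.prems(2)) auto
  qed (use Cons.prems in auto)
  moreover have "f zs \<in> carrier R" using Cons.prems by auto
  ultimately show ?case using Cons.prems by auto
qed simp

lemma ctr_zero: "(\<And>z. z \<in> set zs \<Longrightarrow> r z \<in> carrier R) \<Longrightarrow> ctr r (\<lambda>_. \<zero>) zs = \<zero>"
  by (induction zs) auto

lemma ctr_zero_row: "(\<And>z. z \<in> set zs \<Longrightarrow> r z = \<zero>) \<Longrightarrow> (\<And>u. f u \<in> carrier R) \<Longrightarrow> ctr r f zs = \<zero>"
  by (induction zs arbitrary: f) auto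

lemma neg_add_identity: "a \<in> carrier R \<Longrightarrow> b \<in> carrier R \<Longrightarrow> c \<in> carrier R \<Longrightarrow> e \<in> carrier R \<Longrightarrow>
  (a \<oplus> b) \<oplus> \<ominus> (c \<oplus> e) = (a \<oplus> \<ominus> c) \<oplus> (b \<oplus> \<ominus> e)"
  by (simp add: minus_add a_ac)

lemma ctr_add_row:
  assumes "\<And>z. r z \<in> carrier R" "\<And>z. r' z \<in> carrier R" "\<And>u. f u \<in> carrier R"
  shows "ctr (\<lambda>z. r z \<oplus> r' z) f zs = ctr r f zs \<oplus> ctr r' f zs"
  using assms(3)
proof (induction zs arbitrary: f)
  case (Cons z zs)
  have c: "ctr r (\<lambda>u. f (z # u)) zs \<in> carrier R" "ctr r' (\<lambda>u. f (z # u)) zs \<in> carrier R"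
    by (rule ctr_closed, use assms Cons.prems in auto)+
  show ?case using Cons.IH[of "\<lambda>u. f (z # u)"] Cons.prems assms(1,2) c
    by (simp add: l_distr neg_add_identity)
qed simp

lemma ctr_smult_row:
  assumes "c \<in> carrier R" "\<And>z. r z \<in> carrier R" "\<And>u. f u \<in> carrier R"
  shows "ctr (\<lambda>z. c \<otimes> r z) f zs = c \<otimes> ctr r f zs"
  using assms(3)
proof (induction zs arbitrary: f)
  case (Cons z zs)
  have "ctr r (\<lambda>u. f (z # u)) zs \<in> carrier R"
    by (rule ctr_closed, use assms Cons.prems in auto)+
  then show ?case using Cons.IH[of "\<lambda>u. f (z # u)"] Cons.prems assms(1,2)
    by (simp add: r_distr m_assoc r_minus)
qed (use assms in simp)

lemma ctr_neg_row:
  assumes "\<And>z. r z \<in> carrier R" "\<And>u. f u \<in> carrier R"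
  shows "ctr (\<lambda>z. \<ominus> r z) f zs = \<ominus> ctr r f zs"
  using assms(2)
proof (induction zs arbitrary: f)
  case (Cons z zs)
  have "ctr r (\<lambda>u. f (z # u)) zs \<in> carrier R"
    by (rule ctr_closed, use assms Cons.prems in auto)+
  then show ?case using Cons.IH[of "\<lambda>u. f (z # u)"] Cons.prems assms(1)
    by (simp add: l_minus minus_add)
qed simp

lemma ctr_add:
  assumes "\<And>z. r z \<in> carrier R" "\<And>u. f u \<in> carrier R" "\<And>u. g u \<in> carrier R"
  shows "ctr r (\<lambda>u. f u \<oplus> g u) zs = ctr r f zs \<oplus> ctr r g zs"
  using assms(2,3)
proof (induction zs arbitrary: f g)
  case (Cons z zs)
  have c: "ctr r (\<lambda>u. f (z # u)) zs \<in> carrier R" "ctr r (\<lambda>u. g (z # u)) zs \<in> carrier R"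
    by (rule ctr_closed, use assms Cons.prems in auto)+
  show ?case using Cons.IH[of "\<lambda>u. f (z # u)" "\<lambda>u. g (z # u)"] Cons.prems assms(1) c
    by (simp add: r_distr neg_add_identity)
qed simp

lemma ctr_smult:
  assumes "c \<in> carrier R" "\<And>z. r z \<in> carrier R" "\<And>u. f u \<in> carrier R"
  shows "ctr r (\<lambda>u. c \<otimes> f u) zs = c \<otimes> ctr r f zs"
  using assms(3)
proof (induction zs arbitrary: f)
  case (Cons z zs)
  have "ctr r (\<lambda>u. f (z # u)) zs \<in> carrier R"
    by (rule ctr_closed, use assms Cons.prems in auto)+
  then show ?case using Cons.IH[of "\<lambda>u. f (z # u)"] Cons.prems assms(1,2)
    by (simp add: r_distr m_lcomm r_minus)
qed (use assms in simp)

lemma ctr_neg: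
  assumes "\<And>z. r z \<in> carrier R" "\<And>u. f u \<in> carrier R"
  shows "ctr r (\<lambda>u. \<ominus> f u) zs = \<ominus> ctr r f zs"
proof -
  have "ctr r (\<lambda>u. (\<ominus> \<one>) \<otimes> f u) zs = (\<ominus> \<one>) \<otimes> ctr r f zs"
    by (rule ctr_smult) (use assms in auto)
  moreover have "ctr r f zs \<in> carrier R" by (rule ctr_closed) (use assms in auto)
  ultimately show ?thesis using assms by (simp add: l_minus)
qed

text \<open>Contractions behave like interior products on an exterior algebra. This is the source of
  the sign of a swap in \<open>pf_swap\<close>.\<close>

lemma ctr_anticomm:
  assumes "\<And>z. r z \<in> carrier R" "\<And>z. r' z \<in> carrier R" "\<And>u. f u \<in> carrier R"
  shows "ctr r (ctr r' f) zs = \<ominus> ctr r' (ctr r f) zs"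
  using assms(3)
proof (induction zs arbitrary: f)
  case (Cons z zs)
  let ?g = "\<lambda>u. f (z # u)"
  have cl: "ctr q g u \<in> carrier R" if "q = r \<or> q = r'" "\<And>u. g u \<in> carrier R" for q g u
    by (rule ctr_closed) (use that assms in auto)
  have step: "ctr q (\<lambda>u. ctr q' f (z # u)) zs = (q' z \<otimes> ctr q f zs) \<oplus> \<ominus> ctr q (ctr q' ?g) zs"
    if q: "q = r \<or> q = r'" "q' = r \<or> q' = r'" for q q'
  proof -
    have qc: "q z \<in> carrier R" "q' z \<in> carrier R" for z using q assms by auto
    have "ctr q (\<lambda>u. ctr q' f (z # u)) zs = ctr q (\<lambda>u. (q' z \<otimes> f u) \<oplus> (\<ominus> ctr q' ?g u)) zs" by simp
    also have "\<dots> = ctr q (\<lambda>u. q' z \<otimes> f u) zs \<oplus> ctr q (\<lambda>u. \<ominus> ctr q' ?g u) zs"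
      by (rule ctr_add) (use Cons.prems qc cl q in auto)
    also have "ctr q (\<lambda>u. q' z \<otimes> f u) zs = q' z \<otimes> ctr q f zs"
      by (rule ctr_smult) (use Cons.prems qc in auto)
    also have "ctr q (\<lambda>u. \<ominus> ctr q' ?g u) zs = \<ominus> ctr q (ctr q' ?g) zs"
      by (rule ctr_neg) (use Cons.prems qc cl q in auto)
    finally show ?thesis .
  qed
  have c: "ctr r f zs \<in> carrier R" "ctr r' f zs \<in> carrier R" "ctr r' (ctr r ?g) zs \<in> carrier R"
    by (intro cl disjI1 disjI2 refl Cons.prems)+
  have idn: "A \<oplus> \<ominus> (B \<oplus> \<ominus> (\<ominus> C)) = \<ominus> (B \<oplus> \<ominus> (A \<oplus> \<ominus> C))"
    if "A \<in> carrier R" "B \<in> carrier R" "C \<in> carrier R" for A B C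
    using that by (simp add: minus_add a_ac)
  have IH: "ctr r (ctr r' ?g) zs = \<ominus> ctr r' (ctr r ?g) zs" by (rule Cons.IH) (use Cons.prems in auto)
  have "ctr r (ctr r' f) (z # zs) = (r z \<otimes> ctr r' f zs) \<oplus> \<ominus> ((r' z \<otimes> ctr r f zs) \<oplus> \<ominus> (\<ominus> ctr r' (ctr r ?g) zs))"
    using step[of r r'] IH by simp
  also have "\<dots> = \<ominus> ((r' z \<otimes> ctr r f zs) \<oplus> \<ominus> ((r z \<otimes> ctr r' f zs) \<oplus> \<ominus> ctr r' (ctr r ?g) zs))"
    by (rule idn) (use c assms in auto)
  also have "\<dots> = \<ominus> ctr r' (ctr r f) (z # zs)"
    using step[of r' r] by simp
  finally show ?case .
qed simp

text \<open>Anticommutativity would only show that twice this element vanishes, which says nothing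
  in characteristic two; hence a separate induction.\<close>

lemma ctr_self:
  assumes "\<And>z. r z \<in> carrier R" "\<And>u. f u \<in> carrier R"
  shows "ctr r (ctr r f) zs = \<zero>"
  using assms(2)
proof (induction zs arbitrary: f)
  case (Cons z zs)
  let ?g = "\<lambda>u. f (z # u)"
  have cl: "ctr r g u \<in> carrier R" if "\<And>u. g u \<in> carrier R" for g u
    by (rule ctr_closed) (use that assms in auto)
  have "ctr r (\<lambda>u. ctr r f (z # u)) zs = ctr r (\<lambda>u. (r z \<otimes> f u) \<oplus> (\<ominus> ctr r ?g u)) zs" by simp
  also have "\<dots> = ctr r (\<lambda>u. r z \<otimes> f u) zs \<oplus> ctr r (\<lambda>u. \<ominus> ctr r ?g u) zs"
    by (rule ctr_add) (use Cons.prems assms cl in auto)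
  also have "ctr r (\<lambda>u. r z \<otimes> f u) zs = r z \<otimes> ctr r f zs"
    by (rule ctr_smult) (use Cons.prems assms in auto)
  also have "ctr r (\<lambda>u. \<ominus> ctr r ?g u) zs = \<ominus> ctr r (ctr r ?g) zs"
    by (rule ctr_neg) (use Cons.prems assms cl in auto)
  also have "ctr r (ctr r ?g) zs = \<zero>" by (rule Cons.IH) (use Cons.prems in auto)
  finally have "ctr r (\<lambda>u. ctr r f (z # u)) zs = r z \<otimes> ctr r f zs"
    using assms cl[OF Cons.prems] by simp
  then show ?case using assms cl[OF Cons.prems] by (simp add: r_neg)
qed simp

text \<open>The two terms that remove \<open>p\<close> or \<open>q\<close> trade places with
  opposite signs. Every other term keeps the pair and loses an entry elsewhere, which is why the
  hypothesis speaks of shorter lists only.\<close>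

lemma ctr_swap:
  fixes us vs :: "'v list"
  assumes "\<And>z. r z \<in> carrier R" "\<And>u. f u \<in> carrier R"
    and "\<And>us' vs'. length us' + length vs' < length us + length vs \<Longrightarrow> f (us' @ p # q # vs') = \<ominus> f (us' @ q # p # vs')"
  shows "ctr r f (us @ p # q # vs) = \<ominus> ctr r f (us @ q # p # vs)"
  using assms(2,3)
proof (induction us arbitrary: f)
  case Nil
  have cl: "ctr r (\<lambda>u. f (q # p # u)) vs \<in> carrier R"
    by (rule ctr_closed) (use assms Nil.prems in auto)
  have "ctr r (\<lambda>u. f (p # q # u)) vs = ctr r (\<lambda>u. \<ominus> f (q # p # u)) vs"
    by (rule row_contract_cong) (use Nil.prems(2)[of "[]"] in auto)
  also have "\<dots> = \<ominus> ctr r (\<lambda>u. f (q # p # u)) vs"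
    by (rule ctr_neg) (use assms Nil.prems in auto)
  finally show ?case using cl assms(1) Nil.prems by (simp add: minus_add a_ac)
next
  case (Cons w us)
  have cl: "ctr r (\<lambda>u. f (w # u)) (us @ q # p # vs) \<in> carrier R"
    by (rule ctr_closed) (use assms Cons.prems in auto)
  have "ctr r (\<lambda>u. f (w # u)) (us @ p # q # vs) = \<ominus> ctr r (\<lambda>u. f (w # u)) (us @ q # p # vs)"
  proof (rule Cons.IH)
    fix us' vs' :: "'v list" assume "length us' + length vs' < length us + length vs"
    then show "f (w # us' @ p # q # vs') = \<ominus> f (w # us' @ q # p # vs')"
      using Cons.prems(2)[of "w # us'" vs'] by simp
  qed (use Cons.prems in auto)
  moreover have "f (us @ p # q # vs) = \<ominus> f (us @ q # p # vs)" using Cons.prems(2) by simp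
  ultimately show ?case using cl assms(1) Cons.prems by (simp add: minus_add r_minus)
qed

lemma ctr_dup:
  fixes us vs :: "'v list"
  assumes "\<And>z. r z \<in> carrier R" "\<And>u. f u \<in> carrier R"
    and "\<And>us' vs'. length us' + length vs' < length us + length vs \<Longrightarrow> f (us' @ p # p # vs') = \<zero>"
  shows "ctr r f (us @ p # p # vs) = \<zero>"
  using assms(2,3)
proof (induction us arbitrary: f)
  case Nil
  have "ctr r (\<lambda>u. f (p # p # u)) vs = ctr r (\<lambda>u. \<zero>) vs"
    by (rule row_contract_cong) (use Nil.prems(2)[of "[]"] in auto)
  also have "\<dots> = \<zero>" by (rule ctr_zero) (use assms in auto)
  finally show ?case using assms(1) Nil.prems by (simp add: r_neg)
next
  case (Cons w us)
  have "ctr r (\<lambda>u. f (w # u)) (us @ p # p # vs) = \<zero>"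
  proof (rule Cons.IH)
    fix us' vs' :: "'v list" assume "length us' + length vs' < length us + length vs"
    then show "f (w # us' @ p # p # vs') = \<zero>"
      using Cons.prems(2)[of "w # us'" vs'] by simp
  qed (use Cons.prems in auto)
  moreover have "f (us @ p # p # vs) = \<zero>" using Cons.prems(2) by simp
  ultimately show ?case using assms(1) by simp
qed

lemma ctr_append_zero:
  assumes "\<And>z. z \<in> set ys \<Longrightarrow> r z = \<zero>" "\<And>u. f u \<in> carrier R"
  shows "ctr r f (xs @ ys) = ctr r (\<lambda>u. f (u @ ys)) xs"
  using assms(2)
proof (induction xs arbitrary: f)
  case Nil
  then show ?case using ctr_zero_row[where r=r and f=f and zs=ys] assms(1) by simp
next
  case (Cons x xs)
  then show ?case using Cons.IH[of "\<lambda>u. f (x # u)"] by simp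
qed

lemma ctr_map: "ctr r f (map g zs) = ctr (\<lambda>z. r (g z)) (\<lambda>u. f (map g u)) zs"
  by (induction zs arbitrary: f) auto

lemma ctr_in_ideal:
  assumes "ideal J R" "\<And>z. z \<in> set zs \<Longrightarrow> r z \<in> carrier R"
    and "\<And>u. length zs = Suc (length u) \<Longrightarrow> set u \<subseteq> set zs \<Longrightarrow> f u \<in> J"
  shows "ctr r f zs \<in> J"
  using assms(2,3)
proof (induction zs arbitrary: f)
  case Nil
  interpret J: ideal J R by fact
  show ?case by (simp add: J.zero_closed)
next
  case (Cons z zs)
  interpret J: ideal J R by fact
  have "ctr r (\<lambda>u. f (z # u)) zs \<in> J"
  proof (rule Cons.IH)
    fix u assume "length zs = Suc (length u)" "set u \<subseteq> set zs"
    then show "f (z # u) \<in> J" by (intro Cons.prems(2)) auto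
  qed (use Cons.prems in auto)
  moreover have "f zs \<in> J" using Cons.prems by auto
  ultimately show ?case using Cons.prems by (auto intro!: J.a_closed J.I_l_closed J.a_inv_closed)
qed

text \<open>The outer contraction is linear in its row, and the inner one expands along
  \<open>K\<close> into multiples of the rows \<open>\<lambda>z. B z k\<close>.\<close>

lemma ctr_nested_in_ideal:
  assumes J: "ideal J R" and "\<And>z k. B z k \<in> carrier R" "\<And>u. g u \<in> carrier R" "\<And>u. f u \<in> carrier R"
    and "\<And>k. k \<in> set K \<Longrightarrow> ctr (\<lambda>z. B z k) f zs \<in> J"
  shows "ctr (\<lambda>z. ctr (B z) g K) f zs \<in> J"
  using assms(3,5)
proof (induction K arbitrary: g)
  case Nil
  interpret J: ideal J R by fact
  have "ctr (\<lambda>z. \<zero>) f zs = \<zero>" by (rule ctr_zero_row) (use assms in auto)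
  then show ?case by (simp add: J.zero_closed)
next
  case (Cons k K)
  interpret J: ideal J R by fact
  let ?h = "\<lambda>u. g (k # u)"
  have c: "ctr (B z) ?h K \<in> carrier R" for z by (rule ctr_closed) (use assms Cons.prems in auto)
  have "ctr (\<lambda>z. ctr (B z) g (k # K)) f zs = ctr (\<lambda>z. g K \<otimes> B z k \<oplus> \<ominus> ctr (B z) ?h K) f zs"
    using Cons.prems assms(2) by (simp add: m_comm)
  also have "\<dots> = ctr (\<lambda>z. g K \<otimes> B z k) f zs \<oplus> ctr (\<lambda>z. \<ominus> ctr (B z) ?h K) f zs"
    by (rule ctr_add_row) (use Cons.prems assms c in auto)
  also have "ctr (\<lambda>z. g K \<otimes> B z k) f zs = g K \<otimes> ctr (\<lambda>z. B z k) f zs"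
    by (rule ctr_smult_row) (use Cons.prems assms c in auto)
  also have "ctr (\<lambda>z. \<ominus> ctr (B z) ?h K) f zs = \<ominus> ctr (\<lambda>z. ctr (B z) ?h K) f zs"
    by (rule ctr_neg_row) (use Cons.prems assms c in auto)
  also have "g K \<otimes> ctr (\<lambda>z. B z k) f zs \<oplus> \<ominus> ctr (\<lambda>z. ctr (B z) ?h K) f zs \<in> J"
    by (intro J.a_closed J.I_l_closed J.a_inv_closed Cons.IH) (use Cons.prems in auto)
  finally show ?case .
qed

lemma pf_list_map: "pf_list R b (map g xs) = pf_list R (\<lambda>x y. b (g x) (g y)) xs"
proof (induction xs rule: length_induct)
  case (1 xs)
  show ?case
  proof (cases xs)
    case (Cons x zs)
    have "ctr (\<lambda>z. b (g x) (g z)) (\<lambda>u. pf_list R b (map g u)) zs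
      = ctr (\<lambda>z. b (g x) (g z)) (pf_list R (\<lambda>x y. b (g x) (g y))) zs"
      by (rule row_contract_cong) (use 1 Cons in auto)
    then show ?thesis using Cons by (simp add: ctr_map)
  qed simp
qed

lemma pf_list_cong:
  assumes "\<And>x y. x \<in> set xs \<Longrightarrow> y \<in> set xs \<Longrightarrow> b x y = b' x y"
  shows "pf_list R b xs = pf_list R b' xs"
  using assms
proof (induction xs rule: length_induct)
  case (1 xs)
  show ?case
  proof (cases xs)
    case (Cons x zs)
    have "ctr (b x) (pf_list R b) zs = ctr (b' x) (pf_list R b') zs"
    proof (rule row_contract_cong)
      fix u assume "length zs = Suc (length u)" "set u \<subseteq> set zs"
      then show "pf_list R b u = pf_list R b' u" using 1(1)[rule_format, of u] 1(2) Cons by (auto simp: subset_iff)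
    qed (use 1 Cons in auto)
    then show ?thesis using Cons by simp
  qed simp
qed

end

lemma (in ring_hom_cring) hom_ctr:
  assumes "\<And>z. z \<in> set zs \<Longrightarrow> r z \<in> carrier R" "\<And>u. set u \<subseteq> set zs \<Longrightarrow> f u \<in> carrier R"
  shows "h (row_contract R r f zs) = row_contract S (\<lambda>z. h (r z)) (\<lambda>u. h (f u)) zs"
  using assms
proof (induction zs arbitrary: f)
  case (Cons z zs)
  have "row_contract R r (\<lambda>u. f (z # u)) zs \<in> carrier R"
  proof (rule R.ctr_closed)
    fix u assume "set u \<subseteq> set zs"
    then show "f (z # u) \<in> carrier R" by (intro Cons.prems(2)) auto
  qed (use Cons.prems in auto)
  moreover have "f zs \<in> carrier R" using Cons.prems by auto
  moreover have "h (row_contract R r (\<lambda>u. f (z # u)) zs) = row_contract S (\<lambda>z. h (r z)) (\<lambda>u. h (f (z # u))) zs"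
  proof (rule Cons.IH)
    fix u assume "set u \<subseteq> set zs"
    then show "f (z # u) \<in> carrier R" by (intro Cons.prems(2)) auto
  qed (use Cons.prems in auto)
  ultimately show ?case using Cons.prems by simp
qed simp

lemma (in cring) pf_list_closed_on:
  assumes "\<And>x y. x \<in> set xs \<Longrightarrow> y \<in> set xs \<Longrightarrow> b x y \<in> carrier R"
  shows "pf_list R b xs \<in> carrier R"
  using assms
proof (induction xs rule: length_induct)
  case (1 xs)
  show ?case
  proof (cases xs)
    case (Cons x zs)
    have "ctr (b x) (pf_list R b) zs = ctr (b x) (\<lambda>u. if length u < length xs \<and> set u \<subseteq> set xs then pf_list R b u else \<zero>) zs"
      by (rule row_contract_cong) (use Cons in auto)
    also have "\<dots> \<in> carrier R"
    proof (rule ctr_closed)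
      fix u
      show "(if length u < length xs \<and> set u \<subseteq> set xs then pf_list R b u else \<zero>) \<in> carrier R"
        using 1(1)[rule_format, of u] 1(2) by (auto simp: subset_iff)
    qed (use 1(2) Cons in auto)
    finally show ?thesis using Cons by simp
  qed simp
qed

lemma (in ring_hom_cring) hom_pf_list:
  assumes "\<And>x y. b x y \<in> carrier R"
  shows "h (pf_list R b xs) = pf_list S (\<lambda>x y. h (b x y)) xs"
proof (induction xs rule: length_induct)
  case (1 xs)
  show ?case
  proof (cases xs)
    case (Cons x zs)
    have "h (row_contract R (b x) (pf_list R b) zs) = row_contract S (\<lambda>z. h (b x z)) (\<lambda>u. h (pf_list R b u)) zs"
      by (rule hom_ctr) (auto intro!: R.pf_list_closed_on assms)
    also have "\<dots> = row_contract S (\<lambda>z. h (b x z)) (pf_list S (\<lambda>x y. h (b x y))) zs"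
      by (rule row_contract_cong) (use 1 Cons in auto)
    finally show ?thesis using Cons by simp
  qed simp
qed

locale alternating_form = cring R for R (structure) +
  fixes b :: "'v \<Rightarrow> 'v \<Rightarrow> 'a"
  assumes b_closed [simp]: "b x y \<in> carrier R"
    and b_self [simp]: "b x x = \<zero>"
    and b_skew: "b y x = \<ominus> b x y"
begin

abbreviation "pf \<equiv> pf_list R b"

lemma pf_closed [simp]: "pf xs \<in> carrier R"
  by (rule pf_list_closed_on) simp

lemma ctr_pf_closed [simp]: "ctr (b x) pf zs \<in> carrier R"
  by (rule ctr_closed) auto

lemma pf_odd: "odd (length xs) \<Longrightarrow> pf xs = \<zero>"
proof (induction xs rule: length_induct)
  case (1 xs)
  show ?case
  proof (cases xs)
    case (Cons x zs)
    have "ctr (b x) pf zs = ctr (b x) (\<lambda>_. \<zero>) zs"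
      by (rule row_contract_cong) (use 1 Cons in auto)
    then show ?thesis using Cons by (simp add: ctr_zero)
  qed (use 1 in simp)
qed

text \<open>At the front of the list this is the anticommutativity of two contractions. Further
  inside, the sign passes through the expansion along the first entry, which acts on shorter
  lists.\<close>

lemma pf_swap: "pf (us @ p # q # vs) = \<ominus> pf (us @ q # p # vs)"
proof (induction "length us + length vs" arbitrary: us vs rule: less_induct)
  case less
  show ?case
  proof (cases us)
    case Nil
    have c: "ctr (b q) (ctr (b p) pf) vs \<in> carrier R" by (intro ctr_closed) auto
    have "ctr (b p) (ctr (b q) pf) vs = \<ominus> ctr (b q) (ctr (b p) pf) vs"
      by (rule ctr_anticomm) auto
    moreover have "b p q = \<ominus> b q p" by (rule b_skew)
    ultimately show ?thesis using Nil c by (simp add: minus_add l_minus)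
  next
    case (Cons w us')
    have "ctr (b w) pf (us' @ p # q # vs) = \<ominus> ctr (b w) pf (us' @ q # p # vs)"
      by (rule ctr_swap) (use less Cons in auto)
    then show ?thesis using Cons by simp
  qed
qed

lemma pf_dup_adjacent: "pf (us @ p # p # vs) = \<zero>"
proof (induction "length us + length vs" arbitrary: us vs rule: less_induct)
  case less
  show ?case
  proof (cases us)
    case Nil
    have "ctr (b p) (ctr (b p) pf) vs = \<zero>" by (rule ctr_self) auto
    then show ?thesis using Nil by simp
  next
    case (Cons w us')
    have "ctr (b w) pf (us' @ p # p # vs) = \<zero>"
      by (rule ctr_dup) (use less Cons in auto)
    then show ?thesis using Cons by simp
  qed
qed

lemma pf_move: "pf (pre @ us @ x # vs) = (\<ominus> \<one>) [^] length us \<otimes> pf (pre @ x # us @ vs)"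
proof (induction us arbitrary: vs rule: rev_induct)
  case (snoc w us)
  have "pf (pre @ (us @ [w]) @ x # vs) = \<ominus> pf ((pre @ us) @ x # w # vs)"
    using pf_swap[of "pre @ us" w x vs] by simp
  also have "\<dots> = \<ominus> ((\<ominus> \<one>) [^] length us \<otimes> pf (pre @ x # us @ w # vs))"
    using snoc[of "w # vs"] by simp
  also have "\<dots> = (\<ominus> \<one>) [^] length (us @ [w]) \<otimes> pf (pre @ x # (us @ [w]) @ vs)"
    by (simp add: l_minus r_minus)
  finally show ?case .
qed simp

lemma neg_one_pow_cases: "(\<ominus> \<one>) [^] (n :: nat) = \<one> \<or> (\<ominus> \<one>) [^] n = \<ominus> \<one>"
  by (induction n) (auto simp: l_minus)

lemma pf_dup:
  assumes "\<not> distinct xs"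
  shows "pf xs = \<zero>"
proof -
  obtain us p ms vs where xs: "xs = us @ [p] @ ms @ [p] @ vs" using not_distinct_decomp[OF assms] by blast
  have "pf xs = (\<ominus> \<one>) [^] length ms \<otimes> pf ((us @ [p]) @ p # ms @ vs)"
    using pf_move[of "us @ [p]" ms p vs] xs by simp
  also have "pf ((us @ [p]) @ p # ms @ vs) = \<zero>" using pf_dup_adjacent[of us p "ms @ vs"] by simp
  finally show ?thesis by simp
qed

text \<open>The sign is left open: the conclusion drawn from it is membership in an ideal.\<close>

lemma pf_mset:
  "mset xs = mset ys \<Longrightarrow> pf (pre @ xs) = pf (pre @ ys) \<or> pf (pre @ xs) = \<ominus> pf (pre @ ys)"
proof (induction xs arbitrary: pre ys)
  case (Cons x xs)
  have "x \<in> set ys" using Cons.prems by (metis list.set_intros(1) set_mset_mset)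
  then obtain us vs where ys: "ys = us @ x # vs" by (metis split_list)
  have "pf ((pre @ [x]) @ xs) = pf ((pre @ [x]) @ (us @ vs)) \<or> pf ((pre @ [x]) @ xs) = \<ominus> pf ((pre @ [x]) @ (us @ vs))"
    by (rule Cons.IH) (use Cons.prems ys in auto)
  moreover have "pf (pre @ ys) = pf (pre @ x # us @ vs) \<or> pf (pre @ ys) = \<ominus> pf (pre @ x # us @ vs)"
    using pf_move[of pre us x vs] neg_one_pow_cases[of "length us"] ys by (auto simp: l_minus)
  ultimately show ?case by auto
qed simp

lemma pf_mset_in_ideal:
  assumes "ideal J R" "mset xs = mset ys" "pf ys \<in> J"
  shows "pf xs \<in> J"
proof -
  interpret J: ideal J R by fact
  show ?thesis using pf_mset[OF assms(2), of "[]"] assms(3) by auto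
qed

text \<open>Expansion along the first row never removes an entry of \<open>ys\<close>, so
  \<open>pf ys\<close> factors out of every term.\<close>

lemma pf_append_orthogonal:
  assumes "\<And>x z. x \<in> set xs \<Longrightarrow> z \<in> set ys \<Longrightarrow> b x z = \<zero>"
  shows "pf (xs @ ys) = pf xs \<otimes> pf ys"
  using assms
proof (induction xs rule: length_induct)
  case (1 xs)
  show ?case
  proof (cases xs)
    case (Cons x zs)
    have "ctr (b x) pf (zs @ ys) = ctr (b x) (\<lambda>u. pf (u @ ys)) zs"
      by (rule ctr_append_zero) (use 1 Cons in auto)
    also have "\<dots> = ctr (b x) (\<lambda>u. pf ys \<otimes> pf u) zs"
    proof (rule row_contract_cong)
      fix u assume u: "length zs = Suc (length u)" "set u \<subseteq> set zs"
      then have "pf (u @ ys) = pf u \<otimes> pf ys" using 1 Cons by (auto intro!: 1(1)[rule_format])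
      then show "pf (u @ ys) = pf ys \<otimes> pf u" by (simp add: m_comm)
    qed auto
    also have "\<dots> = pf ys \<otimes> ctr (b x) pf zs" by (rule ctr_smult) auto
    also have "\<dots> = ctr (b x) pf zs \<otimes> pf ys" by (intro m_comm ctr_closed) auto
    finally show ?thesis using Cons by simp
  qed simp
qed

lemma pf_scale:
  assumes d: "d \<in> carrier R"
  shows "pf_list R (\<lambda>x y. d \<otimes> b x y) xs = d [^] (length xs div 2) \<otimes> pf xs"
proof (induction xs rule: length_induct)
  case (1 xs)
  show ?case
  proof (cases xs)
    case (Cons x zs)
    show ?thesis
    proof (cases zs)
      case Nil
      then show ?thesis using Cons by (simp add: d)
    next
      case (Cons z zs')
      have e: "length xs div 2 = Suc ((length zs - 1) div 2)" using Cons \<open>xs = x # zs\<close> by simp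
      have "ctr (\<lambda>z. d \<otimes> b x z) (pf_list R (\<lambda>x y. d \<otimes> b x y)) zs
        = ctr (\<lambda>z. d \<otimes> b x z) (\<lambda>u. d [^] ((length zs - 1) div 2) \<otimes> pf u) zs"
        by (rule row_contract_cong) (use 1 \<open>xs = x # zs\<close> in auto)
      also have "\<dots> = d [^] ((length zs - 1) div 2) \<otimes> ctr (\<lambda>z. d \<otimes> b x z) pf zs"
        by (rule ctr_smult) (use d in auto)
      also have "ctr (\<lambda>z. d \<otimes> b x z) pf zs = d \<otimes> ctr (b x) pf zs"
        by (rule ctr_smult_row) (use d in auto)
      also have "d [^] ((length zs - 1) div 2) \<otimes> (d \<otimes> ctr (b x) pf zs) = d [^] (length xs div 2) \<otimes> ctr (b x) pf zs"
        unfolding e by (simp add: d m_assoc ctr_closed)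
      finally show ?thesis using \<open>xs = x # zs\<close> by simp
    qed
  qed simp
qed

end

section \<open>Pivoting on a Pfaffian\<close>

locale pf_pivot = alternating_form R b for R (structure) and b :: "'v \<Rightarrow> 'v \<Rightarrow> 'a" +
  fixes K :: "'v list"
begin

abbreviation "d \<equiv> pf K"

text \<open>When \<open>d\<close> is invertible, this is \<open>d\<close> times the entry of the
  Schur complement of the block with rows and columns \<open>K\<close>.\<close>

definition y where "y i j = pf (i # j # K)"

lemma y_closed [simp]: "y i j \<in> carrier R"
  unfolding y_def by (rule pf_closed)

lemma y_self [simp]: "y i i = \<zero>"
  unfolding y_def using pf_dup_adjacent[of "[]" i K] by simp

lemma y_skew: "y j i = \<ominus> y i j"
  unfolding y_def using pf_swap[of "[]" j i K] by simp

lemma y_pivot: "k \<in> set K \<Longrightarrow> y i k = \<zero>"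
  unfolding y_def by (rule pf_dup) auto

lemma y_pivot': "k \<in> set K \<Longrightarrow> y k i = \<zero>"
  unfolding y_def by (rule pf_dup) auto

lemma y_expand: "y i j = b i j \<otimes> d \<oplus> \<ominus> ctr (b i) (\<lambda>u. pf (j # u)) K"
  by (simp add: y_def)

text \<open>The form \<open>b\<close> on formal vectors. \<open>Inl i\<close> is the basis vector
  e_i, and \<open>Inr i\<close> stands for f_i = d e_i minus a combination of the e_k with k in
  \<open>K\<close>, chosen orthogonal to those e_k. Then b(e_i, f_j) = y_ij, and b(f_i, f_j) = d
  b(e_i, f_j). Tagging the vectors avoids division by \<open>d\<close>.\<close>

fun \<beta> :: "'v + 'v \<Rightarrow> 'v + 'v \<Rightarrow> 'a" where
  "\<beta> (Inl i) (Inl j) = b i j"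
| "\<beta> (Inl i) (Inr j) = y i j"
| "\<beta> (Inr i) (Inl j) = y i j"
| "\<beta> (Inr i) (Inr j) = d \<otimes> y i j"

lemma y_form: "alternating_form R y"
  by unfold_locales (simp_all add: y_skew[symmetric])

sublocale B: alternating_form R \<beta>
proof
  fix v w
  show "\<beta> v w \<in> carrier R" by (cases v; cases w) auto
  show "\<beta> v v = \<zero>" by (cases v) auto
  have dy: "d \<otimes> y j i = \<ominus> (d \<otimes> y i j)" for i j
    by (subst y_skew) (simp add: r_minus)
  show "\<beta> w v = \<ominus> \<beta> v w"
    by (cases v; cases w; simp only: \<beta>.simps; (rule y_skew b_skew dy)?)
qed

sublocale Y: alternating_form R y by (rule y_form)

text \<open>The relation between d e_j and f_j, paired with \<open>v\<close>. The coefficients of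
  the e_k are Pfaffians of \<open>K\<close> with \<open>k\<close> replaced by \<open>j\<close>, up
  to sign, as in Cramer's rule.\<close>

lemma beta_clear:
  "d \<otimes> \<beta> (Inl j) v = \<beta> (Inr j) v \<oplus> \<ominus> ctr (\<lambda>k. \<beta> v (Inl k)) (\<lambda>u. pf (j # u)) K"
proof (cases v)
  case (Inl i)
  let ?C = "ctr (b i) (\<lambda>u. pf (j # u)) K"
  have C: "?C \<in> carrier R" by (rule ctr_closed) auto
  have "y j i = \<ominus> (b i j \<otimes> d \<oplus> \<ominus> ?C)" using y_skew[of j i] y_expand[of i j] by simp
  also have "\<dots> = d \<otimes> b j i \<oplus> ?C" using C b_skew[of j i] by (simp add: minus_add l_minus m_comm r_minus)
  finally have "y j i \<oplus> \<ominus> ?C = d \<otimes> b j i" using C by (simp add: a_assoc r_neg)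
  then show ?thesis using Inl by simp
next
  case (Inr i)
  have "ctr (\<lambda>k. \<beta> v (Inl k)) (\<lambda>u. pf (j # u)) K = \<zero>"
    by (rule ctr_zero_row) (use Inr y_pivot in auto)
  then show ?thesis using Inr by simp
qed

lemma beta_clear_pf:
  "d \<otimes> B.pf (Inl j # zs) = B.pf (Inr j # zs) \<oplus> \<ominus> ctr (\<lambda>v. ctr (\<lambda>k. \<beta> v (Inl k)) (\<lambda>u. pf (j # u)) K) B.pf zs"
proof -
  let ?c = "\<lambda>v. ctr (\<lambda>k. \<beta> v (Inl k)) (\<lambda>u. pf (j # u)) K"
  have c: "?c v \<in> carrier R" for v by (rule ctr_closed) auto
  have "d \<otimes> B.pf (Inl j # zs) = ctr (\<lambda>v. d \<otimes> \<beta> (Inl j) v) B.pf zs"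
    by (simp add: ctr_smult_row)
  also have "\<dots> = ctr (\<lambda>v. \<beta> (Inr j) v \<oplus> \<ominus> ?c v) B.pf zs"
    by (simp only: beta_clear)
  also have "\<dots> = ctr (\<beta> (Inr j)) B.pf zs \<oplus> ctr (\<lambda>v. \<ominus> ?c v) B.pf zs"
    by (rule ctr_add_row) (use c in auto)
  also have "ctr (\<lambda>v. \<ominus> ?c v) B.pf zs = \<ominus> ctr ?c B.pf zs"
    by (rule ctr_neg_row) (use c in auto)
  finally show ?thesis by simp
qed

text \<open>The correction term of \<open>beta_clear_pf\<close> is a combination of Pfaffians in
  which some \<open>Inl k\<close> with \<open>k\<close> in \<open>K\<close> takes the place of
  \<open>Inl j\<close>.\<close>

lemma nested_in_ideal:
  assumes J: "ideal J R" and "\<And>k. k \<in> set K \<Longrightarrow> B.pf (Inl k # zs) \<in> J"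
  shows "ctr (\<lambda>v. ctr (\<lambda>k. \<beta> v (Inl k)) (\<lambda>u. pf (j # u)) K) B.pf zs \<in> J"
proof (rule ctr_nested_in_ideal[OF J])
  interpret J: ideal J R by fact
  fix k assume k: "k \<in> set K"
  have "ctr (\<lambda>v. \<beta> v (Inl k)) B.pf zs = ctr (\<lambda>v. \<ominus> \<beta> (Inl k) v) B.pf zs"
    by (simp only: B.b_skew[of _ "Inl k"])
  also have "\<dots> = \<ominus> ctr (\<beta> (Inl k)) B.pf zs" by (rule ctr_neg_row) auto
  finally show "ctr (\<lambda>v. \<beta> v (Inl k)) B.pf zs \<in> J" using assms(2)[OF k] by simp
qed auto

text \<open>If all of \<open>K\<close> already occurs in the list, each correction term repeats an
  entry and vanishes. This is \<open>nested_in_ideal\<close> for the zero ideal.\<close>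

lemma beta_clear_exact:
  assumes "Inl ` set K \<subseteq> set us"
  shows "B.pf (us @ Inr j # vs) = d \<otimes> B.pf (us @ Inl j # vs)"
proof -
  have "ctr (\<lambda>v. ctr (\<lambda>k. \<beta> v (Inl k)) (\<lambda>u. pf (j # u)) K) B.pf (us @ vs) \<in> {\<zero>}"
  proof (rule nested_in_ideal[OF zeroideal])
    fix k assume "k \<in> set K"
    then have "Inl k \<in> set us" using assms by auto
    then have "B.pf (Inl k # us @ vs) = \<zero>" by (intro B.pf_dup) auto
    then show "B.pf (Inl k # us @ vs) \<in> {\<zero>}" by simp
  qed
  then have "d \<otimes> B.pf (Inl j # us @ vs) = B.pf (Inr j # us @ vs)"
    using beta_clear_pf[of j "us @ vs"] by simp
  then show ?thesis
    using B.pf_move[of "[]" us "Inl j" vs] B.pf_move[of "[]" us "Inr j" vs]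
    by (metis append_Nil m_lcomm B.pf_closed pf_closed nat_pow_closed a_inv_closed one_closed)
qed

lemma beta_clear_all:
  "B.pf (map Inl K @ map Inr L1 @ map Inr L2) = d [^] length L2 \<otimes> B.pf (map Inl K @ map Inr L1 @ map Inl L2)"
proof (induction L2 arbitrary: L1)
  case (Cons j L2)
  have "B.pf (map Inl K @ map Inr L1 @ map Inr (j # L2)) = d [^] length L2 \<otimes> B.pf ((map Inl K @ map Inr L1) @ Inr j # map Inl L2)"
    using Cons.IH[of "L1 @ [j]"] by simp
  also have "B.pf ((map Inl K @ map Inr L1) @ Inr j # map Inl L2) = d \<otimes> B.pf ((map Inl K @ map Inr L1) @ Inl j # map Inl L2)"
    by (rule beta_clear_exact) auto
  finally show ?case by (simp add: m_assoc)
qed simp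

lemma beta_Inl: "B.pf (map Inl xs) = pf xs"
  by (simp add: pf_list_map)

lemma beta_Inr: "B.pf (map Inr xs) = d [^] (length xs div 2) \<otimes> Y.pf xs"
  using Y.pf_scale[of d xs] by (simp add: pf_list_map)

lemma beta_split:
  assumes "set Ks \<subseteq> set K"
  shows "B.pf (map Inl Ks @ map Inr L) = pf Ks \<otimes> (d [^] (length L div 2) \<otimes> Y.pf L)"
proof -
  have "B.pf (map Inl Ks @ map Inr L) = B.pf (map Inl Ks) \<otimes> B.pf (map Inr L)"
    by (rule B.pf_append_orthogonal) (use assms y_pivot' in auto)
  then show ?thesis by (simp only: beta_Inl beta_Inr)
qed

text \<open>A Pfaffian form of Sylvester's identity: entries of \<open>L\<close> are made orthogonal
  to \<open>K\<close>, each at the cost of a factor \<open>d\<close>, and the Pfaffian then splits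
  into two blocks. The powers of \<open>d\<close> stay on both sides because \<open>d\<close> may be
  a zero divisor.\<close>

lemma pf_Schur:
  "d [^] length L \<otimes> pf (K @ L) = d \<otimes> (d [^] (length L div 2) \<otimes> Y.pf L)"
  using beta_split[of K L] beta_clear_all[of "[]" L] beta_Inl[of "K @ L"] by simp

end

section \<open>Comparison with the sum over perfect matchings\<close>

lemma (in cring) ctr_eq_finsum:
  assumes "\<And>z. z \<in> set zs \<Longrightarrow> r z \<in> carrier R" "\<And>u. set u \<subseteq> set zs \<Longrightarrow> f u \<in> carrier R"
  shows "ctr r f zs = (\<Oplus>j\<in>{..<length zs}. (\<ominus> \<one>) [^] j \<otimes> (r (zs ! j) \<otimes> f (take j zs @ drop (Suc j) zs)))"
  using assms
proof (induction zs arbitrary: f)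
  case (Cons z zs)
  let ?T = "\<lambda>f zs j. (\<ominus> \<one>) [^] j \<otimes> (r (zs ! j) \<otimes> f (take j zs @ drop (Suc j) zs))"
  have cl: "r ((z # zs) ! j) \<in> carrier R" "f (take j (z # zs) @ drop (Suc j) (z # zs)) \<in> carrier R"
    if "j < length (z # zs)" for j
  proof -
    show "r ((z # zs) ! j) \<in> carrier R" by (rule Cons.prems(1)[OF nth_mem[OF that]])
    show "f (take j (z # zs) @ drop (Suc j) (z # zs)) \<in> carrier R"
      by (rule Cons.prems(2)) (use set_take_subset[of j "z # zs"] set_drop_subset[of "Suc j" "z # zs"] in auto)
  qed
  have T: "?T f (z # zs) j \<in> carrier R" if "j < length (z # zs)" for j
    using cl[OF that] by (intro m_closed nat_pow_closed) auto
  have "(\<Oplus>j\<in>{..<length (z # zs)}. ?T f (z # zs) j) = ?T f (z # zs) 0 \<oplus> (\<Oplus>j\<in>Suc ` {..<length zs}. ?T f (z # zs) j)"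
    unfolding list.size(4) add_0_right add_Suc_right lessThan_Suc_eq_insert_0
    by (rule finsum_insert) (use T T[of 0] in auto)
  also have "(\<Oplus>j\<in>Suc ` {..<length zs}. ?T f (z # zs) j) = (\<Oplus>j\<in>{..<length zs}. ?T f (z # zs) (Suc j))"
    by (rule add.finprod_reindex) (use T in auto)
  also have "\<dots> = (\<Oplus>j\<in>{..<length zs}. \<ominus> \<one> \<otimes> ?T (\<lambda>u. f (z # u)) zs j)"
  proof (rule add.finprod_cong')
    fix j assume "j \<in> {..<length zs}"
    then show "?T f (z # zs) (Suc j) = \<ominus> \<one> \<otimes> ?T (\<lambda>u. f (z # u)) zs j"
      using cl[of "Suc j"] by (simp add: m_ac)
  qed (use cl[of "Suc i" for i] in auto)
  also have "\<dots> = \<ominus> \<one> \<otimes> (\<Oplus>j\<in>{..<length zs}. ?T (\<lambda>u. f (z # u)) zs j)"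
    by (rule finsum_rdistr[symmetric]) (use cl[of "Suc i" for i] in auto)
  also have "(\<Oplus>j\<in>{..<length zs}. ?T (\<lambda>u. f (z # u)) zs j) = ctr r (\<lambda>u. f (z # u)) zs"
  proof (rule Cons.IH[symmetric])
    fix u assume "set u \<subseteq> set zs"
    then show "f (z # u) \<in> carrier R" by (intro Cons.prems(2)) auto
  qed (use Cons.prems in auto)
  moreover have "ctr r (\<lambda>u. f (z # u)) zs \<in> carrier R"
  proof (rule ctr_closed)
    fix u assume "set u \<subseteq> set zs"
    then show "f (z # u) \<in> carrier R" by (intro Cons.prems(2)) auto
  qed (use Cons.prems in auto)
  ultimately show ?case using cl[of 0] by (simp add: l_minus)
qed simp

text \<open>Prepends the edge \<open>{0, j + 1}\<close> to a matching; \<open>skip_index\<close> renumbers the remaining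
  positions by skipping these two. This matches the recursion of \<open>pf_list\<close> along the first row.\<close>

definition skip_index :: "nat \<Rightarrow> nat \<Rightarrow> nat"
  where "skip_index j m = (if m < j then Suc m else Suc (Suc m))"

definition extend_matching :: "nat \<Rightarrow> (nat \<Rightarrow> nat) \<Rightarrow> nat \<Rightarrow> nat"
  where "extend_matching j \<tau> i = (case i of 0 \<Rightarrow> 0 | Suc 0 \<Rightarrow> Suc j | Suc (Suc m) \<Rightarrow> skip_index j (\<tau> m))"

lemma extend_matching_simps [simp]:
  "extend_matching j \<tau> 0 = 0" "extend_matching j \<tau> (Suc 0) = Suc j"
  "extend_matching j \<tau> (Suc (Suc m)) = skip_index j (\<tau> m)"
  by (simp_all add: extend_matching_def)

lemma skip_index_less_iff [simp]: "skip_index j a < skip_index j b \<longleftrightarrow> a < b"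
  by (auto simp: skip_index_def)

lemma skip_index_eq_iff [simp]: "skip_index j a = skip_index j b \<longleftrightarrow> a = b"
  by (auto simp: skip_index_def)

lemma skip_index_neq [simp]: "skip_index j a \<noteq> 0" "skip_index j a \<noteq> Suc j" "Suc j \<noteq> skip_index j a" "0 < skip_index j a"
  by (auto simp: skip_index_def)

text \<open>For \<open>j = 0\<close> the new matching fixes 0 and 1 and shifts \<open>\<tau>\<close>
  by two, so each transposition shifts along. Raising \<open>j\<close> by one later costs exactly
  one further transposition, which gives the parity.\<close>

lemma extend_matching_shift_swapidseq:
  "swapidseq n \<tau> \<Longrightarrow> swapidseq n (extend_matching 0 \<tau>)"
proof (induction rule: swapidseq.induct)
  case id
  have "extend_matching 0 id = (id :: nat \<Rightarrow> nat)"
    by (rule ext) (auto simp: extend_matching_def fun_eq_iff skip_index_def split: nat.splits)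
  then show ?case by (simp only: swapidseq.id)
next
  case (comp_Suc n p a b)
  have "extend_matching 0 (transpose a b \<circ> p) = transpose (Suc (Suc a)) (Suc (Suc b)) \<circ> extend_matching 0 p"
    by (auto simp: extend_matching_def fun_eq_iff skip_index_def Transposition.transpose_def split: nat.splits)
  moreover have "swapidseq (Suc n) (transpose (Suc (Suc a)) (Suc (Suc b)) \<circ> extend_matching 0 p)"
    by (rule swapidseq.comp_Suc[OF comp_Suc.IH]) (use comp_Suc in simp)
  ultimately show ?case by (simp only:)
qed

lemma extend_matching_swapidseq:
  assumes "swapidseq n \<tau>"
  shows "swapidseq (n + j) (extend_matching j \<tau>)"
proof (induction j)
  case 0
  then show ?case using extend_matching_shift_swapidseq[OF assms] by simp
next
  case (Suc j)
  have "extend_matching (Suc j) \<tau> = transpose (Suc j) (Suc (Suc j)) \<circ> extend_matching j \<tau>"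
    by (auto simp: extend_matching_def fun_eq_iff skip_index_def Transposition.transpose_def split: nat.splits)
  moreover have "swapidseq (Suc (n + j)) (transpose (Suc j) (Suc (Suc j)) \<circ> extend_matching j \<tau>)"
    by (rule swapidseq.comp_Suc[OF Suc]) simp
  ultimately show ?case by (simp only: add_Suc_right)
qed

lemma evenperm_extend_matching:
  assumes "permutation \<tau>"
  shows "evenperm (extend_matching j \<tau>) \<longleftrightarrow> (even j \<longleftrightarrow> evenperm \<tau>)"
proof -
  obtain n where n: "swapidseq n \<tau>" using assms permutation_def by blast
  have "evenperm \<tau> = even n" by (rule evenperm_unique[OF n]) simp
  moreover have "evenperm (extend_matching j \<tau>) = even (n + j)"
    by (rule evenperm_unique[OF extend_matching_swapidseq[OF n]]) simp
  ultimately show ?thesis by auto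
qed

lemma matching_perms_0: "matching_perms 0 = {id}"
  by (auto simp: matching_perms_def)

lemma finite_matching_perms: "finite (matching_perms k)"
  by (rule finite_subset[OF _ finite_permutations[of "{..<2 * k}"]]) (auto simp: matching_perms_def)

lemma extend_matching_in:
  assumes j: "j < Suc (2 * k)" and t: "\<tau> \<in> matching_perms k"
  shows "extend_matching j \<tau> \<in> matching_perms (Suc k)"
proof -
  have p: "\<tau> permutes {..<2 * k}" using t by (simp add: matching_perms_def)
  have inj: "inj \<tau>" using p permutes_inj by blast
  have "extend_matching j \<tau> permutes {..<2 * Suc k}"
  proof (rule inj_imp_permutes)
    show "inj_on (extend_matching j \<tau>) {..<2 * Suc k}"
      by (rule inj_onI) (auto simp: extend_matching_def inj_eq[OF inj] split: nat.splits)
    show "extend_matching j \<tau> i \<in> {..<2 * Suc k}" if "i \<in> {..<2 * Suc k}" for i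
    proof -
      have "\<tau> m < 2 * k" if "m < 2 * k" for m using permutes_in_image[OF p, of m] that by simp
      then show ?thesis using that j by (auto simp: extend_matching_def skip_index_def split: nat.splits)
    qed
    show "extend_matching j \<tau> i = i" if "i \<notin> {..<2 * Suc k}" for i
    proof -
      define m where "m = i - 2"
      have m: "i = Suc (Suc m)" "2 * k \<le> m" using that by (auto simp: m_def)
      then have "\<tau> m = m" using permutes_not_in[OF p, of m] by simp
      then show ?thesis using m j by (auto simp: skip_index_def)
    qed
  qed simp
  moreover have "extend_matching j \<tau> (2 * i) < extend_matching j \<tau> (2 * i + 1)" if "i < Suc k" for i
    using that t by (cases i) (auto simp: matching_perms_def)
  moreover have "extend_matching j \<tau> (2 * i) < extend_matching j \<tau> (2 * l)" if "i < l" "l < Suc k" for i l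
  proof -
    obtain l' where "l = Suc l'" using \<open>i < l\<close> by (cases l) auto
    then show ?thesis using that t by (cases i) (auto simp: matching_perms_def)
  qed
  ultimately show ?thesis by (auto simp: matching_perms_def)
qed

lemma extend_matching_surj:
  assumes s: "\<sigma> \<in> matching_perms (Suc k)"
  shows "\<exists>j<Suc (2 * k). \<exists>\<tau>\<in>matching_perms k. \<sigma> = extend_matching j \<tau>"
proof -
  have p: "\<sigma> permutes {..<2 * Suc k}" and m1: "\<And>i. i < Suc k \<Longrightarrow> \<sigma> (2 * i) < \<sigma> (2 * i + 1)"
    and m2: "\<And>i j. i < j \<Longrightarrow> j < Suc k \<Longrightarrow> \<sigma> (2 * i) < \<sigma> (2 * j)"
    using s by (auto simp: matching_perms_def)
  have inj: "\<sigma> a = \<sigma> b \<longleftrightarrow> a = b" for a b using permutes_inj[OF p] by (simp add: inj_eq)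
  \<comment> \<open>The value 0 cannot sit at an odd position, being smaller than its partner, nor
    at a positive even one, since the edges are ordered by their smaller endpoints.\<close>
  have s0: "\<sigma> 0 = 0"
  proof -
    obtain i where i: "\<sigma> i = 0" using permutes_surj[OF p] by (metis surjD)
    have "i < 2 * Suc k" using i permutes_not_in[OF p, of i] by (cases "i < 2 * Suc k") auto
    show ?thesis
    proof (cases "even i")
      case True
      then obtain l where l: "i = 2 * l" by auto
      show ?thesis
      proof (cases l)
        case (Suc l')
        then have "\<sigma> (2 * 0) < \<sigma> (2 * l)" using m2[of 0 l] \<open>i < _\<close> l by simp
        then show ?thesis using i l by simp
      qed (use i l in simp)
    next
      case False
      then obtain l where l: "i = 2 * l + 1" using oddE by blast
      then show ?thesis using m1[of l] i \<open>i < _\<close> by simp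
    qed
  qed
  define j where "j = \<sigma> 1 - 1"
  have "\<sigma> 1 \<noteq> 0" using inj[of 1 0] s0 by simp
  then have s1: "\<sigma> 1 = Suc j" by (simp add: j_def)
  have "\<sigma> 1 < 2 * Suc k" using permutes_in_image[OF p, of 1] by simp
  then have j: "j < Suc (2 * k)" using s1 by simp
  \<comment> \<open>\<open>un\<close> inverts \<open>skip_index j\<close> away from the two omitted
    values 0 and \<open>j + 1\<close>.\<close>
  define un where "un = (\<lambda>m::nat. if m \<le> j then m - 1 else m - 2)"
  have un: "skip_index j (un m) = m" if "m \<noteq> 0" "m \<noteq> Suc j" for m
    using that by (auto simp: skip_index_def un_def)
  define \<tau> where "\<tau> = (\<lambda>m. un (\<sigma> (Suc (Suc m))))"
  have sk: "skip_index j (\<tau> m) = \<sigma> (Suc (Suc m))" for m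
    unfolding \<tau>_def by (rule un) (use inj[of "Suc (Suc m)" 0] inj[of "Suc (Suc m)" 1] s0 s1 in auto)
  have ext: "\<sigma> = extend_matching j \<tau>"
    using s0 s1 sk by (auto simp: extend_matching_def fun_eq_iff split: nat.splits)
  have lt: "\<tau> a < \<tau> b \<longleftrightarrow> \<sigma> (Suc (Suc a)) < \<sigma> (Suc (Suc b))" for a b
    using sk[of a] sk[of b] by (metis skip_index_less_iff)
  have "\<tau> permutes {..<2 * k}"
  proof (rule inj_imp_permutes)
    show "inj_on \<tau> {..<2 * k}"
    proof (rule inj_onI)
      fix a b assume "\<tau> a = \<tau> b"
      then show "a = b" using sk[of a] sk[of b] inj[of "Suc (Suc a)" "Suc (Suc b)"] by simp
    qed
    show "\<tau> m \<in> {..<2 * k}" if "m \<in> {..<2 * k}" for m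
    proof -
      have "\<sigma> (Suc (Suc m)) < 2 * Suc k" using permutes_in_image[OF p, of "Suc (Suc m)"] that by simp
      then show ?thesis using sk[of m] j by (auto simp: skip_index_def split: if_splits)
    qed
    show "\<tau> m = m" if "m \<notin> {..<2 * k}" for m
    proof -
      have "\<sigma> (Suc (Suc m)) = Suc (Suc m)" using permutes_not_in[OF p, of "Suc (Suc m)"] that by simp
      then show ?thesis using sk[of m] j that by (auto simp: skip_index_def split: if_splits)
    qed
  qed simp
  moreover have "\<tau> (2 * i) < \<tau> (2 * i + 1)" if "i < k" for i
    using m1[of "Suc i"] that by (simp add: lt)
  moreover have "\<tau> (2 * i) < \<tau> (2 * l)" if "i < l" "l < k" for i l
    using m2[of "Suc i" "Suc l"] that by (simp add: lt)
  ultimately have "\<tau> \<in> matching_perms k" by (auto simp: matching_perms_def)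
  then show ?thesis using j ext by blast
qed

lemma extend_matching_inj:
  assumes "extend_matching j \<tau> = extend_matching j' \<tau>'"
  shows "j = j'" "\<tau> = \<tau>'"
proof -
  show j: "j = j'" using fun_cong[OF assms, of "Suc 0"] by simp
  show "\<tau> = \<tau>'"
  proof
    fix m show "\<tau> m = \<tau>' m" using fun_cong[OF assms, of "Suc (Suc m)"] j by simp
  qed
qed

lemma matching_perms_Suc:
  "matching_perms (Suc k) = (\<Union>j\<in>{..<Suc (2 * k)}. extend_matching j ` matching_perms k)"
  using extend_matching_in extend_matching_surj by fastforce

context cring begin

definition matching_term :: "('v \<Rightarrow> 'v \<Rightarrow> 'a) \<Rightarrow> 'v list \<Rightarrow> nat \<Rightarrow> (nat \<Rightarrow> nat) \<Rightarrow> 'a"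
  where "matching_term b xs k \<sigma> = (\<Otimes>i\<in>{..<k}. b (xs ! \<sigma> (2 * i)) (xs ! \<sigma> (2 * i + 1)))"

definition signed :: "(nat \<Rightarrow> nat) \<Rightarrow> 'a \<Rightarrow> 'a"
  where "signed \<sigma> x = (if evenperm \<sigma> then x else \<ominus> x)"

lemma matching_index:
  assumes "\<sigma> \<in> matching_perms k" "i < k"
  shows "\<sigma> (2 * i) < 2 * k" "\<sigma> (2 * i + 1) < 2 * k"
proof -
  have p: "\<sigma> permutes {..<2 * k}" using assms by (simp add: matching_perms_def)
  show "\<sigma> (2 * i) < 2 * k" "\<sigma> (2 * i + 1) < 2 * k"
    using permutes_in_image[OF p, of "2 * i"] permutes_in_image[OF p, of "2 * i + 1"] assms(2) by auto
qed

lemma matching_term_closed: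
  assumes "\<And>x y. x \<in> set xs \<Longrightarrow> y \<in> set xs \<Longrightarrow> b x y \<in> carrier R"
    and "length xs = 2 * k" "\<sigma> \<in> matching_perms k"
  shows "matching_term b xs k \<sigma> \<in> carrier R"
  unfolding matching_term_def
  by (rule finprod_closed) (use assms matching_index[OF assms(3)] in \<open>auto intro!: assms(1) nth_mem\<close>)

lemma signed_closed: "x \<in> carrier R \<Longrightarrow> signed \<sigma> x \<in> carrier R"
  by (simp add: signed_def)

lemma neg_one_pow: "(\<ominus> \<one>) [^] (j :: nat) = (if even j then \<one> else \<ominus> \<one>)"
  by (induction j) (auto simp: l_minus)

lemma pf_list_eq_sum:
  assumes "\<And>x y. x \<in> set xs \<Longrightarrow> y \<in> set xs \<Longrightarrow> b x y \<in> carrier R" and "length xs = 2 * k"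
  shows "pf_list R b xs = (\<Oplus>\<sigma>\<in>matching_perms k. signed \<sigma> (matching_term b xs k \<sigma>))"
  using assms
proof (induction k arbitrary: xs)
  case 0
  then show ?case by (simp add: matching_perms_0 signed_def matching_term_def)
next
  case (Suc k)
  obtain x zs where xs: "xs = x # zs" using Suc.prems(2) by (cases xs) auto
  have lz: "length zs = Suc (2 * k)" using Suc.prems(2) xs by simp
  let ?rem = "\<lambda>j. take j zs @ drop (Suc j) zs"
  have rem: "set (?rem j) \<subseteq> set zs" for j by (auto dest: in_set_takeD in_set_dropD)
  have lrem: "length (?rem j) = 2 * k" if "j < Suc (2 * k)" for j using that lz by simp
  have bc: "b u v \<in> carrier R" if "u \<in> set xs" "v \<in> set xs" for u v using Suc.prems(1) that .
  have brem: "b u v \<in> carrier R" if "u \<in> set (?rem j)" "v \<in> set (?rem j)" for u v j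
    by (rule bc) (use that rem[of j] xs in auto)
  have mterm: "matching_term b xs (Suc k) (extend_matching j \<tau>) = b x (zs ! j) \<otimes> matching_term b (?rem j) k \<tau>"
    if j: "j < Suc (2 * k)" and t: "\<tau> \<in> matching_perms k" for j \<tau>
  proof -
    let ?\<sigma> = "extend_matching j \<tau>"
    let ?g = "\<lambda>i. b (xs ! ?\<sigma> (2 * i)) (xs ! ?\<sigma> (2 * i + 1))"
    have idx: "?\<sigma> (2 * i) < length xs" "?\<sigma> (2 * i + 1) < length xs" if "i < Suc k" for i
      using matching_index[OF extend_matching_in[OF j t] that] Suc.prems(2) by auto
    have gc: "?g i \<in> carrier R" if "i < Suc k" for i
      by (intro bc nth_mem idx that)
    have "matching_term b xs (Suc k) ?\<sigma> = ?g 0 \<otimes> finprod R ?g (Suc ` {..<k})"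
      unfolding matching_term_def lessThan_Suc_eq_insert_0 by (rule finprod_insert) (use gc gc[of 0] in auto)
    also have "finprod R ?g (Suc ` {..<k}) = finprod R (\<lambda>i. ?g (Suc i)) {..<k}"
      by (rule finprod_reindex) (use gc in auto)
    also have "\<dots> = matching_term b (?rem j) k \<tau>"
      unfolding matching_term_def
    proof (rule finprod_cong')
      have nth: "xs ! skip_index j m = ?rem j ! m" if "m < 2 * k" for m
        using that j lz xs by (auto simp: skip_index_def nth_append)
      fix i assume i: "i \<in> {..<k}"
      then show "?g (Suc i) = b (?rem j ! \<tau> (2 * i)) (?rem j ! \<tau> (2 * i + 1))"
        using nth matching_index[OF t, of i] by simp
    next
      show "(\<lambda>i. b (?rem j ! \<tau> (2 * i)) (?rem j ! \<tau> (2 * i + 1))) \<in> {..<k} \<rightarrow> carrier R"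
        using matching_index[OF t] lrem[OF j] by (auto intro!: brem nth_mem)
    qed simp
    finally show ?thesis using xs by simp
  qed
  have mt: "matching_term b (?rem j) k \<tau> \<in> carrier R" if "j < Suc (2 * k)" "\<tau> \<in> matching_perms k" for j \<tau>
    by (rule matching_term_closed[OF brem lrem[OF that(1)] that(2)])
  \<comment> \<open>The sign of the \<open>j\<close>th term of the row expansion is exactly the
    change of parity in \<open>evenperm_extend_matching\<close>.\<close>
  have sgn: "signed (extend_matching j \<tau>) (matching_term b xs (Suc k) (extend_matching j \<tau>))
      = ((\<ominus> \<one>) [^] j \<otimes> b x (zs ! j)) \<otimes> signed \<tau> (matching_term b (?rem j) k \<tau>)"
    if j: "j < Suc (2 * k)" and t: "\<tau> \<in> matching_perms k" for j \<tau>
  proof -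
    have "permutation \<tau>" using t by (auto simp: matching_perms_def permutation_permutes)
    moreover have "b x (zs ! j) \<in> carrier R" by (rule bc) (use xs j lz in auto)
    ultimately show ?thesis
      unfolding mterm[OF j t] signed_def evenperm_extend_matching[OF \<open>permutation \<tau>\<close>] neg_one_pow
      using mt[OF j t] by (auto simp: l_minus r_minus)
  qed
  have bz: "b x (zs ! j) \<in> carrier R" if "j < Suc (2 * k)" for j by (rule bc) (use xs that lz in auto)
  have sc: "signed \<sigma> (matching_term b xs (Suc k) \<sigma>) \<in> carrier R" if "\<sigma> \<in> matching_perms (Suc k)" for \<sigma>
    by (intro signed_closed matching_term_closed bc Suc.prems(2) that)
  have "pf_list R b xs = (\<Oplus>j\<in>{..<length zs}. (\<ominus> \<one>) [^] j \<otimes> (b x (zs ! j) \<otimes> pf_list R b (?rem j)))"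
    unfolding xs pf_list.simps by (rule ctr_eq_finsum) (auto intro!: bc pf_list_closed_on simp: xs subset_iff)
  also have "\<dots> = (\<Oplus>j\<in>{..<Suc (2 * k)}. \<Oplus>\<tau>\<in>matching_perms k. signed (extend_matching j \<tau>) (matching_term b xs (Suc k) (extend_matching j \<tau>)))"
    unfolding lz
  proof (rule add.finprod_cong')
    fix j assume j: "j \<in> {..<Suc (2 * k)}"
    then have jl: "j < Suc (2 * k)" by simp
    have "(\<ominus> \<one>) [^] j \<otimes> (b x (zs ! j) \<otimes> pf_list R b (?rem j))
      = ((\<ominus> \<one>) [^] j \<otimes> b x (zs ! j)) \<otimes> pf_list R b (?rem j)"
    proof (rule m_assoc[symmetric])
      show "pf_list R b (?rem j) \<in> carrier R" by (rule pf_list_closed_on) (rule brem; assumption)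
    qed (use bz[OF jl] in auto)
    also have "\<dots> = ((\<ominus> \<one>) [^] j \<otimes> b x (zs ! j)) \<otimes> (\<Oplus>\<tau>\<in>matching_perms k. signed \<tau> (matching_term b (?rem j) k \<tau>))"
      by (simp only: Suc.IH[OF brem lrem[OF jl]])
    also have "\<dots> = (\<Oplus>\<tau>\<in>matching_perms k. ((\<ominus> \<one>) [^] j \<otimes> b x (zs ! j)) \<otimes> signed \<tau> (matching_term b (?rem j) k \<tau>))"
      by (rule finsum_rdistr) (use bz[OF jl] mt[OF jl] finite_matching_perms signed_closed in auto)
    also have "\<dots> = (\<Oplus>\<tau>\<in>matching_perms k. signed (extend_matching j \<tau>) (matching_term b xs (Suc k) (extend_matching j \<tau>)))"
      by (rule add.finprod_cong') (use sgn[OF jl] sc extend_matching_in[OF jl] in auto)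
    finally show "(\<ominus> \<one>) [^] j \<otimes> (b x (zs ! j) \<otimes> pf_list R b (?rem j))
      = (\<Oplus>\<tau>\<in>matching_perms k. signed (extend_matching j \<tau>) (matching_term b xs (Suc k) (extend_matching j \<tau>)))" .
  qed (use sc extend_matching_in in \<open>auto intro!: finsum_closed\<close>)
  also have "\<dots> = (\<Oplus>j\<in>{..<Suc (2 * k)}. \<Oplus>\<sigma>\<in>extend_matching j ` matching_perms k. signed \<sigma> (matching_term b xs (Suc k) \<sigma>))"
  proof (rule add.finprod_cong')
    fix j assume j: "j \<in> {..<Suc (2 * k)}"
    show "(\<Oplus>\<tau>\<in>matching_perms k. signed (extend_matching j \<tau>) (matching_term b xs (Suc k) (extend_matching j \<tau>)))
      = (\<Oplus>\<sigma>\<in>extend_matching j ` matching_perms k. signed \<sigma> (matching_term b xs (Suc k) \<sigma>))"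
      by (rule add.finprod_reindex[symmetric]) (use sc j extend_matching_in extend_matching_inj in \<open>auto simp: inj_on_def\<close>)
  qed (use sc extend_matching_in in \<open>auto intro!: finsum_closed\<close>)
  also have "\<dots> = (\<Oplus>\<sigma>\<in>matching_perms (Suc k). signed \<sigma> (matching_term b xs (Suc k) \<sigma>))"
    unfolding matching_perms_Suc
    by (rule add.finprod_UN_disjoint[symmetric])
      (use sc extend_matching_in finite_matching_perms extend_matching_inj in \<open>auto simp: pairwise_def disjnt_def\<close>)
  finally show ?case .
qed

lemma pfaffian_eq_pf_list:
  assumes "\<And>i j. i < dim_row A \<Longrightarrow> j < dim_row A \<Longrightarrow> A $$ (i, j) \<in> carrier R" "even (dim_row A)"
  shows "pfaffian R A = pf_list R (\<lambda>i j. A $$ (i, j)) [0..<dim_row A]"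
proof -
  define k where "k = dim_row A div 2"
  have k: "dim_row A = 2 * k" using assms(2) by (simp add: k_def)
  have "pf_list R (\<lambda>i j. A $$ (i, j)) [0..<dim_row A]
    = (\<Oplus>\<sigma>\<in>matching_perms k. signed \<sigma> (matching_term (\<lambda>i j. A $$ (i, j)) [0..<dim_row A] k \<sigma>))"
    by (rule pf_list_eq_sum) (use assms k in auto)
  also have "\<dots> = (\<Oplus>\<sigma>\<in>matching_perms k. signed \<sigma> (\<Otimes>i\<in>{..<k}. A $$ (\<sigma> (2 * i), \<sigma> (2 * i + 1))))"
  proof (rule add.finprod_cong')
    fix \<sigma> assume s: "\<sigma> \<in> matching_perms k"
    have "matching_term (\<lambda>i j. A $$ (i, j)) [0..<dim_row A] k \<sigma> = (\<Otimes>i\<in>{..<k}. A $$ (\<sigma> (2 * i), \<sigma> (2 * i + 1)))"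
      unfolding matching_term_def
      by (rule finprod_cong') (use matching_index[OF s] assms k in auto)
    then show "signed \<sigma> (matching_term (\<lambda>i j. A $$ (i, j)) [0..<dim_row A] k \<sigma>)
      = signed \<sigma> (\<Otimes>i\<in>{..<k}. A $$ (\<sigma> (2 * i), \<sigma> (2 * i + 1)))" by simp
  qed (use assms k matching_index in \<open>auto intro!: signed_closed finprod_closed\<close>)
  finally show ?thesis unfolding pfaffian_def Let_def signed_def k_def ..
qed

lemma pfaffian_submatrix:
  assumes "\<And>i j. i < n \<Longrightarrow> j < n \<Longrightarrow> A $$ (i, j) = b i j" "\<And>i j. b i j \<in> carrier R"
    and "dim_row A = n" "dim_col A = n" "J \<subseteq> {..<n}" "even (card J)"
  shows "pfaffian R (submatrix A J J) = pf_list R b (sorted_list_of_set J)"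
proof -
  have fin: "finite J" using assms(5) finite_subset by blast
  have c: "card {i. i < n \<and> i \<in> J} = card J" using assms(5) by (intro arg_cong[where f=card]) auto
  let ?M = "submatrix A J J" and ?k = "card J"
  have dr: "dim_row ?M = ?k" using c assms(3) by (simp add: dim_submatrix)
  have pick: "pick J i < n" if "i < ?k" for i
    using pick_in_set[of i J] that assms(5) by auto
  have M: "?M $$ (i, j) = b (pick J i) (pick J j)" if "i < ?k" "j < ?k" for i j
  proof -
    have "?M $$ (i, j) = A $$ (pick J i, pick J j)"
      by (rule submatrix_index) (use that c assms in auto)
    then show ?thesis using pick that assms(1) by simp
  qed
  \<comment> \<open>\<open>pick J\<close> enumerates \<open>J\<close> increasingly, which identifies
    the indices of the submatrix with the sorted list.\<close>
  have srt: "map (pick J) [0..<?k] = sorted_list_of_set J"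
  proof (rule sorted_distinct_set_unique)
    have mono: "pick J i < pick J j" if "i < j" "j < ?k" for i j
      using pick_mono[of j J i] that by simp
    have sw: "sorted_wrt (<) (map (pick J) [0..<?k])"
      using mono by (auto simp: sorted_wrt_iff_nth_less)
    then show "sorted (map (pick J) [0..<?k])" "distinct (map (pick J) [0..<?k])"
      by (simp_all add: strict_sorted_iff)
    have "pick J ` {0..<?k} \<subseteq> J" using pick_in_set by auto
    moreover have "card (pick J ` {0..<?k}) = ?k"
      using \<open>distinct _\<close> by (simp add: distinct_map card_image)
    ultimately have "pick J ` {0..<?k} = J" using fin by (intro card_subset_eq) auto
    then show "set (map (pick J) [0..<?k]) = set (sorted_list_of_set J)" using fin by simp
  qed (use fin in auto)
  have "pfaffian R ?M = pf_list R (\<lambda>i j. ?M $$ (i, j)) [0..<?k]"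
    using pfaffian_eq_pf_list[of ?M] M assms dr by simp
  also have "\<dots> = pf_list R (\<lambda>i j. b (pick J i) (pick J j)) [0..<?k]"
    by (rule pf_list_cong) (use M in auto)
  also have "\<dots> = pf_list R b (map (pick J) [0..<?k])" by (simp add: pf_list_map)
  finally show ?thesis unfolding srt .
qed

end

lemma (in ideal) finsum_mem:
  assumes "\<And>x. x \<in> A \<Longrightarrow> f x \<in> I"
  shows "finsum R f A \<in> I"
  using assms
proof (induction A rule: infinite_finite_induct)
  case (insert x A)
  have "finsum R f (insert x A) = f x \<oplus> finsum R f A"
    by (rule finsum_insert) (use insert Icarr in auto)
  then show ?case using insert by (simp add: a_closed)
qed (auto simp: zero_closed)

lemma (in ideal) add_mem_cancel:
  assumes "x \<in> carrier R" "y \<in> I"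
  shows "x \<oplus> y \<in> I \<longleftrightarrow> x \<in> I"
proof
  assume "x \<oplus> y \<in> I"
  then have "(x \<oplus> y) \<oplus> \<ominus> y \<in> I" using assms by simp
  moreover have "(x \<oplus> y) \<oplus> \<ominus> y = x" using assms Icarr by (simp add: a_assoc r_neg)
  ultimately show "x \<in> I" by simp
qed (use assms in \<open>simp add: a_closed\<close>)

lemma (in primeideal) mult_mem_iff: "x \<in> carrier R \<Longrightarrow> y \<in> carrier R \<Longrightarrow> x \<otimes> y \<in> I \<longleftrightarrow> x \<in> I \<or> y \<in> I"
  using I_prime I_l_closed I_r_closed by blast

lemma (in primeideal) one_notin: "\<one> \<notin> I"
  using I_notcarr one_imp_carrier by auto

lemma (in primeideal) pow_notin:
  assumes "x \<in> carrier R" "x \<notin> I"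
  shows "x [^] (n :: nat) \<notin> I"
  using assms by (induction n) (auto simp: one_notin mult_mem_iff)

section \<open>Linear algebra modulo a prime\<close>

text \<open>Gaussian elimination over the domain R / I, written with congruences: an equation with
  all coefficients in \<open>I\<close> is dropped; otherwise a coefficient outside \<open>I\<close>
  serves as pivot and removes one unknown together with one equation.\<close>

lemma (in primeideal) homogeneous_system:
  assumes "finite E" "finite U" "card E < card U" "\<And>e u. e \<in> E \<Longrightarrow> u \<in> U \<Longrightarrow> a e u \<in> carrier R"
  shows "\<exists>v. (\<forall>u\<in>U. v u \<in> carrier R) \<and> (\<exists>u\<in>U. v u \<notin> I) \<and> (\<forall>e\<in>E. (\<Oplus>u\<in>U. a e u \<otimes> v u) \<in> I)"
  using assms
proof (induction E arbitrary: U a rule: finite_induct)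
  case empty
  then obtain u where "u \<in> U" by fastforce
  then show ?case using one_notin by (intro exI[of _ "\<lambda>_. \<one>"]) auto
next
  case (insert e E)
  show ?case
  proof (cases "\<forall>u\<in>U. a e u \<in> I")
    case True
    obtain v where v: "\<forall>u\<in>U. v u \<in> carrier R" "\<exists>u\<in>U. v u \<notin> I" "\<forall>e\<in>E. (\<Oplus>u\<in>U. a e u \<otimes> v u) \<in> I"
      using insert.IH[of U a] insert.prems insert.hyps by auto
    have "(\<Oplus>u\<in>U. a e u \<otimes> v u) \<in> I" by (rule finsum_mem) (use True v in \<open>auto intro: I_r_closed\<close>)
    then show ?thesis using v by auto
  next
    case False
    then obtain u0 where u0: "u0 \<in> U" "a e u0 \<notin> I" by blast
    let ?U = "U - {u0}"
    let ?p = "a e u0"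
    \<comment> \<open>Cross-multiplication with the pivot eliminates \<open>u0\<close> without
      division.\<close>
    define a' where "a' = (\<lambda>e' u. ?p \<otimes> a e' u \<ominus> a e' u0 \<otimes> a e u)"
    have ac: "a e' u \<in> carrier R" if "e' \<in> insert e E" "u \<in> U" for e' u using insert.prems that by blast
    have "\<exists>v. (\<forall>u\<in>?U. v u \<in> carrier R) \<and> (\<exists>u\<in>?U. v u \<notin> I) \<and> (\<forall>e\<in>E. (\<Oplus>u\<in>?U. a' e u \<otimes> v u) \<in> I)"
      by (rule insert.IH) (use insert.prems insert.hyps u0 ac in \<open>auto simp: a'_def\<close>)
    then obtain v where v: "\<And>u. u \<in> ?U \<Longrightarrow> v u \<in> carrier R" "\<exists>u\<in>?U. v u \<notin> I" "\<forall>e\<in>E. (\<Oplus>u\<in>?U. a' e u \<otimes> v u) \<in> I"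
      by blast
    define s where "s = (\<Oplus>u\<in>?U. a e u \<otimes> v u)"
    have finU: "finite ?U" using insert.prems by simp
    have sc: "s \<in> carrier R" unfolding s_def by (rule finsum_closed) (use v ac in auto)
    \<comment> \<open>Scaling the reduced solution by the pivot and taking
      \<open>\<ominus> s\<close> at \<open>u0\<close> solves equation \<open>e\<close> exactly. The
      scaled entries stay outside \<open>I\<close> because \<open>I\<close> is prime.\<close>
    define w where "w = (\<lambda>u. if u = u0 then \<ominus> s else ?p \<otimes> v u)"
    have pc: "?p \<in> carrier R" using ac u0 by blast
    have wc: "w u \<in> carrier R" if "u \<in> U" for u using that v sc pc by (auto simp: w_def)
    have U: "U = insert u0 ?U" using u0 by auto
    have split: "(\<Oplus>u\<in>U. a e' u \<otimes> w u) = a e' u0 \<otimes> (\<ominus> s) \<oplus> (\<Oplus>u\<in>?U. ?p \<otimes> (a e' u \<otimes> v u))"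
      if e': "e' \<in> insert e E" for e'
    proof -
      have "(\<Oplus>u\<in>insert u0 ?U. a e' u \<otimes> w u) = a e' u0 \<otimes> w u0 \<oplus> (\<Oplus>u\<in>?U. a e' u \<otimes> w u)"
        by (rule finsum_insert) (use finU ac e' wc u0 in auto)
      also have "(\<Oplus>u\<in>?U. a e' u \<otimes> w u) = (\<Oplus>u\<in>?U. ?p \<otimes> (a e' u \<otimes> v u))"
        by (rule add.finprod_cong') (use ac e' v pc in \<open>auto simp: w_def m_lcomm\<close>)
      finally show ?thesis using U by (simp add: w_def)
    qed
    have eq_e: "(\<Oplus>u\<in>U. a e u \<otimes> w u) = \<zero>"
    proof -
      have "(\<Oplus>u\<in>?U. ?p \<otimes> (a e u \<otimes> v u)) = ?p \<otimes> s"
        unfolding s_def by (rule finsum_rdistr[symmetric]) (use finU pc ac v in auto)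
      then show ?thesis using split[of e] pc sc by (simp add: r_minus l_neg)
    qed
    have eq_E: "(\<Oplus>u\<in>U. a e' u \<otimes> w u) \<in> I" if e': "e' \<in> E" for e'
    proof -
      have a0: "a e' u0 \<in> carrier R" using ac e' u0 by blast
      have "(\<Oplus>u\<in>?U. a' e' u \<otimes> v u) = (\<Oplus>u\<in>?U. ?p \<otimes> (a e' u \<otimes> v u) \<oplus> \<ominus> (a e' u0 \<otimes> (a e u \<otimes> v u)))"
        by (rule add.finprod_cong')
          (use ac e' v pc a0 in \<open>auto simp: a'_def a_minus_def l_distr l_minus m_assoc\<close>)
      also have "\<dots> = (\<Oplus>u\<in>?U. ?p \<otimes> (a e' u \<otimes> v u)) \<oplus> (\<Oplus>u\<in>?U. (\<ominus> a e' u0) \<otimes> (a e u \<otimes> v u))"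
      proof -
        have "(\<Oplus>u\<in>?U. ?p \<otimes> (a e' u \<otimes> v u) \<oplus> \<ominus> (a e' u0 \<otimes> (a e u \<otimes> v u)))
          = (\<Oplus>u\<in>?U. ?p \<otimes> (a e' u \<otimes> v u) \<oplus> (\<ominus> a e' u0) \<otimes> (a e u \<otimes> v u))"
          by (rule add.finprod_cong') (use ac e' v pc a0 in \<open>auto simp: l_minus\<close>)
        also have "\<dots> = (\<Oplus>u\<in>?U. ?p \<otimes> (a e' u \<otimes> v u)) \<oplus> (\<Oplus>u\<in>?U. (\<ominus> a e' u0) \<otimes> (a e u \<otimes> v u))"
          by (rule finsum_addf) (use ac e' v pc a0 in auto)
        finally show ?thesis .
      qed
      also have "(\<Oplus>u\<in>?U. (\<ominus> a e' u0) \<otimes> (a e u \<otimes> v u)) = (\<ominus> a e' u0) \<otimes> s"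
        unfolding s_def by (rule finsum_rdistr[symmetric]) (use finU a0 ac v in auto)
      also have "(\<Oplus>u\<in>?U. ?p \<otimes> (a e' u \<otimes> v u)) \<oplus> (\<ominus> a e' u0) \<otimes> s = (\<Oplus>u\<in>U. a e' u \<otimes> w u)"
      proof -
        have "(\<Oplus>u\<in>?U. ?p \<otimes> (a e' u \<otimes> v u)) \<in> carrier R"
          by (rule finsum_closed) (use ac e' v pc in auto)
        then show ?thesis using split[of e'] e' a0 sc by (simp add: l_minus r_minus a_comm)
      qed
      finally show ?thesis using v e' by metis
    qed
    obtain u where u: "u \<in> ?U" "v u \<notin> I" using v by blast
    have "w u \<notin> I" using u u0 pc v by (auto simp: w_def mult_mem_iff)
    then show ?thesis using wc u eq_e eq_E zero_closed by (intro exI[of _ w]) auto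
  qed
qed

lemma (in cring) Idl_finite_combinations:
  assumes "finite A" "A \<subseteq> carrier R" "x \<in> Idl A"
  shows "\<exists>g. (\<forall>a\<in>A. g a \<in> carrier R) \<and> x = (\<Oplus>a\<in>A. g a \<otimes> a)"
proof -
  let ?J = "{x. \<exists>g. (\<forall>a\<in>A. g a \<in> carrier R) \<and> x = (\<Oplus>a\<in>A. g a \<otimes> a)}"
  have Ac: "a \<in> carrier R" if "a \<in> A" for a using assms that by blast
  have "ideal ?J R"
  proof (rule idealI_cring)
    show "?J \<subseteq> carrier R" using Ac by (auto intro!: finsum_closed)
    have "(\<Oplus>a\<in>A. \<zero> \<otimes> a) = (\<Oplus>a\<in>A. \<zero>)" by (rule add.finprod_cong') (use Ac in auto)
    then have "(\<Oplus>a\<in>A. \<zero> \<otimes> a) = \<zero>" by simp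
    then show "\<zero> \<in> ?J" by (intro CollectI exI[of _ "\<lambda>_. \<zero>"]) auto
  next
    fix x y assume "x \<in> ?J" "y \<in> ?J"
    then obtain g h where g: "\<forall>a\<in>A. g a \<in> carrier R" "x = (\<Oplus>a\<in>A. g a \<otimes> a)"
      and h: "\<forall>a\<in>A. h a \<in> carrier R" "y = (\<Oplus>a\<in>A. h a \<otimes> a)" by blast
    have "x \<oplus> y = (\<Oplus>a\<in>A. g a \<otimes> a \<oplus> h a \<otimes> a)"
      unfolding g h by (rule finsum_addf[symmetric]) (use g h Ac in auto)
    also have "\<dots> = (\<Oplus>a\<in>A. (g a \<oplus> h a) \<otimes> a)"
      by (rule add.finprod_cong') (use g h Ac in \<open>auto simp: l_distr\<close>)
    finally show "x \<oplus> y \<in> ?J" using g h by (intro CollectI exI[of _ "\<lambda>a. g a \<oplus> h a"]) auto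
  next
    fix x r assume "x \<in> ?J" and r: "r \<in> carrier R"
    then obtain g where g: "\<forall>a\<in>A. g a \<in> carrier R" "x = (\<Oplus>a\<in>A. g a \<otimes> a)" by blast
    have "r \<otimes> x = (\<Oplus>a\<in>A. r \<otimes> (g a \<otimes> a))"
      unfolding g by (rule finsum_rdistr) (use g r Ac assms in auto)
    also have "\<dots> = (\<Oplus>a\<in>A. (r \<otimes> g a) \<otimes> a)"
      by (rule add.finprod_cong') (use g r Ac in \<open>auto simp: m_assoc\<close>)
    finally show "r \<otimes> x \<in> ?J" using g r by (intro CollectI exI[of _ "\<lambda>a. r \<otimes> g a"]) auto
  qed
  moreover have "A \<subseteq> ?J"
  proof
    fix b assume b: "b \<in> A"
    have "(\<Oplus>a\<in>A. (if b = a then \<one> else \<zero>) \<otimes> a) = (\<Oplus>a\<in>A. if b = a then a else \<zero>)"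
      by (rule add.finprod_cong') (use Ac in auto)
    also have "\<dots> = b" using add.finprod_singleton[OF b assms(1), of "\<lambda>a. a"] Ac by auto
    finally show "b \<in> ?J" by (intro CollectI exI[of _ "\<lambda>a. if b = a then \<one> else \<zero>"]) auto
  qed
  ultimately have "Idl A \<subseteq> ?J" by (rule genideal_minimal)
  then show ?thesis using assms(3) by blast
qed

section \<open>Primes of polynomial rings\<close>

lemma (in ring_hom_cring) prime_vimage:
  assumes "primeideal Q S"
  shows "primeideal {x \<in> carrier R. h x \<in> Q} R"
proof -
  interpret Q: primeideal Q S by fact
  have "ideal {x \<in> carrier R. h x \<in> Q} R"
    by (rule R.idealI_cring) (use Q.zero_closed in \<open>auto simp: Q.a_closed Q.I_l_closed\<close>)
  then show ?thesis
  proof (rule primeidealI[OF _ R.is_cring])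
    show "carrier R \<noteq> {x \<in> carrier R. h x \<in> Q}"
      using Q.one_notin hom_one R.one_closed by (metis (no_types, lifting) mem_Collect_eq)
  qed (auto simp: Q.mult_mem_iff)
qed

lemma (in cring) exists_prime:
  assumes "carrier R \<noteq> {\<zero>}"
  shows "\<exists>P. primeideal P R"
proof -
  let ?A = "{J. ideal J R \<and> \<one> \<notin> J}"
  have "\<one> \<noteq> \<zero>" using assms one_zeroD by blast
  then have ne: "?A \<noteq> {}" using zeroideal by auto
  have "\<exists>M\<in>?A. \<forall>Z\<in>?A. M \<subseteq> Z \<longrightarrow> Z = M"
  proof (rule subset_Zorn_nonempty[OF ne])
    fix C assume C: "C \<noteq> {}" "subset.chain ?A C"
    have id: "ideal J R" "\<one> \<notin> J" if "J \<in> C" for J using C that by (auto simp: subset.chain_def)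
    have tot: "J \<subseteq> J' \<or> J' \<subseteq> J" if "J \<in> C" "J' \<in> C" for J J'
      using C that unfolding subset.chain_def by blast
    have "ideal (\<Union>C) R"
    proof (rule idealI_cring)
      show "\<Union>C \<subseteq> carrier R" using ideal.Icarr[OF id(1)] by auto
      show "\<zero> \<in> \<Union>C" using C(1) additive_subgroup.zero_closed[OF ideal.axioms(1)[OF id(1)]] by auto
    next
      fix a c assume "a \<in> \<Union>C" "c \<in> \<Union>C"
      then obtain J where J: "J \<in> C" "a \<in> J" "c \<in> J" using tot by blast
      interpret J: ideal J R using id J by blast
      show "a \<oplus> c \<in> \<Union>C" using J J.a_closed by blast
    next
      fix a r assume "a \<in> \<Union>C" "r \<in> carrier R"
      then show "r \<otimes> a \<in> \<Union>C" using ideal.I_l_closed[OF id(1)] by auto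
    qed
    then show "\<Union>C \<in> ?A" using id(2) by blast
  qed
  then obtain M where M: "ideal M R" "\<one> \<notin> M" "\<And>Z. ideal Z R \<Longrightarrow> \<one> \<notin> Z \<Longrightarrow> M \<subseteq> Z \<Longrightarrow> Z = M" by blast
  have "maximalideal M R"
  proof (rule maximalidealI[OF M(1)])
    show "carrier R \<noteq> M" using M(2) one_closed by blast
    fix J assume J: "ideal J R" "M \<subseteq> J" "J \<subseteq> carrier R"
    show "J = M \<or> J = carrier R"
    proof (cases "\<one> \<in> J")
      case True
      then show ?thesis using ideal.one_imp_carrier[OF J(1)] by blast
    next
      case False
      then show ?thesis using M(3) J by blast
    qed
  qed
  then show ?thesis using maximalideal_prime by blast
qed

lemma (in cring) exists_minimal_prime:
  assumes "carrier R \<noteq> {\<zero>}"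
  shows "\<exists>q. primeideal q R \<and> (\<forall>P. primeideal P R \<longrightarrow> P \<subseteq> q \<longrightarrow> P = q)"
proof -
  \<comment> \<open>Complements turn a minimal prime into a maximal set, and intersections of chains
    of primes into unions, so that Zorn's lemma applies.\<close>
  let ?A = "{carrier R - P | P. primeideal P R}"
  have ne: "?A \<noteq> {}" using exists_prime[OF assms] by blast
  have "\<exists>M\<in>?A. \<forall>Z\<in>?A. M \<subseteq> Z \<longrightarrow> Z = M"
  proof (rule subset_Zorn_nonempty[OF ne])
    fix C assume C: "C \<noteq> {}" "subset.chain ?A C"
    define D where "D = {P. primeideal P R \<and> carrier R - P \<in> C}"
    have CA: "C \<subseteq> ?A" using C(2) by (simp add: subset.chain_def)
    have pr: "primeideal P R" if "P \<in> D" for P using that by (simp add: D_def)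
    have sub: "P \<subseteq> carrier R" if "P \<in> D" for P
      using ideal.Icarr[OF primeideal.axioms(1)[OF pr[OF that]]] by auto
    have Dne: "D \<noteq> {}" using C(1) CA unfolding D_def by blast
    have CD: "\<Union>C = carrier R - \<Inter>D"
    proof
      show "\<Union>C \<subseteq> carrier R - \<Inter>D"
      proof
        fix x assume "x \<in> \<Union>C"
        then obtain Z where Z: "Z \<in> C" "x \<in> Z" by blast
        then obtain P where "Z = carrier R - P" "primeideal P R" using CA by blast
        then show "x \<in> carrier R - \<Inter>D" using Z unfolding D_def by blast
      qed
      show "carrier R - \<Inter>D \<subseteq> \<Union>C" unfolding D_def by blast
    qed
    have tot: "P \<subseteq> Q \<or> Q \<subseteq> P" if "P \<in> D" "Q \<in> D" for P Q
    proof -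
      have "carrier R - P \<subseteq> carrier R - Q \<or> carrier R - Q \<subseteq> carrier R - P"
        using subset.chain_total[OF C(2), of "carrier R - P" "carrier R - Q"] that by (auto simp only: D_def mem_Collect_eq)
      then show ?thesis using sub[OF that(1)] sub[OF that(2)] by blast
    qed
    have "primeideal (\<Inter>D) R"
    proof (rule primeidealI)
      show "ideal (\<Inter>D) R" by (rule i_Intersect[OF primeideal.axioms(1)[OF pr] Dne])
      obtain P where P: "P \<in> D" using Dne by blast
      have "\<one> \<notin> P" using primeideal.one_notin[OF pr[OF P]] .
      then show "carrier R \<noteq> \<Inter>D" using P one_closed by blast
      fix a c assume ac: "a \<in> carrier R" "c \<in> carrier R" "a \<otimes> c \<in> \<Inter>D"
      show "a \<in> \<Inter>D \<or> c \<in> \<Inter>D"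
      proof (rule ccontr)
        assume "\<not> (a \<in> \<Inter>D \<or> c \<in> \<Inter>D)"
        then obtain P Q where PQ: "P \<in> D" "Q \<in> D" "a \<notin> P" "c \<notin> Q" by blast
        \<comment> \<open>The smaller of the two primes misses both factors.\<close>
        then obtain T where "T \<in> D" "a \<notin> T" "c \<notin> T" using tot[OF PQ(1,2)] by blast
        moreover have "a \<otimes> c \<in> T" using ac(3) \<open>T \<in> D\<close> by blast
        ultimately show False using primeideal.mult_mem_iff[OF pr[OF \<open>T \<in> D\<close>] ac(1,2)] by simp
      qed
    qed (rule is_cring)
    then show "\<Union>C \<in> ?A" unfolding CD by (intro CollectI exI[of _ "\<Inter>D"] conjI refl)
  qed
  then obtain M where M: "M \<in> ?A" "\<forall>Z\<in>?A. M \<subseteq> Z \<longrightarrow> Z = M" by (rule bexE)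
  from M(1) obtain q where q1: "primeideal q R" and Mq: "M = carrier R - q" by auto
  have q: "carrier R - P = carrier R - q" if "primeideal P R" "carrier R - q \<subseteq> carrier R - P" for P
  proof -
    have "carrier R - P \<in> ?A" using that(1) by (intro CollectI exI[of _ P] conjI refl)
    from bspec[OF M(2) this] show ?thesis using that(2) unfolding Mq by (rule mp)
  qed
  have "P = q" if P: "primeideal P R" "P \<subseteq> q" for P
  proof -
    have "carrier R - P = carrier R - q" by (rule q[OF P(1)]) (use P(2) in auto)
    moreover have "P \<subseteq> carrier R" "q \<subseteq> carrier R"
      using ideal.Icarr[OF primeideal.axioms(1)[OF P(1)]] ideal.Icarr[OF primeideal.axioms(1)[OF q1]] by auto
    ultimately show ?thesis by blast
  qed
  then show ?thesis using q1 by (intro exI[of _ q] conjI) auto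
qed

text \<open>The ideal generated by \<open>\<mm>\<close> and the variables in \<open>F\<close>, when
  \<mm> is an ideal and \<open>F\<close> a subset of \<open>V\<close>, described through
  coefficients.\<close>

definition coeff_prime :: "('a, 'b) ring_scheme \<Rightarrow> 'v set \<Rightarrow> 'a set \<Rightarrow> 'v set \<Rightarrow> ('v multiset \<Rightarrow> 'a) set"
  where "coeff_prime A V \<mm> F = {f \<in> carrier (mpoly_ring A V). \<forall>m. set_mset m \<inter> F = {} \<longrightarrow> f m \<in> \<mm>}"

lemma (in primeideal) coeff_prime_ideal: "ideal (coeff_prime R V I F) (mpoly_ring R V)"
proof -
  interpret P: cring "mpoly_ring R V" by (rule mpoly_ring_cring)
  show ?thesis
  proof (rule P.idealI_cring)
    show "\<zero>\<^bsub>mpoly_ring R V\<^esub> \<in> coeff_prime R V I F"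
      using P.zero_closed by (simp add: coeff_prime_def mpoly_zero indexed_const_def)
    fix f g assume "f \<in> coeff_prime R V I F" "g \<in> coeff_prime R V I F"
    then show "f \<oplus>\<^bsub>mpoly_ring R V\<^esub> g \<in> coeff_prime R V I F"
      using P.a_closed[of f g] by (auto simp: coeff_prime_def mpoly_add indexed_padd_def a_closed)
  next
    fix f g assume f: "f \<in> coeff_prime R V I F" and g: "g \<in> carrier (mpoly_ring R V)"
    have "(g \<otimes>\<^bsub>mpoly_ring R V\<^esub> f) m \<in> I" if m: "set_mset m \<inter> F = {}" for m
      unfolding mpoly_mult_eq mpoly_mult_def
    proof (rule finsum_mem)
      fix a assume "a \<in> {a. a \<subseteq># m}"
      have "set_mset (m - a) \<inter> F = {}" using m by (meson disjoint_iff in_diffD)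
      then show "g a \<otimes> f (m - a) \<in> I" using f g by (auto simp: coeff_prime_def intro!: I_l_closed intro: mpoly_coeff_closed)
    qed
    then show "g \<otimes>\<^bsub>mpoly_ring R V\<^esub> f \<in> coeff_prime R V I F"
      using f g P.m_closed by (auto simp: coeff_prime_def)
  qed (auto simp: coeff_prime_def)
qed

text \<open>Take the largest \<open>F\<close>-free monomials \<open>M\<close> and \<open>M'\<close>
  of the factors with coefficients outside \<open>I\<close>. In the coefficient of
  \<open>M + M'\<close>, every other product involves a monomial above \<open>M\<close> or one above
  \<open>M'\<close> and so lies in \<open>I\<close>. The comparison needs a linear order on
  monomials compatible with addition; this is the reason for ordering the variables.\<close>

lemma (in primeideal) coeff_prime:
  fixes V F :: "'v :: linorder set"
  shows "primeideal (coeff_prime R V I F) (mpoly_ring R V)"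
proof -
  interpret P: cring "mpoly_ring R V" by (rule mpoly_ring_cring)
  show ?thesis
  proof (rule primeidealI[OF coeff_prime_ideal mpoly_ring_cring])
    have "\<one>\<^bsub>mpoly_ring R V\<^esub> \<notin> coeff_prime R V I F"
    proof
      assume "\<one>\<^bsub>mpoly_ring R V\<^esub> \<in> coeff_prime R V I F"
      then have "\<one>\<^bsub>mpoly_ring R V\<^esub> {#} \<in> I" by (simp add: coeff_prime_def)
      then show False using one_notin by (simp add: mpoly_one indexed_const_def)
    qed
    then show "carrier (mpoly_ring R V) \<noteq> coeff_prime R V I F" using P.one_closed by blast
    fix f g assume f: "f \<in> carrier (mpoly_ring R V)" and g: "g \<in> carrier (mpoly_ring R V)"
      and fg: "f \<otimes>\<^bsub>mpoly_ring R V\<^esub> g \<in> coeff_prime R V I F"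
    show "f \<in> coeff_prime R V I F \<or> g \<in> coeff_prime R V I F"
    proof (rule ccontr)
      assume neg: "\<not> (f \<in> coeff_prime R V I F \<or> g \<in> coeff_prime R V I F)"
      have lead: "\<exists>M. set_mset M \<inter> F = {} \<and> h M \<notin> I \<and> (\<forall>m. set_mset m \<inter> F = {} \<longrightarrow> M < m \<longrightarrow> h m \<in> I)"
        if h: "h \<in> carrier (mpoly_ring R V)" "h \<notin> coeff_prime R V I F" for h
      proof -
        let ?S = "{m. set_mset m \<inter> F = {} \<and> h m \<notin> I}"
        have "?S \<subseteq> {m. h m \<noteq> \<zero>}" using zero_closed by auto
        then have fin: "finite ?S" using mpoly_finite_support[OF h(1)] finite_subset by blast
        have ne: "?S \<noteq> {}" using h by (auto simp: coeff_prime_def)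
        have "Max ?S \<in> ?S" by (rule Max_in[OF fin ne])
        moreover have "h m \<in> I" if "set_mset m \<inter> F = {}" "Max ?S < m" for m
          using that Max_ge[OF fin, of m] by (metis (mono_tags, lifting) leD mem_Collect_eq)
        ultimately show ?thesis by blast
      qed
      obtain M where M: "set_mset M \<inter> F = {}" "f M \<notin> I" "\<And>m. set_mset m \<inter> F = {} \<Longrightarrow> M < m \<Longrightarrow> f m \<in> I"
        using lead[OF f] neg by blast
      obtain M' where M': "set_mset M' \<inter> F = {}" "g M' \<notin> I" "\<And>m. set_mset m \<inter> F = {} \<Longrightarrow> M' < m \<Longrightarrow> g m \<in> I"
        using lead[OF g] neg by blast
      let ?A = "{a. a \<subseteq># M + M'}"
      have free: "set_mset a \<inter> F = {}" "set_mset (M + M' - a) \<inter> F = {}" if "a \<in> ?A" for a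
      proof -
        have "set_mset (M + M') \<inter> F = {}" using M(1) M'(1) by auto
        then show "set_mset a \<inter> F = {}" "set_mset (M + M' - a) \<inter> F = {}"
          using set_mset_mono[of a "M + M'"] set_mset_mono[OF diff_subset_eq_self[of "M + M'" a]] that by blast+
      qed
      have A: "?A = insert M (?A - {M})" by auto
      have fc: "f m \<in> carrier R" and gc: "g m \<in> carrier R" for m using f g by (auto intro: mpoly_coeff_closed)
      have "(f \<otimes>\<^bsub>mpoly_ring R V\<^esub> g) (M + M') = (\<Oplus>a\<in>insert M (?A - {M}). f a \<otimes> g (M + M' - a))"
        using A by (simp add: mpoly_mult_eq mpoly_mult_def)
      also have "\<dots> = f M \<otimes> g (M + M' - M) \<oplus> (\<Oplus>a\<in>?A - {M}. f a \<otimes> g (M + M' - a))"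
        by (rule finsum_insert) (use finite_submultisets fc gc in auto)
      finally have eq: "(f \<otimes>\<^bsub>mpoly_ring R V\<^esub> g) (M + M') = f M \<otimes> g M' \<oplus> (\<Oplus>a\<in>?A - {M}. f a \<otimes> g (M + M' - a))"
        by simp
      have rest: "(\<Oplus>a\<in>?A - {M}. f a \<otimes> g (M + M' - a)) \<in> I"
      proof (rule finsum_mem)
        fix a assume a: "a \<in> ?A - {M}"
        let ?b = "M + M' - a"
        have ab: "a + ?b = M + M'" using a by simp
        show "f a \<otimes> g ?b \<in> I"
        proof (cases "M < a")
          case True
          then have "f a \<in> I" using M(3) free a by blast
          then show ?thesis using gc by (rule I_r_closed)
        next
          case False
          then have "a < M" using a by auto
          have "M' < ?b"
          proof (rule ccontr)
            assume "\<not> M' < ?b"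
            then have "a + ?b < M + M'" using \<open>a < M\<close> by (intro add_less_le_mono) auto
            then show False using ab by simp
          qed
          then have "g ?b \<in> I" using M'(3) free(2)[of a] a by blast
          then show ?thesis using fc by (rule I_l_closed)
        qed
      qed
      have "set_mset (M + M') \<inter> F = {}" using M(1) M'(1) by auto
      then have "(f \<otimes>\<^bsub>mpoly_ring R V\<^esub> g) (M + M') \<in> I" using fg by (simp add: coeff_prime_def)
      then have "f M \<otimes> g M' \<in> I" unfolding eq using add_mem_cancel[OF _ rest] fc gc by simp
      then show False using M(2) M'(2) fc gc by (simp add: mult_mem_iff)
    qed
  qed
qed

lemma (in cring) const_coeff_hom: "ring_hom_cring (mpoly_ring R V) R (\<lambda>f. f {#})"
proof (rule ring_hom_cringI[OF mpoly_ring_cring is_cring ring_hom_memI])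
  fix f g assume fg: "f \<in> carrier (mpoly_ring R V)" "g \<in> carrier (mpoly_ring R V)"
  have "{a. a \<subseteq># ({#} :: 'c multiset)} = {{#}}" by auto
  then show "(f \<otimes>\<^bsub>mpoly_ring R V\<^esub> g) {#} = f {#} \<otimes> g {#}"
    using fg by (simp add: mpoly_mult_eq mpoly_mult_def mpoly_coeff_closed)
  show "(f \<oplus>\<^bsub>mpoly_ring R V\<^esub> g) {#} = f {#} \<oplus> g {#}"
    by (simp add: mpoly_add indexed_padd_def)
qed (auto simp: mpoly_one indexed_const_def mpoly_coeff_closed)

text \<open>Serves to compare the localization map with the constant term of the chart, which agree
  on constants but on the variables only modulo an ideal.\<close>

lemma (in cring) mpoly_hom_cong_mod:
  assumes "ring_hom_cring (mpoly_ring R V) T f" "ring_hom_cring (mpoly_ring R V) T g" "ideal J T"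
    and "\<And>k. k \<in> carrier R \<Longrightarrow> f (indexed_const k) = g (indexed_const k)"
    and "\<And>i. i \<in> V \<Longrightarrow> f (indexed_var i) \<ominus>\<^bsub>T\<^esub> g (indexed_var i) \<in> J"
    and "x \<in> carrier (mpoly_ring R V)"
  shows "f x \<ominus>\<^bsub>T\<^esub> g x \<in> J"
proof -
  interpret f: ring_hom_cring "mpoly_ring R V" T f by fact
  interpret g: ring_hom_cring "mpoly_ring R V" T g by fact
  interpret J: ideal J T by fact
  show ?thesis using assms(6)
  proof (induction rule: mpoly_induct)
    case (const k)
    then show ?case using assms(4)[OF const] J.zero_closed by (simp add: f.S.r_neg a_minus_def)
  next
    case (add a b)
    have "f (a \<oplus>\<^bsub>mpoly_ring R V\<^esub> b) \<ominus>\<^bsub>T\<^esub> g (a \<oplus>\<^bsub>mpoly_ring R V\<^esub> b) = (f a \<ominus>\<^bsub>T\<^esub> g a) \<oplus>\<^bsub>T\<^esub> (f b \<ominus>\<^bsub>T\<^esub> g b)"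
      using add by (simp add: a_minus_def f.S.minus_add f.S.a_ac)
    then show ?case using add by (simp add: J.a_closed)
  next
    case (var a i)
    let ?x = "indexed_var i"
    have c: "f ?x \<in> carrier T" "g ?x \<in> carrier T" "f a \<in> carrier T" "g a \<in> carrier T" using var by simp_all
    have "f (?x \<otimes>\<^bsub>mpoly_ring R V\<^esub> a) \<ominus>\<^bsub>T\<^esub> g (?x \<otimes>\<^bsub>mpoly_ring R V\<^esub> a)
      = f ?x \<otimes>\<^bsub>T\<^esub> f a \<ominus>\<^bsub>T\<^esub> g ?x \<otimes>\<^bsub>T\<^esub> g a" using var by simp
    also have "\<dots> = f ?x \<otimes>\<^bsub>T\<^esub> (f a \<ominus>\<^bsub>T\<^esub> g a) \<oplus>\<^bsub>T\<^esub> (f ?x \<ominus>\<^bsub>T\<^esub> g ?x) \<otimes>\<^bsub>T\<^esub> g a"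
    proof -
      have "f ?x \<otimes>\<^bsub>T\<^esub> (f a \<ominus>\<^bsub>T\<^esub> g a) \<oplus>\<^bsub>T\<^esub> (f ?x \<ominus>\<^bsub>T\<^esub> g ?x) \<otimes>\<^bsub>T\<^esub> g a
        = f ?x \<otimes>\<^bsub>T\<^esub> f a \<oplus>\<^bsub>T\<^esub> (\<ominus>\<^bsub>T\<^esub> (f ?x \<otimes>\<^bsub>T\<^esub> g a) \<oplus>\<^bsub>T\<^esub> f ?x \<otimes>\<^bsub>T\<^esub> g a) \<oplus>\<^bsub>T\<^esub> \<ominus>\<^bsub>T\<^esub> (g ?x \<otimes>\<^bsub>T\<^esub> g a)"
        using c by (simp add: a_minus_def f.S.l_distr f.S.r_distr f.S.l_minus f.S.r_minus f.S.a_assoc)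
      then show ?thesis using c by (simp add: f.S.l_neg a_minus_def)
    qed
    also have "\<dots> \<in> J" using c var assms(5) by (intro J.a_closed J.I_l_closed J.I_r_closed) auto
    finally show ?case .
  qed
qed

lemma ring_hom_cring_trans:
  assumes "ring_hom_cring R S f" "ring_hom_cring S T g"
  shows "ring_hom_cring R T (\<lambda>x. g (f x))"
proof -
  interpret f: ring_hom_cring R S f by fact
  interpret g: ring_hom_cring S T g by fact
  show ?thesis
    by (rule ring_hom_cringI[OF f.R.is_cring g.S.is_cring ring_hom_memI]) auto
qed

lemma (in ring) indexed_var_coeff: "indexed_var i m = (if m = {#i#} then \<one> else \<zero>)"
  by (simp add: indexed_var_eq_monom mpoly_monom_def)

lemma (in ring) indexed_const_coeff: "indexed_const k {#} = k"
  by (simp add: indexed_const_def)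

definition var_form :: "('a, 'b) ring_scheme \<Rightarrow> (nat \<times> nat) set \<Rightarrow> nat \<Rightarrow> nat \<Rightarrow> ((nat \<times> nat) multiset \<Rightarrow> 'a)"
  where "var_form S V i j = (if (i, j) \<in> V then ring.indexed_var S (i, j)
    else if (j, i) \<in> V then \<ominus>\<^bsub>mpoly_ring S V\<^esub> ring.indexed_var S (j, i) else \<zero>\<^bsub>mpoly_ring S V\<^esub>)"

lemma (in cring) var_form_alternating:
  assumes "V \<subseteq> {(i, j). i < j}"
  shows "alternating_form (mpoly_ring R V) (var_form R V)"
proof -
  interpret P: cring "mpoly_ring R V" by (rule mpoly_ring_cring)
  show ?thesis
  proof
    fix i j
    have lt: "(i, j) \<in> V \<Longrightarrow> (j, i) \<notin> V"
      using subsetD[OF assms, of "(i, j)"] subsetD[OF assms, of "(j, i)"] by auto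
    show "var_form R V i j \<in> carrier (mpoly_ring R V)" by (simp add: var_form_def)
    show "var_form R V i i = \<zero>\<^bsub>mpoly_ring R V\<^esub>" using assms by (auto simp: var_form_def)
    show "var_form R V j i = \<ominus>\<^bsub>mpoly_ring R V\<^esub> var_form R V i j" using lt by (auto simp: var_form_def)
  qed
qed

section \<open>Pfaffian ideals after pivoting\<close>

context pf_pivot begin

text \<open>At the cost of a factor \<open>d\<close>, which cancels modulo \<open>J\<close>, each
  \<open>Inl j\<close> with \<open>j\<close> outside \<open>K\<close> is replaced by
  \<open>Inr j\<close> and correction terms with entries of \<open>K\<close>. In the end, a list
  with distinct entries uses at most \<open>length K\<close> entries from \<open>K\<close>, so at
  least \<open>m\<close> orthogonal ones remain. The Pfaffian then splits, and its second factor
  lies in \<open>J\<close>.\<close>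

lemma pf_in_ideal:
  assumes J: "ideal J R" and cancel: "\<And>x. x \<in> carrier R \<Longrightarrow> d \<otimes> x \<in> J \<Longrightarrow> x \<in> J"
    and m: "even m"
    and gens: "\<And>L. distinct L \<Longrightarrow> set L \<subseteq> D - set K \<Longrightarrow> length L = m \<Longrightarrow> Y.pf L \<in> J"
    and xs: "set xs \<subseteq> D" "length xs = length K + m"
  shows "pf xs \<in> J"
proof -
  interpret J: ideal J R by fact
  have G2: "Y.pf L \<in> J" if "set L \<subseteq> D - set K" "length L = m" for L
    using gens[of L] that Y.pf_dup[of L] J.zero_closed by (cases "distinct L") auto
  \<comment> \<open>Lengths grow in steps of two because each term of a row expansion omits two
    entries.\<close>
  have G3: "Y.pf L \<in> J" if "set L \<subseteq> D - set K" "length L = m + 2 * i" for L i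
    using that
  proof (induction i arbitrary: L)
    case 0
    then show ?case using G2 by simp
  next
    case (Suc i)
    then obtain x zs where L: "L = x # zs" by (cases L) auto
    have "ctr (y x) Y.pf zs \<in> J"
    proof (rule ctr_in_ideal[OF J])
      fix u assume "length zs = Suc (length u)" "set u \<subseteq> set zs"
      then show "Y.pf u \<in> J" using Suc L by (intro Suc.IH) auto
    qed simp
    then show ?case using L by simp
  qed
  have G3': "Y.pf L \<in> J" if L: "set L \<subseteq> D - set K" "m \<le> length L" for L
  proof (cases "even (length L)")
    case True
    then have "even (length L - m)" using m by simp
    then obtain i where "length L - m = 2 * i" by blast
    then show ?thesis using G3[of L i] L by simp
  next
    case False
    then show ?thesis using Y.pf_odd J.zero_closed by simp
  qed
  have G4: "B.pf (map Inl Ks @ map Inr L) \<in> J"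
    if "set Ks \<subseteq> set K" "set L \<subseteq> D - set K" "length Ks + length L = length K + m" for Ks L
  proof (cases "distinct Ks")
    case True
    have "length Ks = card (set Ks)" using True by (simp add: distinct_card)
    also have "\<dots> \<le> card (set K)" using that by (intro card_mono) auto
    also have "\<dots> \<le> length K" by (rule card_length)
    finally have "Y.pf L \<in> J" using that by (intro G3') auto
    then show ?thesis unfolding beta_split[OF that(1)] by (auto intro!: J.I_l_closed)
  next
    case False
    then have "B.pf (map Inl Ks @ map Inr L) = \<zero>" by (intro B.pf_dup) (auto simp: distinct_map)
    then show ?thesis using J.zero_closed by simp
  qed
  have G5: "B.pf (map Inl js @ map Inl Ks @ map Inr L) \<in> J"
    if "set js \<subseteq> D" "set Ks \<subseteq> set K" "set L \<subseteq> D - set K" "length js + length Ks + length L = length K + m" for js Ks L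
    using that
  proof (induction js arbitrary: Ks L)
    case Nil
    then show ?case using G4 by simp
  next
    case (Cons j js)
    let ?zs = "map Inl js @ map Inl Ks @ map Inr L"
    have inK: "B.pf (Inl k # ?zs) \<in> J" if k: "k \<in> set K" for k
    proof (rule B.pf_mset_in_ideal[OF J])
      show "B.pf (map Inl js @ map Inl (k # Ks) @ map Inr L) \<in> J"
        by (rule Cons.IH) (use Cons.prems k in auto)
    qed simp
    show ?case
    proof (cases "j \<in> set K")
      case True
      then show ?thesis using inK by simp
    next
      case False
      have "B.pf (Inr j # ?zs) \<in> J"
      proof (rule B.pf_mset_in_ideal[OF J])
        show "B.pf (map Inl js @ map Inl Ks @ map Inr (j # L)) \<in> J"
          by (rule Cons.IH) (use Cons.prems False in auto)
      qed simp
      moreover have "ctr (\<lambda>v. ctr (\<lambda>k. \<beta> v (Inl k)) (\<lambda>u. pf (j # u)) K) B.pf ?zs \<in> J"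
        by (rule nested_in_ideal[OF J inK])
      ultimately have "d \<otimes> B.pf (Inl j # ?zs) \<in> J"
        unfolding beta_clear_pf by (intro J.a_closed J.a_inv_closed)
      then show ?thesis using cancel[OF B.pf_closed, of "Inl j # ?zs"] by simp
    qed
  qed
  show ?thesis using G5[of xs "[]" "[]"] xs by (simp add: beta_Inl)
qed

lemma cancel_pow:
  assumes "\<And>x. x \<in> carrier R \<Longrightarrow> d \<otimes> x \<in> J \<Longrightarrow> x \<in> J" "x \<in> carrier R" "d [^] (k :: nat) \<otimes> x \<in> J"
  shows "x \<in> J"
  using assms(3)
proof (induction k)
  case (Suc k)
  have "d \<otimes> (d [^] k \<otimes> x) \<in> J" using Suc.prems assms(2) by (simp add: m_assoc m_lcomm)
  then show ?case using Suc.IH assms(1)[of "d [^] k \<otimes> x"] assms(2) by simp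
qed (use assms in simp)

lemma Schur_in_ideal:
  assumes J: "ideal J R" and cancel: "\<And>x. x \<in> carrier R \<Longrightarrow> d \<otimes> x \<in> J \<Longrightarrow> x \<in> J"
    and "pf (K @ L) \<in> J"
  shows "Y.pf L \<in> J"
proof -
  interpret J: ideal J R by fact
  have "d [^] length L \<otimes> pf (K @ L) \<in> J" using assms(3) by (simp add: J.I_l_closed)
  then have "d \<otimes> (d [^] (length L div 2) \<otimes> Y.pf L) \<in> J" by (simp only: pf_Schur)
  then have *: "d [^] (length L div 2) \<otimes> Y.pf L \<in> J" by (rule cancel[rotated]) simp
  show ?thesis
  proof (rule cancel_pow)
    show "z \<in> J" if "z \<in> carrier R" "d \<otimes> z \<in> J" for z using that by (rule cancel)
  qed (use * in auto)
qed

end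

text \<open>These are the elements that enter the extension of \<open>J\<close> after localization
  at \<open>I\<close>. Everything outside \<open>I\<close> can be cancelled modulo this ideal, in
  particular a pivot.\<close>

lemma (in primeideal) saturation_ideal:
  assumes "ideal J R"
  shows "ideal {x \<in> carrier R. \<exists>s\<in>carrier R - I. s \<otimes> x \<in> J} R"
proof -
  interpret J: ideal J R by fact
  show ?thesis
  proof (rule idealI_cring)
    show "\<zero> \<in> {x \<in> carrier R. \<exists>s\<in>carrier R - I. s \<otimes> x \<in> J}"
      using one_notin J.zero_closed by (auto intro!: bexI[of _ \<one>])
    fix a c assume "a \<in> {x \<in> carrier R. \<exists>s\<in>carrier R - I. s \<otimes> x \<in> J}" "c \<in> {x \<in> carrier R. \<exists>s\<in>carrier R - I. s \<otimes> x \<in> J}"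
    then obtain s s' where s: "a \<in> carrier R" "c \<in> carrier R" "s \<in> carrier R" "s \<notin> I" "s' \<in> carrier R" "s' \<notin> I"
      "s \<otimes> a \<in> J" "s' \<otimes> c \<in> J" by blast
    have "s' \<otimes> (s \<otimes> a) \<oplus> s \<otimes> (s' \<otimes> c) \<in> J"
      by (rule J.a_closed[OF J.I_l_closed[OF s(7) s(5)] J.I_l_closed[OF s(8) s(3)]])
    also have "s' \<otimes> (s \<otimes> a) \<oplus> s \<otimes> (s' \<otimes> c) = (s \<otimes> s') \<otimes> (a \<oplus> c)"
      using s by (simp add: r_distr m_ac)
    finally show "a \<oplus> c \<in> {x \<in> carrier R. \<exists>s\<in>carrier R - I. s \<otimes> x \<in> J}"
      using s by (auto intro!: bexI[of _ "s \<otimes> s'"] simp: mult_mem_iff)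
  next
    fix a r assume "a \<in> {x \<in> carrier R. \<exists>s\<in>carrier R - I. s \<otimes> x \<in> J}" and r: "r \<in> carrier R"
    then obtain s where s: "a \<in> carrier R" "s \<in> carrier R" "s \<notin> I" "s \<otimes> a \<in> J" by blast
    have "r \<otimes> (s \<otimes> a) \<in> J" by (rule J.I_l_closed[OF s(4) r])
    then have "s \<otimes> (r \<otimes> a) \<in> J" using s r by (simp add: m_lcomm)
    then show "r \<otimes> a \<in> {x \<in> carrier R. \<exists>s\<in>carrier R - I. s \<otimes> x \<in> J}" using s r by blast
  qed auto
qed

locale generic_pivot = S: cring S for S :: "('a, 'b) ring_scheme" (structure) +
  fixes n :: nat and K :: "nat list"
begin

abbreviation "V \<equiv> upper_positions n"
abbreviation "R \<equiv> mpoly_ring S V"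
abbreviation "x \<equiv> var_form S V"

text \<open>The positions of T above the diagonal; their variables are the ones that the chart
  replaces.\<close>

definition "E = {(i, j). i < j \<and> j < n \<and> i \<notin> set K \<and> j \<notin> set K}"

lemma E_sub: "E \<subseteq> V"
  by (auto simp: E_def upper_positions_def)

lemma V_less: "V \<subseteq> {(i, j). i < j}"
  by (auto simp: upper_positions_def)

sublocale F: pf_pivot R x K
  using S.var_form_alternating[OF V_less] by (simp add: pf_pivot_def)

lemma pf_in_ideal_sorted:
  assumes J: "ideal J R" and gens: "\<And>L. L \<subseteq> D \<Longrightarrow> card L = m \<Longrightarrow> F.pf (pre @ sorted_list_of_set L) \<in> J"
    and "set xs \<subseteq> D" "finite D" "length xs = m"
  shows "F.pf (pre @ xs) \<in> J"
proof (cases "distinct xs")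
  case True
  have "mset (pre @ xs) = mset (pre @ sorted_list_of_set (set xs))"
    using True set_eq_iff_mset_eq_distinct[of xs "sorted_list_of_set (set xs)"] by simp
  moreover have "F.pf (pre @ sorted_list_of_set (set xs)) \<in> J"
    using gens[of "set xs"] True assms by (simp add: distinct_card)
  ultimately show ?thesis by (rule F.pf_mset_in_ideal[OF J])
next
  case False
  interpret J: ideal J R by fact
  have "F.pf (pre @ xs) = \<zero>\<^bsub>R\<^esub>" by (rule F.pf_dup) (use False in auto)
  then show ?thesis using J.zero_closed by simp
qed

lemma pfaffian_ideal_eq:
  "pfaffian_ideal (generic_alt_ring S n) (2 * t) (generic_alt_mat S n)
    = Idl\<^bsub>R\<^esub> {F.pf (sorted_list_of_set J) | J. J \<subseteq> {..<n} \<and> card J = 2 * t}"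
proof -
  have "pfaffian R (submatrix (generic_alt_mat S n) J J) = F.pf (sorted_list_of_set J)"
    if "J \<subseteq> {..<n}" "card J = 2 * t" for J
  proof (rule F.pfaffian_submatrix[where n=n])
    show "generic_alt_mat S n $$ (i, j) = x i j" if "i < n" "j < n" for i j
      using that by (auto simp: generic_alt_mat_def var_form_def upper_positions_def generic_alt_ring_def)
  qed (use that in \<open>auto simp: generic_alt_mat_def\<close>)
  then have "{pfaffian R (submatrix (generic_alt_mat S n) J J) | J. J \<subseteq> {..<n} \<and> card J = 2 * t}
    = {F.pf (sorted_list_of_set J) | J. J \<subseteq> {..<n} \<and> card J = 2 * t}"
    unfolding setcompr_eq_image by (intro image_cong refl) auto
  then show ?thesis
    by (simp add: pfaffian_ideal_def generic_alt_ring_def generic_alt_mat_def)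
qed

lemma minors_closed: "{F.pf (sorted_list_of_set J) | J. J \<subseteq> {..<n} \<and> card J = 2 * t} \<subseteq> carrier R"
  by auto

lemma pfaffian_ideal_ideal: "ideal (pfaffian_ideal (generic_alt_ring S n) (2 * t) (generic_alt_mat S n)) R"
  unfolding pfaffian_ideal_eq by (rule F.genideal_ideal[OF minors_closed])

lemma pf_in_pfaffian_ideal:
  assumes "set xs \<subseteq> {..<n}" "length xs = 2 * t"
  shows "F.pf xs \<in> pfaffian_ideal (generic_alt_ring S n) (2 * t) (generic_alt_mat S n)"
proof -
  have "F.pf ([] @ xs) \<in> pfaffian_ideal (generic_alt_ring S n) (2 * t) (generic_alt_mat S n)"
  proof (rule pf_in_ideal_sorted[OF pfaffian_ideal_ideal _ assms(1) _ assms(2)])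
    fix L assume "L \<subseteq> {..<n}" "card L = 2 * t"
    then show "F.pf ([] @ sorted_list_of_set L) \<in> pfaffian_ideal (generic_alt_ring S n) (2 * t) (generic_alt_mat S n)"
      unfolding pfaffian_ideal_eq using F.genideal_self[OF minors_closed[of t]] by auto
  qed simp
  then show ?thesis by simp
qed

lemma pfaffian_ideal_subset:
  assumes J: "ideal J R" and cancel: "\<And>x. x \<in> carrier R \<Longrightarrow> F.d \<otimes>\<^bsub>R\<^esub> x \<in> J \<Longrightarrow> x \<in> J"
    and "2 * t = length K + m" "even m"
    and gens: "\<And>L. distinct L \<Longrightarrow> set L \<subseteq> {..<n} - set K \<Longrightarrow> length L = m \<Longrightarrow> F.Y.pf L \<in> J"
  shows "pfaffian_ideal (generic_alt_ring S n) (2 * t) (generic_alt_mat S n) \<subseteq> J"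
  unfolding pfaffian_ideal_eq
proof (rule F.genideal_minimal[OF J], clarify)
  fix M assume M: "M \<subseteq> {..<n}" "card M = 2 * t"
  then have "finite M" using finite_subset by blast
  show "F.pf (sorted_list_of_set M) \<in> J"
  proof (rule F.pf_in_ideal[OF J])
    show "z \<in> J" if "z \<in> carrier R" "F.d \<otimes>\<^bsub>R\<^esub> z \<in> J" for z using that by (rule cancel)
    show "F.Y.pf L \<in> J" if "distinct L" "set L \<subseteq> {..<n} - set K" "length L = m" for L
      using that by (rule gens)
  qed (use M \<open>finite M\<close> assms in auto)
qed

text \<open>The generators are the Pfaffians Pf(K, L) with \<open>L\<close> disjoint from
  \<open>K\<close>. By the Schur identity they are, up to powers of the unit \<open>d\<close>, the
  Pfaffians of size \<open>m\<close> of T.\<close>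

lemma locally_generated_pfaffian_ideal:
  assumes p: "primeideal p R" and d: "F.d \<notin> p" and K: "set K \<subseteq> {..<n}" "distinct K"
    and m: "2 * t = length K + m" "even m"
  shows "locally_generated R p (pfaffian_ideal (generic_alt_ring S n) (2 * t) (generic_alt_mat S n))
    ((n - length K) choose m)"
proof -
  interpret p: primeideal p R by fact
  let ?I = "pfaffian_ideal (generic_alt_ring S n) (2 * t) (generic_alt_mat S n)"
  let ?D = "{..<n} - set K"
  define G where "G = (\<lambda>L. F.pf (K @ sorted_list_of_set L)) ` {L. L \<subseteq> ?D \<and> card L = m}"
  have finG: "finite G" unfolding G_def by (rule finite_imageI) (rule finite_subset[of _ "Pow ?D"], auto)
  have cD: "card ?D = n - length K" using K by (simp add: card_Diff_subset distinct_card)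
  have "card G \<le> card {L. L \<subseteq> ?D \<and> card L = m}"
    unfolding G_def by (rule card_image_le) (rule finite_subset[of _ "Pow ?D"], auto)
  also have "\<dots> = (n - length K) choose m" using n_subsets[of ?D m] cD by simp
  finally have cG: "card G \<le> (n - length K) choose m" .
  have GI: "G \<subseteq> ?I"
  proof
    fix g assume "g \<in> G"
    then obtain L where L: "L \<subseteq> ?D" "card L = m" "g = F.pf (K @ sorted_list_of_set L)" by (auto simp: G_def)
    have "finite L" using L finite_subset by blast
    then show "g \<in> ?I" unfolding L(3) using L m K by (intro pf_in_pfaffian_ideal) auto
  qed
  have GR: "G \<subseteq> carrier R" by (auto simp: G_def)
  \<comment> \<open>Saturating at \<open>p\<close> makes \<open>F.d\<close> cancellable, as both
    \<open>Schur_in_ideal\<close> and \<open>pfaffian_ideal_subset\<close> require.\<close>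
  let ?J = "{x \<in> carrier R. \<exists>s\<in>carrier R - p. s \<otimes>\<^bsub>R\<^esub> x \<in> Idl\<^bsub>R\<^esub> G}"
  have J: "ideal ?J R" by (rule p.saturation_ideal[OF F.genideal_ideal[OF GR]])
  have GJ: "G \<subseteq> ?J"
    using F.genideal_self[OF GR] GR p.one_notin by (auto intro!: bexI[of _ "\<one>\<^bsub>R\<^esub>"] simp: subset_iff)
  have cancel: "x \<in> ?J" if x: "x \<in> carrier R" "F.d \<otimes>\<^bsub>R\<^esub> x \<in> ?J" for x
  proof -
    obtain s where s: "s \<in> carrier R" "s \<notin> p" "s \<otimes>\<^bsub>R\<^esub> (F.d \<otimes>\<^bsub>R\<^esub> x) \<in> Idl\<^bsub>R\<^esub> G" using x by blast
    have "(s \<otimes>\<^bsub>R\<^esub> F.d) \<otimes>\<^bsub>R\<^esub> x \<in> Idl\<^bsub>R\<^esub> G" using s x by (simp add: F.m_assoc)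
    then show ?thesis using s x d by (auto intro!: bexI[of _ "s \<otimes>\<^bsub>R\<^esub> F.d"] simp: p.mult_mem_iff)
  qed
  have "?I \<subseteq> ?J"
  proof (rule pfaffian_ideal_subset[OF J _ m])
    show "z \<in> ?J" if "z \<in> carrier R" "F.d \<otimes>\<^bsub>R\<^esub> z \<in> ?J" for z using that by (rule cancel)
    fix L assume L: "distinct L" "set L \<subseteq> ?D" "length L = m"
    have "F.pf (K @ L) \<in> ?J"
      by (rule pf_in_ideal_sorted[OF J _ L(2) _ L(3)]) (use GJ in \<open>auto simp: G_def\<close>)
    then show "F.Y.pf L \<in> ?J"
    proof (rule F.Schur_in_ideal[OF J, rotated])
      show "z \<in> ?J" if "z \<in> carrier R" "F.d \<otimes>\<^bsub>R\<^esub> z \<in> ?J" for z using that by (rule cancel)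
    qed
  qed
  then show ?thesis unfolding locally_generated_def using GI finG cG by blast
qed

end

lemma coeff_prime_mono: "F \<subseteq> F' \<Longrightarrow> coeff_prime A V \<mm> F \<subseteq> coeff_prime A V \<mm> F'"
  unfolding coeff_prime_def by blast

section \<open>The chart at an invertible Pfaffian\<close>

text \<open>The inverse of the pivot Pfaffian is \<open>u\<close>; the chart \<open>\<theta>\<close> is the substitution
  \<open>x\<^sub>e = u (T\<^sub>e - shift e)\<close> for \<open>e \<in> E\<close>, solving \<open>y\<^sub>e = d x\<^sub>e + shift e\<close> for \<open>x\<^sub>e\<close>.\<close>

locale pivot_chart = generic_pivot S n K + A: cring A
    + iota: ring_hom_cring "mpoly_ring S (upper_positions n)" A iota
  for S :: "('a, 'b) ring_scheme" and n K and A :: "('c, 'd) ring_scheme" and iota +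
  fixes u :: 'c
  assumes u_closed [simp]: "u \<in> carrier A" and u_inverse: "iota F.d \<otimes>\<^bsub>A\<^esub> u = \<one>\<^bsub>A\<^esub>"
begin

abbreviation "T \<equiv> mpoly_ring A E"
abbreviation "cA \<equiv> ring.indexed_const A :: 'c \<Rightarrow> (nat \<times> nat) multiset \<Rightarrow> 'c"

sublocale T: cring T by (rule A.mpoly_ring_cring)

sublocale cA: ring_hom_cring A T cA by (rule A.indexed_const_hom)

definition shift :: "nat \<Rightarrow> nat \<Rightarrow> ((nat \<times> nat) multiset \<Rightarrow> 'a)"
  where "shift i j = \<ominus>\<^bsub>R\<^esub> row_contract R (x i) (\<lambda>w. F.pf (j # w)) K"

definition chart_var :: "nat \<times> nat \<Rightarrow> ((nat \<times> nat) multiset \<Rightarrow> 'c)"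
  where "chart_var e = (if e \<in> E
    then cA u \<otimes>\<^bsub>T\<^esub> (ring.indexed_var A e \<ominus>\<^bsub>T\<^esub> cA (iota (shift (fst e) (snd e))))
    else cA (iota (ring.indexed_var S e)))"

abbreviation "cAi \<equiv> \<lambda>f. cA (iota f)"

lemma cAi_hom: "ring_hom_cring R T cAi"
  by (rule ring_hom_cring_trans[OF iota.ring_hom_cring_axioms cA.ring_hom_cring_axioms])

sublocale cAi: ring_hom_cring R T cAi by (rule cAi_hom)

lemma ctr_pf_cons_closed [simp]: "row_contract R (x i) (\<lambda>w. F.pf (j # w)) L \<in> carrier R"
  by (rule F.ctr_closed) (simp_all del: pf_list.simps)

lemma shift_closed [simp]: "shift i j \<in> carrier R"
  unfolding shift_def by (rule F.a_inv_closed, rule ctr_pf_cons_closed)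

abbreviation "\<theta> \<equiv> mpoly_eval S T (\<lambda>k. cAi (ring.indexed_const S k)) chart_var"

sublocale ev: mpoly_evaluation S T "\<lambda>k. cAi (ring.indexed_const S k)" V chart_var
proof (intro mpoly_evaluation.intro mpoly_evaluation_axioms.intro)
  show "ring_hom_cring S T (\<lambda>k. cAi (ring.indexed_const S k))"
    by (rule ring_hom_cring_trans[OF S.indexed_const_hom cAi_hom])
  fix e assume e: "e \<in> V"
  then have "ring.indexed_var S e \<in> carrier R" by simp
  then show "chart_var e \<in> carrier T" by (simp add: chart_var_def)
qed (rule S.is_cring T.is_cring)+

lemma theta_hom: "ring_hom_cring R T \<theta>" by (rule ev.eval_hom)

sublocale \<theta>: ring_hom_cring R T \<theta> by (rule theta_hom)

lemma theta_var_pivot: "e \<in> V \<Longrightarrow> e \<notin> E \<Longrightarrow> \<theta> (ring.indexed_var S e) = cAi (ring.indexed_var S e)"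
  by (simp add: chart_var_def)

text \<open>The case \<open>i = j\<close> is included so that all pairs drawn from \<open>K\<close>
  and one further index are covered; these are the pairs occurring in the Pfaffians of
  \<open>shift\<close>.\<close>

lemma theta_x_pivot:
  assumes "i \<in> set K \<or> j \<in> set K \<or> i = j"
  shows "\<theta> (x i j) = cAi (x i j)"
proof -
  have 1: "(i, j) \<notin> E" "(j, i) \<notin> E" using assms by (auto simp: E_def)
  show ?thesis
  proof (cases "(i, j) \<in> V")
    case True
    then show ?thesis using 1 theta_var_pivot by (simp add: var_form_def)
  next
    case False
    show ?thesis
    proof (cases "(j, i) \<in> V")
      case True
      let ?v = "ring.indexed_var S (j, i)"
      have v: "?v \<in> carrier R" by (rule S.mpoly_var_closed[OF True])
      have e: "x i j = \<ominus>\<^bsub>R\<^esub> ?v" using False True by (simp add: var_form_def)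
      have "\<theta> (x i j) = \<ominus>\<^bsub>T\<^esub> \<theta> ?v" unfolding e by (rule \<theta>.hom_a_inv[OF v])
      also have "\<dots> = \<ominus>\<^bsub>T\<^esub> cAi ?v" by (simp only: theta_var_pivot[OF True 1(2)])
      also have "\<dots> = cAi (x i j)" unfolding e by (rule cAi.hom_a_inv[OF v, symmetric])
      finally show ?thesis .
    next
      case False2: False
      have e: "x i j = \<zero>\<^bsub>R\<^esub>" using False False2 by (simp add: var_form_def)
      show ?thesis unfolding e by (simp only: \<theta>.hom_zero cAi.hom_zero)
    qed
  qed
qed

lemma theta_pf_pivot:
  assumes "set xs \<subseteq> insert j (set K)"
  shows "\<theta> (F.pf xs) = cAi (F.pf xs)"
proof -
  have "\<theta> (F.pf xs) = pf_list T (\<lambda>i j. \<theta> (x i j)) xs" by (rule \<theta>.hom_pf_list) simp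
  also have "\<dots> = pf_list T (\<lambda>i j. cAi (x i j)) xs"
    by (rule T.pf_list_cong, rule theta_x_pivot) (use assms in auto)
  also have "\<dots> = cAi (F.pf xs)" by (rule cAi.hom_pf_list[symmetric]) simp
  finally show ?thesis .
qed

lemma theta_d: "\<theta> F.d = cAi F.d"
  by (rule theta_pf_pivot[of _ 0]) auto

lemma theta_shift: "\<theta> (shift i j) = cAi (shift i j)"
proof -
  let ?f = "\<lambda>w. F.pf (j # w)"
  have fc: "?f w \<in> carrier R" for w by (rule F.pf_closed)
  have "\<theta> (row_contract R (x i) ?f K) = row_contract T (\<lambda>z. \<theta> (x i z)) (\<lambda>w. \<theta> (?f w)) K"
    by (rule \<theta>.hom_ctr) (use fc in auto)
  also have "\<dots> = row_contract T (\<lambda>z. cAi (x i z)) (\<lambda>w. cAi (?f w)) K"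
    by (rule row_contract_cong) (auto intro!: theta_x_pivot theta_pf_pivot[of _ j] simp del: pf_list.simps)
  also have "\<dots> = cAi (row_contract R (x i) ?f K)"
    by (rule cAi.hom_ctr[symmetric]) (use fc in auto)
  finally show ?thesis unfolding shift_def by (simp del: pf_list.simps)
qed

lemma y_shift: "F.y i j = x i j \<otimes>\<^bsub>R\<^esub> F.d \<oplus>\<^bsub>R\<^esub> shift i j"
  unfolding F.y_expand shift_def ..

lemma theta_y:
  assumes "(i, j) \<in> E"
  shows "\<theta> (F.y i j) = ring.indexed_var A (i, j)"
proof -
  have V: "(i, j) \<in> V" using assms E_sub by blast
  let ?X = "ring.indexed_var A (i, j)" and ?s = "cAi (shift i j)"
  have c: "?X \<in> carrier T" "?s \<in> carrier T" "cA u \<in> carrier T" "cAi F.d \<in> carrier T" using assms by simp_all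
  have ud: "cA u \<otimes>\<^bsub>T\<^esub> cAi F.d = \<one>\<^bsub>T\<^esub>"
  proof -
    have "cA u \<otimes>\<^bsub>T\<^esub> cAi F.d = cA (iota F.d \<otimes>\<^bsub>A\<^esub> u)" by (simp add: T.m_comm)
    then show ?thesis by (simp only: u_inverse cA.hom_one)
  qed
  have "\<theta> (x i j) = cA u \<otimes>\<^bsub>T\<^esub> (?X \<ominus>\<^bsub>T\<^esub> ?s)" using V assms by (simp add: var_form_def chart_var_def)
  then have "\<theta> (F.y i j) = cA u \<otimes>\<^bsub>T\<^esub> (?X \<ominus>\<^bsub>T\<^esub> ?s) \<otimes>\<^bsub>T\<^esub> cAi F.d \<oplus>\<^bsub>T\<^esub> ?s"
    unfolding y_shift
    by (simp only: \<theta>.hom_add \<theta>.hom_mult F.b_closed F.pf_closed shift_closed F.m_closed theta_d theta_shift)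
  also have "cA u \<otimes>\<^bsub>T\<^esub> (?X \<ominus>\<^bsub>T\<^esub> ?s) \<otimes>\<^bsub>T\<^esub> cAi F.d = (cA u \<otimes>\<^bsub>T\<^esub> cAi F.d) \<otimes>\<^bsub>T\<^esub> (?X \<ominus>\<^bsub>T\<^esub> ?s)"
    using c by (simp add: T.m_ac)
  also have "\<dots> \<oplus>\<^bsub>T\<^esub> ?s = ?X" unfolding ud using c by (simp add: a_minus_def T.a_assoc T.l_neg)
  finally show ?thesis .
qed

lemma coeff_prime_chart:
  assumes "primeideal \<mm> A"
  shows "primeideal {f \<in> carrier R. \<theta> f \<in> coeff_prime A E \<mm> F} R"
  by (rule \<theta>.prime_vimage[OF primeideal.coeff_prime[OF assms]])

text \<open>Setting the variables of T to zero amounts to setting the \<open>F.y i j\<close> with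
  \<open>(i, j)\<close> in \<open>E\<close> to zero, and these vanish modulo \<open>\<mm>\<close>.
  On the variable at such a position, the discrepancy is exactly \<open>u\<close> times the image of
  \<open>F.y i j\<close>.\<close>

lemma theta_const_coeff_mod:
  assumes \<mm>: "ideal \<mm> A" and y: "\<And>i j. (i, j) \<in> E \<Longrightarrow> iota (F.y i j) \<in> \<mm>" and f: "f \<in> carrier R"
  shows "iota f \<ominus>\<^bsub>A\<^esub> \<theta> f {#} \<in> \<mm>"
proof (rule S.mpoly_hom_cong_mod[OF iota.ring_hom_cring_axioms _ \<mm> _ _ f])
  interpret m: ideal \<mm> A by fact
  show "ring_hom_cring R A (\<lambda>f. \<theta> f {#})"
    by (rule ring_hom_cring_trans[OF theta_hom A.const_coeff_hom])
  show "iota (ring.indexed_const S k) = \<theta> (ring.indexed_const S k) {#}" if "k \<in> carrier S" for k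
    unfolding ev.eval_const[OF that] by (simp only: A.indexed_const_coeff)
  fix e assume e: "e \<in> V"
  obtain i j where [simp]: "e = (i, j)" by (cases e)
  let ?x = "ring.indexed_var S e"
  have xc: "iota ?x \<in> carrier A" using e by simp
  show "iota ?x \<ominus>\<^bsub>A\<^esub> \<theta> ?x {#} \<in> \<mm>"
  proof (cases "e \<in> E")
    case False
    have t: "\<theta> ?x {#} = iota ?x" by (simp only: theta_var_pivot[OF e False] A.indexed_const_coeff)
    show ?thesis unfolding t using xc m.zero_closed by (simp only: a_minus_def A.r_neg)
  next
    case True
    let ?s = "iota (shift i j)"
    interpret cc: ring_hom_cring T A "\<lambda>f. f {#}" by (rule A.const_coeff_hom)
    have t0: "\<theta> ?x {#} = u \<otimes>\<^bsub>A\<^esub> (ring.indexed_var A e {#} \<ominus>\<^bsub>A\<^esub> ?s)"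
    proof -
      have "\<theta> ?x {#} = (cA u \<otimes>\<^bsub>T\<^esub> (ring.indexed_var A e \<oplus>\<^bsub>T\<^esub> \<ominus>\<^bsub>T\<^esub> cA ?s)) {#}"
        using e True by (simp add: chart_var_def a_minus_def)
      also have "\<dots> = cA u {#} \<otimes>\<^bsub>A\<^esub> (ring.indexed_var A e {#} \<oplus>\<^bsub>A\<^esub> \<ominus>\<^bsub>A\<^esub> (cA ?s {#}))"
        using True by (simp only: cc.hom_mult cc.hom_add cc.hom_a_inv T.a_inv_closed T.a_closed cA.hom_closed u_closed iota.hom_closed shift_closed A.mpoly_var_closed)
      finally show ?thesis by (simp only: A.indexed_const_coeff a_minus_def)
    qed
    have v0: "ring.indexed_var A e {#} = \<zero>\<^bsub>A\<^esub>" by (subst A.indexed_var_coeff) simp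
    have t: "\<theta> ?x {#} = u \<otimes>\<^bsub>A\<^esub> (\<ominus>\<^bsub>A\<^esub> ?s)"
      unfolding t0 v0 a_minus_def
      by (simp only: A.l_zero A.a_inv_closed iota.hom_closed shift_closed)
    have "x i j = ?x" using e by (simp add: var_form_def)
    then have "iota (F.y i j) = iota ?x \<otimes>\<^bsub>A\<^esub> iota F.d \<oplus>\<^bsub>A\<^esub> ?s" unfolding y_shift using e by simp
    then have "u \<otimes>\<^bsub>A\<^esub> iota (F.y i j) = iota ?x \<otimes>\<^bsub>A\<^esub> (iota F.d \<otimes>\<^bsub>A\<^esub> u) \<oplus>\<^bsub>A\<^esub> u \<otimes>\<^bsub>A\<^esub> ?s"
      using xc by (simp add: A.r_distr A.m_ac)
    also have "\<dots> = iota ?x \<ominus>\<^bsub>A\<^esub> \<theta> ?x {#}" unfolding u_inverse t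
      by (simp only: a_minus_def A.r_minus A.minus_minus A.r_one A.m_closed A.a_inv_closed u_closed iota.hom_closed shift_closed xc)
    finally have eq: "u \<otimes>\<^bsub>A\<^esub> iota (F.y i j) = iota ?x \<ominus>\<^bsub>A\<^esub> \<theta> ?x {#}" .
    have "u \<otimes>\<^bsub>A\<^esub> iota (F.y i j) \<in> \<mm>" using True by (intro m.I_l_closed y u_closed) simp
    then show ?thesis by (simp only: eq)
  qed
qed

text \<open>The variables of T are adjoined to \<open>\<mm>\<close> one at a time and the resulting
  primes are pulled back along \<open>\<theta>\<close>. Each inclusion is strict because some
  \<open>F.y i j\<close> maps to the variable just added. The last prime lies in \<open>p\<close> by
  the comparison of constant terms.\<close>

lemma height_ge_chart:
  assumes \<mm>: "primeideal \<mm> A" and y: "\<And>i j. (i, j) \<in> E \<Longrightarrow> iota (F.y i j) \<in> \<mm>"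
    and p: "\<And>f. f \<in> carrier R \<Longrightarrow> iota f \<in> \<mm> \<Longrightarrow> f \<in> p"
  shows "height_ge R p (card E)"
proof -
  interpret m: primeideal \<mm> A by fact
  have "finite E" by (rule finite_subset[of _ "{..<n} \<times> {..<n}"]) (auto simp: E_def)
  then obtain h where h: "bij_betw h {..<card E} E" using ex_bij_betw_nat_finite[of E] by (auto simp: atLeast0LessThan)
  define P where "P = (\<lambda>k. {f \<in> carrier R. \<theta> f \<in> coeff_prime A E \<mm> (h ` {..<k})})"
  have "P k \<subset> P (Suc k)" if k: "k < card E" for k
  proof -
    have "coeff_prime A E \<mm> (h ` {..<k}) \<subseteq> coeff_prime A E \<mm> (h ` {..<Suc k})"
      by (rule coeff_prime_mono) auto
    then have sub: "P k \<subseteq> P (Suc k)" unfolding P_def by blast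
    have hk: "h k \<in> E" using h k by (auto simp: bij_betw_def)
    have nk: "h k \<notin> h ` {..<k}"
    proof
      assume "h k \<in> h ` {..<k}"
      then obtain l where l: "l < k" "h k = h l" by blast
      then have "k = l" using h k by (intro inj_onD[OF bij_betw_imp_inj_on[OF h]]) auto
      then show False using l by simp
    qed
    let ?y = "F.y (fst (h k)) (snd (h k))"
    have ty: "\<theta> ?y = ring.indexed_var A (h k)" using theta_y[of "fst (h k)" "snd (h k)"] hk by simp
    have "?y \<in> P (Suc k)"
    proof -
      have "ring.indexed_var A (h k) \<in> coeff_prime A E \<mm> (h ` {..<Suc k})"
        unfolding coeff_prime_def
      proof (intro CollectI conjI allI impI)
        show "ring.indexed_var A (h k) \<in> carrier T" using hk by (rule A.mpoly_var_closed)
        fix m assume "set_mset m \<inter> h ` {..<Suc k} = {}"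
        then have "m \<noteq> {#h k#}" by auto
        then show "ring.indexed_var A (h k) m \<in> \<mm>"
          using m.zero_closed by (simp add: A.indexed_var_coeff)
      qed
      then show ?thesis unfolding P_def using ty by simp
    qed
    moreover have "?y \<notin> P k"
    proof
      assume "?y \<in> P k"
      then have "\<forall>m. set_mset m \<inter> h ` {..<k} = {} \<longrightarrow> ring.indexed_var A (h k) m \<in> \<mm>"
        by (simp only: P_def coeff_prime_def mem_Collect_eq ty) blast
      moreover have "set_mset {#h k#} \<inter> h ` {..<k} = {}" using nk by simp
      ultimately have "ring.indexed_var A (h k) {#h k#} \<in> \<mm>" by blast
      then show False using m.one_notin by (simp add: A.indexed_var_coeff)
    qed
    ultimately show ?thesis using sub by blast
  qed
  moreover have "primeideal (P k) R" for k unfolding P_def by (rule coeff_prime_chart[OF \<mm>])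
  moreover have "P (card E) \<subseteq> p"
  proof
    fix f assume "f \<in> P (card E)"
    then have f: "f \<in> carrier R" and c: "\<And>m. set_mset m \<inter> h ` {..<card E} = {} \<Longrightarrow> \<theta> f m \<in> \<mm>"
      unfolding P_def coeff_prime_def by blast+
    have c0: "\<theta> f {#} \<in> \<mm>" by (rule c) simp
    have e: "iota f = (iota f \<ominus>\<^bsub>A\<^esub> \<theta> f {#}) \<oplus>\<^bsub>A\<^esub> \<theta> f {#}"
      by (simp only: a_minus_def A.a_assoc A.l_neg A.r_zero A.a_inv_closed m.Icarr[OF c0] iota.hom_closed f)
    have "iota f \<in> \<mm>"
      by (subst e, rule m.a_closed[OF _ c0], rule theta_const_coeff_mod[OF m.is_ideal y f])
    then show "f \<in> p" by (rule p[OF f])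
  qed
  ultimately show ?thesis unfolding height_ge_def by blast
qed

end

lemma card_pairs:
  assumes "finite (D :: nat set)"
  shows "card {(i, j). i < j \<and> i \<in> D \<and> j \<in> D} = card D choose 2"
proof -
  have "bij_betw (\<lambda>(i, j). {i, j}) {(i, j). i < j \<and> i \<in> D \<and> j \<in> D} {B. B \<subseteq> D \<and> card B = 2}"
    unfolding bij_betw_def
  proof
    show "inj_on (\<lambda>(i, j). {i, j}) {(i, j). i < j \<and> i \<in> D \<and> j \<in> D}"
      by (auto simp: inj_on_def doubleton_eq_iff)
    show "(\<lambda>(i, j). {i, j}) ` {(i, j). i < j \<and> i \<in> D \<and> j \<in> D} = {B. B \<subseteq> D \<and> card B = 2}"
    proof (intro equalityI subsetI)
      fix B assume B: "B \<in> {B. B \<subseteq> D \<and> card B = 2}"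
      then obtain i j where ij: "B = {i, j}" "i \<noteq> j" by (auto simp: card_2_iff)
      then have "B = {min i j, max i j}" "min i j < max i j" by auto
      moreover have "min i j \<in> D" "max i j \<in> D" using B ij by (auto simp: min_def max_def)
      ultimately show "B \<in> (\<lambda>(i, j). {i, j}) ` {(i, j). i < j \<and> i \<in> D \<and> j \<in> D}"
        by (intro image_eqI[of _ _ "(min i j, max i j)"]) auto
    qed (auto simp: card_2_iff)
  qed
  then show ?thesis using n_subsets[OF assms, of 2] by (simp add: bij_betw_same_card)
qed

lemma (in generic_pivot) card_E:
  assumes "distinct K" "set K \<subseteq> {..<n}"
  shows "card E = (n - length K) choose 2"
proof -
  have "E = {(i, j). i < j \<and> i \<in> {..<n} - set K \<and> j \<in> {..<n} - set K}" by (auto simp: E_def)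
  then show ?thesis using card_pairs[of "{..<n} - set K"] assms by (simp add: card_Diff_subset distinct_card)
qed

text \<open>The chart is taken over the localization at \<open>p\<close> itself, with its maximal
  ideal as \<open>\<mm>\<close>: there \<open>F.d\<close> is a unit, and the entries of T lie in
  \<open>\<mm>\<close> by hypothesis.\<close>

lemma (in generic_pivot) height_ge_pivot:
  assumes p: "primeideal p R" and d: "F.d \<notin> p" and y: "\<And>i j. i < n \<Longrightarrow> j < n \<Longrightarrow> F.pf (i # j # K) \<in> p"
    and K: "distinct K" "set K \<subseteq> {..<n}"
  shows "height_ge R p ((n - length K) choose 2)"
proof -
  interpret L: localization_at_prime p R using p by (simp add: localization_at_prime_def)
  have dW: "F.d \<in> carrier R - p" using d by simp
  interpret C: pivot_chart S n K "local_ring_at R p" "\<lambda>a. fraction R (carrier R - p) a \<one>\<^bsub>R\<^esub>"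
    "fraction R (carrier R - p) \<one>\<^bsub>R\<^esub> F.d"
  proof (intro pivot_chart.intro pivot_chart_axioms.intro)
    show "generic_pivot S" ..
    show "cring (local_ring_at R p)" by (rule L.L_cring)
    show "ring_hom_cring R (local_ring_at R p) (\<lambda>a. fraction R (carrier R - p) a \<one>\<^bsub>R\<^esub>)" by (rule L.iota_hom)
    show "fraction R (carrier R - p) \<one>\<^bsub>R\<^esub> F.d \<in> carrier (local_ring_at R p)"
      using dW by (intro L.frac_closed F.one_closed)
  qed (rule L.frac_inverse[OF dW])
  have mem: "fraction R (carrier R - p) f \<one>\<^bsub>R\<^esub> \<in> local_ideal_at R p p \<longleftrightarrow> f \<in> p" if "f \<in> carrier R" for f
    using L.prime_mem_iff[OF p subset_refl that L.W_one] .
  have "height_ge R p (card E)"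
  proof (rule C.height_ge_chart)
    show "primeideal (local_ideal_at R p p) (local_ring_at R p)" by (rule L.local_prime[OF p subset_refl])
    show "fraction R (carrier R - p) (F.y i j) \<one>\<^bsub>R\<^esub> \<in> local_ideal_at R p p" if "(i, j) \<in> E" for i j
      using mem[OF F.y_closed] y[of i j] that unfolding F.y_def E_def by (simp del: pf_list.simps)
  qed (use mem in blast)
  then show ?thesis unfolding card_E[OF K] .
qed

lemma (in cring) pfaffian_ideal_height_and_gens:
  assumes t: "2 \<le> 2 * t" "2 * t \<le> n"
  defines "P \<equiv> generic_alt_ring R n"
  defines "I \<equiv> pfaffian_ideal P (2 * t) (generic_alt_mat R n)"
  assumes p: "primeideal p P" "I \<subseteq> p"
  shows "\<exists>r<t. height_ge P p ((n - 2 * r) choose 2) \<and> locally_generated P p I ((n - 2 * r) choose (2 * t - 2 * r))"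
proof -
  have P: "P = mpoly_ring R (upper_positions n)" by (simp add: P_def generic_alt_ring_def)
  let ?x = "var_form R (upper_positions n)"
  interpret G0: generic_pivot R n "[]" ..
  interpret p: primeideal p P by fact
  define Q where "Q = (\<lambda>r. \<exists>K. length K = 2 * r \<and> set K \<subseteq> {..<n} \<and> pf_list P ?x K \<notin> p)"
  have Q0: "Q 0" using p.one_notin by (auto simp: Q_def)
  have Qt: "\<not> Q t"
    using G0.pf_in_pfaffian_ideal[of _ t] p(2) unfolding Q_def I_def P P_def generic_alt_ring_def by blast
  \<comment> \<open>\<open>Q\<close> holds at 0, where the empty Pfaffian is 1, and fails at
    \<open>t\<close> because \<open>I\<close> lies in \<open>p\<close>, so it switches somewhere
    below \<open>t\<close>.\<close>
  have "\<exists>r<t. Q r \<and> \<not> Q (Suc r)"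
  proof (rule ccontr)
    assume "\<not> (\<exists>r<t. Q r \<and> \<not> Q (Suc r))"
    then have "r \<le> t \<Longrightarrow> Q r" for r by (induction r) (auto simp: Q0)
    then show False using Qt by blast
  qed
  then obtain r K where r: "r < t" "\<not> Q (Suc r)" and K: "length K = 2 * r" "set K \<subseteq> {..<n}" "pf_list P ?x K \<notin> p"
    unfolding Q_def by blast
  interpret G: generic_pivot R n K ..
  have Kp: "pf_list G.R G.x K \<notin> p" using K(3) by (simp add: P)
  have dist: "distinct K"
  proof (rule ccontr)
    assume "\<not> distinct K"
    then have "pf_list G.R G.x K = \<zero>\<^bsub>G.R\<^esub>" by (rule G0.F.pf_dup)
    moreover have "\<zero>\<^bsub>G.R\<^esub> \<in> p" using additive_subgroup.zero_closed[OF p.additive_subgroup_axioms] unfolding P .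
    ultimately show False using Kp by metis
  qed
  have gens: "locally_generated P p I ((n - 2 * r) choose (2 * t - 2 * r))"
    using G.locally_generated_pfaffian_ideal[of p t "2 * t - 2 * r"] p Kp K dist r unfolding P I_def P_def generic_alt_ring_def
    by simp
  have "pf_list G.R G.x (i # j # K) \<in> p" if "i < n" "j < n" for i j
  proof (rule ccontr)
    assume "pf_list G.R G.x (i # j # K) \<notin> p"
    then have "Q (Suc r)" unfolding Q_def P using K that by (intro exI[of _ "i # j # K"]) auto
    then show False using r by simp
  qed
  then have "height_ge P p ((n - 2 * r) choose 2)"
    using G.height_ge_pivot[of p] p(1) Kp dist K by (simp add: P del: pf_list.simps)
  then show ?thesis using r gens by blast
qed

section \<open>Degrees, lowest terms and algebraic relations\<close>

context cring begin

lemma finsum_swap: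
  assumes "finite A" "finite B" "\<And>a b. a \<in> A \<Longrightarrow> b \<in> B \<Longrightarrow> f a b \<in> carrier R"
  shows "(\<Oplus>a\<in>A. \<Oplus>b\<in>B. f a b) = (\<Oplus>b\<in>B. \<Oplus>a\<in>A. f a b)"
  using assms(1,3)
proof (induction A rule: finite_induct)
  case (insert x F)
  have "(\<Oplus>a\<in>insert x F. \<Oplus>b\<in>B. f a b) = (\<Oplus>b\<in>B. f x b) \<oplus> (\<Oplus>a\<in>F. \<Oplus>b\<in>B. f a b)"
    by (rule finsum_insert) (use insert in \<open>auto intro!: finsum_closed\<close>)
  also have "\<dots> = (\<Oplus>b\<in>B. f x b) \<oplus> (\<Oplus>b\<in>B. \<Oplus>a\<in>F. f a b)" using insert by simp
  also have "\<dots> = (\<Oplus>b\<in>B. f x b \<oplus> (\<Oplus>a\<in>F. f a b))"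
    by (rule finsum_addf[symmetric]) (use insert in \<open>auto intro!: finsum_closed\<close>)
  also have "\<dots> = (\<Oplus>b\<in>B. \<Oplus>a\<in>insert x F. f a b)"
    by (rule add.finprod_cong') (use insert in \<open>auto intro!: finsum_closed\<close>)
  finally show ?case .
qed simp

text \<open>In the lowest degree of \<open>g\<close> only the constant term of the multiplier is
  visible. A relation among generators of order two thereby becomes a linear relation over the
  coefficient ring.\<close>

lemma mpoly_mult_lowest:
  assumes f: "\<And>m. f m \<in> carrier R" and g: "\<And>m. g m \<in> carrier R"
    and low: "\<And>m'. size m' < size m \<Longrightarrow> g m' = \<zero>"
  shows "mpoly_mult R f g m = f {#} \<otimes> g m"
proof -
  have "mpoly_mult R f g m = (\<Oplus>a\<in>{a. a \<subseteq># m}. if {#} = a then f {#} \<otimes> g m else \<zero>)"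
    unfolding mpoly_mult_def
  proof (rule add.finprod_cong')
    fix a assume a: "a \<in> {a. a \<subseteq># m}"
    show "f a \<otimes> g (m - a) = (if {#} = a then f {#} \<otimes> g m else \<zero>)"
    proof (cases "a = {#}")
      case False
      then have "size (m - a) < size m" using a by (simp add: size_Diff_submset nonempty_has_size) (metis a diff_less mem_Collect_eq nonempty_has_size size_mset_mono less_le_trans)
      then show ?thesis using False low f by auto
    qed simp
  qed (use f g in auto)
  also have "\<dots> = f {#} \<otimes> g m"
    by (rule add.finprod_singleton) (use f g finite_submultisets in auto)
  finally show ?thesis .
qed

lemma mpoly_eq_sum_monoms:
  assumes "f \<in> carrier (mpoly_ring R V)"
  shows "f = finsum (mpoly_ring R V) (\<lambda>m. mpoly_monom R (f m) m) {m. f m \<noteq> \<zero>}"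
proof
  fix m
  have c: "f m \<in> carrier R" for m using assms by (rule mpoly_coeff_closed)
  have "finsum (mpoly_ring R V) (\<lambda>m. mpoly_monom R (f m) m) {m. f m \<noteq> \<zero>} m
    = (\<Oplus>m'\<in>{m. f m \<noteq> \<zero>}. mpoly_monom R (f m') m' m)"
    by (rule mpoly_finsum[OF mpoly_finite_support[OF assms]]) (use c mpoly_support_vars[OF assms] in auto)
  also have "\<dots> = (\<Oplus>m'\<in>{m. f m \<noteq> \<zero>}. if m = m' then f m' else \<zero>)"
    by (rule add.finprod_cong') (use c in \<open>auto simp: mpoly_monom_def\<close>)
  also have "\<dots> = f m"
  proof (cases "f m = \<zero>")
    case True
    have "(\<Oplus>m'\<in>{m. f m \<noteq> \<zero>}. if m = m' then f m' else \<zero>) = (\<Oplus>m'\<in>{m. f m \<noteq> \<zero>}. \<zero>)"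
      by (rule add.finprod_cong') (use True in auto)
    then show ?thesis using True by simp
  next
    case False
    then show ?thesis
      using add.finprod_singleton[of m "{m. f m \<noteq> \<zero>}" f] mpoly_finite_support[OF assms] c by auto
  qed
  finally show "f m = finsum (mpoly_ring R V) (\<lambda>m. mpoly_monom R (f m) m) {m. f m \<noteq> \<zero>} m" ..
qed

lemma mpoly_monom_mult:
  assumes "k \<in> carrier R" "l \<in> carrier R"
  shows "mpoly_monom R k a \<otimes>\<^bsub>mpoly_ring R V\<^esub> mpoly_monom R l c = mpoly_monom R (k \<otimes> l) (a + c)"
proof
  fix m
  have "a \<subseteq># m \<Longrightarrow> m - a = c \<longleftrightarrow> m = a + c" by (auto simp: subset_mset.add_diff_inverse)
  then show "(mpoly_monom R k a \<otimes>\<^bsub>mpoly_ring R V\<^esub> mpoly_monom R l c) m = mpoly_monom R (k \<otimes> l) (a + c) m"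
    unfolding mpoly_mult_eq using assms
    by (subst mpoly_mult_monom) (auto simp: mpoly_monom_def)
qed

lemma indexed_const_eq_monom: "indexed_const k = mpoly_monom R k {#}"
  by (auto simp: mpoly_monom_def indexed_const_def)

lemma mpoly_in_ideal_of_coeffs:
  assumes J: "ideal J (mpoly_ring R V)" and f: "f \<in> carrier (mpoly_ring R V)"
    and c: "\<And>m. indexed_const (f m) \<in> J"
  shows "f \<in> J"
proof -
  interpret P: cring "mpoly_ring R V" by (rule mpoly_ring_cring)
  interpret J: ideal J "mpoly_ring R V" by fact
  have "finsum (mpoly_ring R V) (\<lambda>m. mpoly_monom R (f m) m) {m. f m \<noteq> \<zero>} \<in> J"
  proof (rule J.finsum_mem)
    fix m assume "m \<in> {m. f m \<noteq> \<zero>}"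
    then have V: "set_mset m \<subseteq> V" using mpoly_support_vars[OF f] by auto
    have fm: "f m \<in> carrier R" using f by (rule mpoly_coeff_closed)
    have "mpoly_monom R (f m) m = indexed_const (f m) \<otimes>\<^bsub>mpoly_ring R V\<^esub> mpoly_monom R \<one> m"
      unfolding indexed_const_eq_monom using mpoly_monom_mult[OF fm one_closed, where a="{#}" and c=m and V=V] fm by simp
    then show "mpoly_monom R (f m) m \<in> J" using c[of m] V by (simp add: J.I_r_closed)
  qed
  then show ?thesis using mpoly_eq_sum_monoms[OF f] by simp
qed

lemma var_mult_var_coeff:
  "(indexed_var a \<otimes>\<^bsub>mpoly_ring R V\<^esub> indexed_var c) m = (if m = {#a, c#} then \<one> else \<zero>)"
proof -
  have "indexed_var a \<otimes>\<^bsub>mpoly_ring R V\<^esub> indexed_var c = mpoly_monom R (\<one> \<otimes> \<one>) ({#a#} + {#c#})"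
    unfolding indexed_var_eq_monom by (rule mpoly_monom_mult) auto
  then show ?thesis by (simp add: mpoly_monom_def)
qed

definition mpoly_degree_le :: "nat \<Rightarrow> ('v multiset \<Rightarrow> 'a) \<Rightarrow> bool"
  where "mpoly_degree_le D f \<longleftrightarrow> (\<forall>m. D < size m \<longrightarrow> f m = \<zero>)"

lemma mpoly_degree_le_mono: "mpoly_degree_le D f \<Longrightarrow> D \<le> D' \<Longrightarrow> mpoly_degree_le D' f"
  unfolding mpoly_degree_le_def by auto

lemma mpoly_degree_le_mult:
  assumes f: "f \<in> carrier (mpoly_ring R V)" "mpoly_degree_le D f"
    and g: "g \<in> carrier (mpoly_ring R V)" "mpoly_degree_le D' g"
  shows "mpoly_degree_le (D + D') (f \<otimes>\<^bsub>mpoly_ring R V\<^esub> g)"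
  unfolding mpoly_degree_le_def
proof (intro allI impI)
  fix m :: "'c multiset" assume m: "D + D' < size m"
  have fc: "f m \<in> carrier R" "g m \<in> carrier R" for m using f g mpoly_coeff_closed by blast+
  have "(f \<otimes>\<^bsub>mpoly_ring R V\<^esub> g) m = (\<Oplus>a\<in>{a. a \<subseteq># m}. \<zero>)"
    unfolding mpoly_mult_eq mpoly_mult_def
  proof (rule add.finprod_cong')
    fix a assume "a \<in> {a. a \<subseteq># m}"
    then have "size a + size (m - a) = size m"
      by (metis mem_Collect_eq size_union subset_mset.add_diff_inverse)
    then have "D < size a \<or> D' < size (m - a)" using m by linarith
    then show "f a \<otimes> g (m - a) = \<zero>" using f(2) g(2) fc unfolding mpoly_degree_le_def by auto
  qed auto
  then show "(f \<otimes>\<^bsub>mpoly_ring R V\<^esub> g) m = \<zero>" by simp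
qed

lemma mpoly_degree_le_pow:
  assumes f: "f \<in> carrier (mpoly_ring R V)" "mpoly_degree_le D f"
  shows "mpoly_degree_le (k * D) (f [^]\<^bsub>mpoly_ring R V\<^esub> (k :: nat))"
proof (induction k)
  case 0
  then show ?case by (auto simp: mpoly_degree_le_def mpoly_one indexed_const_def)
next
  case (Suc k)
  interpret P: cring "mpoly_ring R V" by (rule mpoly_ring_cring)
  show ?case using mpoly_degree_le_mult[OF P.nat_pow_closed[OF f(1)] Suc f] by (simp add: add.commute)
qed

lemma mpoly_degree_le_prod:
  assumes "finite J" "\<And>j. j \<in> J \<Longrightarrow> f j \<in> carrier (mpoly_ring R V)" "\<And>j. j \<in> J \<Longrightarrow> mpoly_degree_le (D j) (f j)"
  shows "mpoly_degree_le (\<Sum>j\<in>J. D j) (finprod (mpoly_ring R V) f J)"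
  using assms
proof (induction J rule: finite_induct)
  case empty
  interpret P: cring "mpoly_ring R V" by (rule mpoly_ring_cring)
  show ?case by (auto simp: mpoly_degree_le_def mpoly_one indexed_const_def)
next
  case (insert j J)
  interpret P: cring "mpoly_ring R V" by (rule mpoly_ring_cring)
  have "finprod (mpoly_ring R V) f (insert j J) = f j \<otimes>\<^bsub>mpoly_ring R V\<^esub> finprod (mpoly_ring R V) f J"
    by (rule P.finprod_insert) (use insert in auto)
  moreover have "finprod (mpoly_ring R V) f J \<in> carrier (mpoly_ring R V)"
    by (rule P.finprod_closed) (use insert in auto)
  ultimately show ?case using insert mpoly_degree_le_mult[of "f j" V "D j" "finprod (mpoly_ring R V) f J"] by simp
qed

lemma mpoly_degree_le_exists:
  assumes "f \<in> carrier (mpoly_ring R V)"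
  shows "\<exists>D. mpoly_degree_le D f"
proof -
  let ?S = "size ` {m. f m \<noteq> \<zero>}"
  have "finite ?S" using mpoly_finite_support[OF assms] by simp
  then have "s \<le> Max ?S" if "s \<in> ?S" for s using that by simp
  then have "mpoly_degree_le (Max ?S) f" unfolding mpoly_degree_le_def by (metis (mono_tags, lifting) image_eqI leD mem_Collect_eq)
  then show ?thesis by blast
qed

end

text \<open>Each exponent is at most \<open>D\<close>, so the exponent vectors embed in a box of
  side \<open>D + 1\<close>. This crude count has the right exponent \<open>card V\<close>.\<close>

lemma card_bounded_monomials:
  assumes "finite V"
  shows "finite {m :: 'v multiset. set_mset m \<subseteq> V \<and> size m \<le> D}"
    and "card {m :: 'v multiset. set_mset m \<subseteq> V \<and> size m \<le> D} \<le> (D + 1) ^ card V"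
proof -
  let ?M = "{m :: 'v multiset. set_mset m \<subseteq> V \<and> size m \<le> D}"
  let ?f = "\<lambda>m :: 'v multiset. restrict (count m) V"
  have inj: "inj_on ?f ?M"
  proof (rule inj_onI)
    fix m m' assume m: "m \<in> ?M" "m' \<in> ?M" "?f m = ?f m'"
    show "m = m'"
    proof (rule multiset_eqI)
      fix x
      show "count m x = count m' x"
      proof (cases "x \<in> V")
        case True
        then show ?thesis using fun_cong[OF m(3), of x] by simp
      next
        case False
        then have "x \<notin># m" "x \<notin># m'" using m by auto
        then show ?thesis by (simp add: not_in_iff)
      qed
    qed
  qed
  have img: "?f ` ?M \<subseteq> V \<rightarrow>\<^sub>E {..D}"
  proof
    fix g assume "g \<in> ?f ` ?M"
    then obtain m where m: "size m \<le> D" "g = ?f m" by auto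
    have "count m x \<le> D" for x using count_le_size[of m x] m(1) by linarith
    then show "g \<in> V \<rightarrow>\<^sub>E {..D}" using m by auto
  qed
  have fin: "finite (V \<rightarrow>\<^sub>E {..D})" using assms by (intro finite_PiE) auto
  show "finite ?M" using finite_imageD[OF finite_subset[OF img fin] inj] .
  have "card ?M = card (?f ` ?M)" using card_image[OF inj] by simp
  also have "\<dots> \<le> card (V \<rightarrow>\<^sub>E {..D})" by (rule card_mono[OF fin img])
  also have "\<dots> = (D + 1) ^ card V" using assms by (simp add: card_PiE)
  finally show "card ?M \<le> (D + 1) ^ card V" .
qed

text \<open>The \<open>c + 1\<close> polynomials \<open>w i\<close> in \<open>c\<close> variables satisfy a relation modulo \<open>I\<close> because, for
  large \<open>B\<close>, there are more exponents \<open>\<alpha>\<close> than monomials of the degrees that occur.\<close>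

lemma (in primeideal) algebraic_dependence:
  fixes V :: "'v set"
  assumes V: "finite V" "card V = c" and w: "\<And>i. i \<le> c \<Longrightarrow> w i \<in> carrier (mpoly_ring R V)"
  shows "\<exists>B v. (\<forall>\<alpha>\<in>{..c} \<rightarrow>\<^sub>E {..<B}. v \<alpha> \<in> carrier R) \<and> (\<exists>\<alpha>\<in>{..c} \<rightarrow>\<^sub>E {..<B}. v \<alpha> \<notin> I)
    \<and> (\<forall>m. finsum (mpoly_ring R V) (\<lambda>\<alpha>. indexed_const (v \<alpha>) \<otimes>\<^bsub>mpoly_ring R V\<^esub>
          finprod (mpoly_ring R V) (\<lambda>i. w i [^]\<^bsub>mpoly_ring R V\<^esub> (\<alpha> i :: nat)) {..c}) ({..c} \<rightarrow>\<^sub>E {..<B :: nat}) m \<in> I)"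
proof -
  interpret P: cring "mpoly_ring R V" by (rule mpoly_ring_cring)
  have "\<exists>D. \<forall>i\<le>c. mpoly_degree_le D (w i)"
  proof -
    obtain D where D: "\<And>i. i \<le> c \<Longrightarrow> mpoly_degree_le (D i) (w i)"
      using mpoly_degree_le_exists[OF w] by metis
    have "mpoly_degree_le (Max (D ` {..c})) (w i)" if "i \<le> c" for i
      by (rule mpoly_degree_le_mono[OF D[OF that]]) (use that in simp)
    then show ?thesis by blast
  qed
  then obtain \<delta> where \<delta>: "\<And>i. i \<le> c \<Longrightarrow> mpoly_degree_le \<delta> (w i)" by blast
  \<comment> \<open>A product of powers of the \<open>c + 1\<close> polynomials with exponents below
    \<open>B\<close> has degree at most \<open>D\<close>, and \<open>D + 1 \<le> B * e\<close> with
    \<open>e\<close> independent of \<open>B\<close>. So there are at most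
    \<open>B ^ c * e ^ c\<close> monomials, fewer than the \<open>B ^ (c + 1)\<close> exponent
    vectors once \<open>B\<close> exceeds \<open>e ^ c\<close>.\<close>
  define e where "e = (c + 1) * \<delta> + 1"
  define B where "B = e ^ c + 1"
  define D where "D = (c + 1) * B * \<delta>"
  define M where "M = {m :: 'v multiset. set_mset m \<subseteq> V \<and> size m \<le> D}"
  let ?\<Lambda> = "{..c} \<rightarrow>\<^sub>E {..<B}"
  define W where "W = (\<lambda>\<alpha> :: nat \<Rightarrow> nat. finprod (mpoly_ring R V) (\<lambda>i. w i [^]\<^bsub>mpoly_ring R V\<^esub> \<alpha> i) {..c})"
  have Wc: "W \<alpha> \<in> carrier (mpoly_ring R V)" for \<alpha>
    unfolding W_def by (rule P.finprod_closed) (use w in auto)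
  have Wm: "W \<alpha> m \<in> carrier R" for \<alpha> m using Wc by (rule mpoly_coeff_closed)
  have Wd: "mpoly_degree_le D (W \<alpha>)" if "\<alpha> \<in> ?\<Lambda>" for \<alpha>
  proof (rule mpoly_degree_le_mono)
    show "mpoly_degree_le (\<Sum>i\<in>{..c}. \<alpha> i * \<delta>) (W \<alpha>)"
      unfolding W_def by (rule mpoly_degree_le_prod) (use w \<delta> in \<open>auto intro!: mpoly_degree_le_pow\<close>)
    have "(\<Sum>i\<in>{..c}. \<alpha> i * \<delta>) \<le> (\<Sum>i\<in>{..c}. B * \<delta>)"
    proof (rule sum_mono)
      fix i assume "i \<in> {..c}"
      then have "\<alpha> i < B" using that by auto
      then show "\<alpha> i * \<delta> \<le> B * \<delta>" by simp
    qed
    then show "(\<Sum>i\<in>{..c}. \<alpha> i * \<delta>) \<le> D" by (simp add: D_def algebra_simps)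
  qed
  have Wsupp: "W \<alpha> m = \<zero>" if "\<alpha> \<in> ?\<Lambda>" "m \<notin> M" for \<alpha> m
    using Wd[OF that(1)] mpoly_support_vars[OF Wc[of \<alpha>], of m] that(2) unfolding M_def mpoly_degree_le_def
    by (metis (mono_tags, lifting) leI mem_Collect_eq)
  have finM: "finite M" and cM: "card M \<le> (D + 1) ^ c"
    using card_bounded_monomials[OF V(1), of D] V(2) unfolding M_def by auto
  have "D + 1 \<le> B * e" unfolding D_def e_def B_def by (simp add: algebra_simps)
  then have "(D + 1) ^ c \<le> (B * e) ^ c" by (rule power_mono) simp
  also have "\<dots> = B ^ c * e ^ c" by (rule power_mult_distrib)
  also have "\<dots> < B ^ c * B" by (intro mult_strict_left_mono) (auto simp: B_def)
  also have "\<dots> = card ?\<Lambda>" by (simp add: card_PiE)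
  finally have card: "card M < card ?\<Lambda>" using cM by linarith
  have fin\<Lambda>: "finite ?\<Lambda>" by (intro finite_PiE) auto
  \<comment> \<open>One equation for each monomial, one unknown for each exponent vector.\<close>
  obtain v where v: "\<forall>\<alpha>\<in>?\<Lambda>. v \<alpha> \<in> carrier R" "\<exists>\<alpha>\<in>?\<Lambda>. v \<alpha> \<notin> I" "\<forall>m\<in>M. (\<Oplus>\<alpha>\<in>?\<Lambda>. W \<alpha> m \<otimes> v \<alpha>) \<in> I"
    using homogeneous_system[OF finM fin\<Lambda> card, of "\<lambda>m \<alpha>. W \<alpha> m"] Wm by blast
  have "finsum (mpoly_ring R V) (\<lambda>\<alpha>. indexed_const (v \<alpha>) \<otimes>\<^bsub>mpoly_ring R V\<^esub> W \<alpha>) ?\<Lambda> m \<in> I" for m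
  proof -
    have "finsum (mpoly_ring R V) (\<lambda>\<alpha>. indexed_const (v \<alpha>) \<otimes>\<^bsub>mpoly_ring R V\<^esub> W \<alpha>) ?\<Lambda> m
      = (\<Oplus>\<alpha>\<in>?\<Lambda>. (indexed_const (v \<alpha>) \<otimes>\<^bsub>mpoly_ring R V\<^esub> W \<alpha>) m)"
      by (rule mpoly_finsum[OF fin\<Lambda>]) (use v Wc in auto)
    also have "\<dots> = (\<Oplus>\<alpha>\<in>?\<Lambda>. W \<alpha> m \<otimes> v \<alpha>)"
      by (rule add.finprod_cong') (use v Wm in \<open>auto simp: mpoly_mult_eq mpoly_mult_const m_comm\<close>)
    also have "\<dots> \<in> I"
    proof (cases "m \<in> M")
      case True
      then show ?thesis using v(3) by blast
    next
      case False
      show ?thesis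
      proof (rule finsum_mem)
        fix \<alpha> assume a: "\<alpha> \<in> ?\<Lambda>"
        then have "W \<alpha> m \<otimes> v \<alpha> = \<zero>" using Wsupp[OF a False] v(1) by simp
        then show "W \<alpha> m \<otimes> v \<alpha> \<in> I" using additive_subgroup.zero_closed[OF additive_subgroup_axioms] by simp
      qed
    qed
    finally show ?thesis .
  qed
  then show ?thesis using v(1,2) unfolding W_def by blast
qed

text \<open>Given a chain of primes with \<open>w i \<in> P (i + 1) - P i\<close>, divide out the lowest power of \<open>w i\<close> from the
  sum: the terms that survive modulo \<open>P (i + 1)\<close> share the exponent of \<open>w i\<close>, so they are still
  separated by the later exponents.\<close>

lemma (in cring) lex_descent:
  fixes P :: "nat \<Rightarrow> 'a set" and w :: "nat \<Rightarrow> 'a"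
  assumes P: "\<And>i. i \<le> N \<Longrightarrow> primeideal (P i) R" "\<And>i. i < N \<Longrightarrow> P i \<subseteq> P (Suc i)"
    and w: "\<And>i. i < N \<Longrightarrow> w i \<in> P (Suc i)" "\<And>i. i < N \<Longrightarrow> w i \<notin> P i" "\<And>i. i \<le> c \<Longrightarrow> w i \<in> carrier R"
    and N: "N \<le> Suc c"
    and v: "\<And>\<alpha>. \<alpha> \<in> L \<Longrightarrow> v \<alpha> \<in> carrier R"
    and base: "\<And>\<Lambda>. \<Lambda> \<subseteq> L \<Longrightarrow> finite \<Lambda> \<Longrightarrow> \<Lambda> \<noteq> {} \<Longrightarrow>
        (\<And>\<alpha> \<beta>. \<alpha> \<in> \<Lambda> \<Longrightarrow> \<beta> \<in> \<Lambda> \<Longrightarrow> (\<And>j. j \<in> {N..c} \<Longrightarrow> \<alpha> j = \<beta> j) \<Longrightarrow> \<alpha> = \<beta>) \<Longrightarrow>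
        (\<Oplus>\<alpha>\<in>\<Lambda>. v \<alpha> \<otimes> (\<Otimes>j\<in>{N..c}. w j [^] (\<alpha> j :: nat))) \<notin> P N"
    and i: "i \<le> N" and \<Lambda>: "\<Lambda> \<subseteq> L" "finite \<Lambda>" "\<Lambda> \<noteq> {}"
      "\<And>\<alpha> \<beta>. \<alpha> \<in> \<Lambda> \<Longrightarrow> \<beta> \<in> \<Lambda> \<Longrightarrow> (\<And>j. j \<in> {i..c} \<Longrightarrow> \<alpha> j = \<beta> j) \<Longrightarrow> \<alpha> = \<beta>"
  shows "(\<Oplus>\<alpha>\<in>\<Lambda>. v \<alpha> \<otimes> (\<Otimes>j\<in>{i..c}. w j [^] (\<alpha> j :: nat))) \<notin> P i"
  using i \<Lambda>
proof (induction i arbitrary: \<Lambda> rule: inc_induct)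
  case base
  then show ?case by (intro assms(8)) auto
next
  case (step i)
  interpret Pi: primeideal "P i" R using P(1)[of i] step by simp
  interpret Pj: primeideal "P (Suc i)" R using P(1)[of "Suc i"] step by simp
  have ic: "i \<le> c" using step N by simp
  have wi: "w i \<in> carrier R" using w(3) ic by blast
  define m where "m = Min ((\<lambda>\<alpha>. \<alpha> i) ` \<Lambda>)"
  define \<Lambda>1 where "\<Lambda>1 = {\<alpha> \<in> \<Lambda>. \<alpha> i = m}"
  have mmin: "m \<le> \<alpha> i" if "\<alpha> \<in> \<Lambda>" for \<alpha> using that step.prems unfolding m_def by (intro Min_le) auto
  have "m \<in> (\<lambda>\<alpha>. \<alpha> i) ` \<Lambda>" unfolding m_def by (rule Min_in) (use step.prems in auto)
  then have ne: "\<Lambda>1 \<noteq> {}" unfolding \<Lambda>1_def by auto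
  define r where "r = (\<lambda>\<alpha>. v \<alpha> \<otimes> (\<Otimes>j\<in>{Suc i..c}. w j [^] (\<alpha> j :: nat)))"
  have pc: "(\<Otimes>j\<in>{Suc i..c}. w j [^] (\<alpha> j :: nat)) \<in> carrier R" for \<alpha>
    by (rule finprod_closed) (use w(3) in auto)
  have rc: "r \<alpha> \<in> carrier R" if "\<alpha> \<in> \<Lambda>" for \<alpha>
    unfolding r_def using pc v step.prems that by blast
  have sub1: "\<Lambda>1 \<subseteq> \<Lambda>" by (auto simp: \<Lambda>1_def)
  have not: "(\<Oplus>\<alpha>\<in>\<Lambda>1. r \<alpha>) \<notin> P (Suc i)"
    unfolding r_def
  proof (rule step.IH)
    show "\<Lambda>1 \<subseteq> L" "finite \<Lambda>1" using sub1 step.prems finite_subset[OF sub1] by auto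
    fix \<alpha> \<beta> assume ab: "\<alpha> \<in> \<Lambda>1" "\<beta> \<in> \<Lambda>1" "\<And>j. j \<in> {Suc i..c} \<Longrightarrow> \<alpha> j = \<beta> j"
    show "\<alpha> = \<beta>"
    proof (rule step.prems(4))
      fix j assume "j \<in> {i..c}"
      then show "\<alpha> j = \<beta> j" using ab by (cases "j = i") (auto simp: \<Lambda>1_def)
    qed (use ab sub1 in auto)
  qed (rule ne)
  show ?case
  proof
    assume asm: "(\<Oplus>\<alpha>\<in>\<Lambda>. v \<alpha> \<otimes> (\<Otimes>j\<in>{i..c}. w j [^] \<alpha> j)) \<in> P i"
    have tm: "v \<alpha> \<otimes> (\<Otimes>j\<in>{i..c}. w j [^] \<alpha> j) = w i [^] m \<otimes> (w i [^] (\<alpha> i - m) \<otimes> r \<alpha>)" if a: "\<alpha> \<in> \<Lambda>" for \<alpha>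
    proof -
      have "{i..c} = insert i {Suc i..c}" using ic by auto
      then have "(\<Otimes>j\<in>{i..c}. w j [^] \<alpha> j) = w i [^] \<alpha> i \<otimes> (\<Otimes>j\<in>{Suc i..c}. w j [^] \<alpha> j)"
        by (simp only:) (rule finprod_insert, use w(3) wi in auto)
      also have "w i [^] \<alpha> i = w i [^] m \<otimes> w i [^] (\<alpha> i - m)"
        using mmin[OF a] wi by (simp add: nat_pow_mult)
      finally show ?thesis unfolding r_def using pc[of \<alpha>] wi v[of \<alpha>] a step.prems(1) by (simp add: m_ac subset_iff)
    qed
    have tc: "w i [^] (\<alpha> i - m) \<otimes> r \<alpha> \<in> carrier R" if "\<alpha> \<in> \<Lambda>" for \<alpha> using rc[OF that] wi by simp
    have "(\<Oplus>\<alpha>\<in>\<Lambda>. v \<alpha> \<otimes> (\<Otimes>j\<in>{i..c}. w j [^] \<alpha> j)) = (\<Oplus>\<alpha>\<in>\<Lambda>. w i [^] m \<otimes> (w i [^] (\<alpha> i - m) \<otimes> r \<alpha>))"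
      by (rule add.finprod_cong') (use tm tc wi in auto)
    also have "\<dots> = w i [^] m \<otimes> (\<Oplus>\<alpha>\<in>\<Lambda>. w i [^] (\<alpha> i - m) \<otimes> r \<alpha>)"
      by (rule finsum_rdistr[symmetric]) (use step.prems tc wi in auto)
    finally have "w i [^] m \<otimes> (\<Oplus>\<alpha>\<in>\<Lambda>. w i [^] (\<alpha> i - m) \<otimes> r \<alpha>) \<in> P i" using asm by simp
    moreover have "(\<Oplus>\<alpha>\<in>\<Lambda>. w i [^] (\<alpha> i - m) \<otimes> r \<alpha>) \<in> carrier R" by (rule finsum_closed) (use tc in auto)
    moreover have "w i [^] m \<notin> P i" using Pi.pow_notin[OF wi] w(2) step by simp
    ultimately have "(\<Oplus>\<alpha>\<in>\<Lambda>. w i [^] (\<alpha> i - m) \<otimes> r \<alpha>) \<in> P i" using Pi.mult_mem_iff wi by simp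
    then have in2: "(\<Oplus>\<alpha>\<in>\<Lambda>. w i [^] (\<alpha> i - m) \<otimes> r \<alpha>) \<in> P (Suc i)" using P(2)[of i] step by auto
    have L: "\<Lambda> = \<Lambda>1 \<union> (\<Lambda> - \<Lambda>1)" using sub1 by auto
    have "(\<Oplus>\<alpha>\<in>\<Lambda>1 \<union> (\<Lambda> - \<Lambda>1). w i [^] (\<alpha> i - m) \<otimes> r \<alpha>)
      = (\<Oplus>\<alpha>\<in>\<Lambda>1. w i [^] (\<alpha> i - m) \<otimes> r \<alpha>) \<oplus> (\<Oplus>\<alpha>\<in>\<Lambda> - \<Lambda>1. w i [^] (\<alpha> i - m) \<otimes> r \<alpha>)"
      by (rule add.finprod_Un_disjoint) (use step.prems tc sub1 finite_subset[OF sub1] in auto)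
    also have "(\<Oplus>\<alpha>\<in>\<Lambda>1. w i [^] (\<alpha> i - m) \<otimes> r \<alpha>) = (\<Oplus>\<alpha>\<in>\<Lambda>1. r \<alpha>)"
      by (rule add.finprod_cong') (use rc sub1 in \<open>auto simp: \<Lambda>1_def\<close>)
    finally have eq: "(\<Oplus>\<alpha>\<in>\<Lambda>. w i [^] (\<alpha> i - m) \<otimes> r \<alpha>) = (\<Oplus>\<alpha>\<in>\<Lambda>1. r \<alpha>) \<oplus> (\<Oplus>\<alpha>\<in>\<Lambda> - \<Lambda>1. w i [^] (\<alpha> i - m) \<otimes> r \<alpha>)"
      using L by simp
    have rest: "(\<Oplus>\<alpha>\<in>\<Lambda> - \<Lambda>1. w i [^] (\<alpha> i - m) \<otimes> r \<alpha>) \<in> P (Suc i)"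
    proof (rule Pj.finsum_mem)
      fix \<alpha> assume a: "\<alpha> \<in> \<Lambda> - \<Lambda>1"
      then have "m < \<alpha> i" using mmin[of \<alpha>] by (auto simp: \<Lambda>1_def)
      then obtain k where k: "\<alpha> i - m = Suc k" by (metis Suc_diff_Suc)
      have "w i [^] (\<alpha> i - m) \<in> P (Suc i)" unfolding k using w(1)[of i] step wi by (simp add: Pj.I_l_closed)
      then show "w i [^] (\<alpha> i - m) \<otimes> r \<alpha> \<in> P (Suc i)" using rc[of \<alpha>] a by (simp add: Pj.I_r_closed)
    qed
    have "(\<Oplus>\<alpha>\<in>\<Lambda>1. r \<alpha>) \<in> carrier R" by (rule finsum_closed) (use rc sub1 in auto)
    then have "(\<Oplus>\<alpha>\<in>\<Lambda>1. r \<alpha>) \<in> P (Suc i)" using in2 Pj.add_mem_cancel[OF _ rest] eq by simp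
    then show False using not by blast
  qed
qed

lemma (in ring_hom_cring) ideal_vimage_cring:
  assumes "ideal J S"
  shows "ideal {x \<in> carrier R. h x \<in> J} R"
proof -
  interpret J: ideal J S by fact
  show ?thesis
    by (rule R.idealI_cring) (use J.zero_closed in \<open>auto simp: J.a_closed J.I_l_closed\<close>)
qed

context cring begin

lemma mpoly_order_ideal: "ideal {g \<in> carrier (mpoly_ring R V). \<forall>m. size m < k \<longrightarrow> g m = \<zero>} (mpoly_ring R V)"
proof -
  interpret P: cring "mpoly_ring R V" by (rule mpoly_ring_cring)
  show ?thesis
  proof (rule P.idealI_cring)
    fix f g assume f: "f \<in> {g \<in> carrier (mpoly_ring R V). \<forall>m. size m < k \<longrightarrow> g m = \<zero>}"
      and g: "g \<in> carrier (mpoly_ring R V)"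
    have "(g \<otimes>\<^bsub>mpoly_ring R V\<^esub> f) m = \<zero>" if m: "size m < k" for m
    proof -
      have "(g \<otimes>\<^bsub>mpoly_ring R V\<^esub> f) m = (\<Oplus>a\<in>{a. a \<subseteq># m}. \<zero>)"
        unfolding mpoly_mult_eq mpoly_mult_def
      proof (rule add.finprod_cong')
        fix a assume "a \<in> {a. a \<subseteq># m}"
        have "size (m - a) \<le> size m" by (intro size_mset_mono) simp
        then have "f (m - a) = \<zero>" using f m by simp
        then show "g a \<otimes> f (m - a) = \<zero>" using mpoly_coeff_closed[OF g] by simp
      qed auto
      then show ?thesis by simp
    qed
    then show "g \<otimes>\<^bsub>mpoly_ring R V\<^esub> f \<in> {g \<in> carrier (mpoly_ring R V). \<forall>m. size m < k \<longrightarrow> g m = \<zero>}"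
      using f g by simp
  next
    have "\<zero>\<^bsub>mpoly_ring R V\<^esub> m = \<zero>" for m by (simp add: mpoly_zero indexed_const_def)
    then show "\<zero>\<^bsub>mpoly_ring R V\<^esub> \<in> {g \<in> carrier (mpoly_ring R V). \<forall>m. size m < k \<longrightarrow> g m = \<zero>}" by simp
  next
    fix f g assume "f \<in> {g \<in> carrier (mpoly_ring R V). \<forall>m. size m < k \<longrightarrow> g m = \<zero>}"
      "g \<in> {g \<in> carrier (mpoly_ring R V). \<forall>m. size m < k \<longrightarrow> g m = \<zero>}"
    moreover have "(f \<oplus>\<^bsub>mpoly_ring R V\<^esub> g) m = f m \<oplus> g m" for m by (simp add: mpoly_add indexed_padd_def)
    ultimately show "f \<oplus>\<^bsub>mpoly_ring R V\<^esub> g \<in> {g \<in> carrier (mpoly_ring R V). \<forall>m. size m < k \<longrightarrow> g m = \<zero>}"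
      by simp
  qed auto
qed

lemma mpoly_add_coeff: "(f \<oplus>\<^bsub>mpoly_ring R V\<^esub> g) m = f m \<oplus> g m"
  by (simp add: mpoly_add indexed_padd_def)

lemma mpoly_var_pow:
  assumes "i \<in> V"
  shows "indexed_var i [^]\<^bsub>mpoly_ring R V\<^esub> (k :: nat) = mpoly_monom R \<one> (replicate_mset k i)"
proof (induction k)
  case 0
  then show ?case by (simp add: mpoly_one indexed_const_eq_monom)
next
  case (Suc k)
  then show ?case
    using mpoly_monom_mult[OF one_closed one_closed, where a="replicate_mset k i" and c="{#i#}" and V=V]
    by (simp add: indexed_var_eq_monom)
qed

lemma mpoly_prod_var_pow:
  assumes "finite J" "\<And>j. j \<in> J \<Longrightarrow> z j \<in> V"
  shows "finprod (mpoly_ring R V) (\<lambda>j. indexed_var (z j) [^]\<^bsub>mpoly_ring R V\<^esub> (\<alpha> j :: nat)) J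
    = mpoly_monom R \<one> (\<Sum>j\<in>J. replicate_mset (\<alpha> j) (z j))"
  using assms
proof (induction J rule: finite_induct)
  case empty
  interpret P: cring "mpoly_ring R V" by (rule mpoly_ring_cring)
  show ?case by (simp add: mpoly_one indexed_const_eq_monom)
next
  case (insert j J)
  interpret P: cring "mpoly_ring R V" by (rule mpoly_ring_cring)
  have "finprod (mpoly_ring R V) (\<lambda>j. indexed_var (z j) [^]\<^bsub>mpoly_ring R V\<^esub> (\<alpha> j :: nat)) (insert j J)
    = indexed_var (z j) [^]\<^bsub>mpoly_ring R V\<^esub> \<alpha> j \<otimes>\<^bsub>mpoly_ring R V\<^esub>
      finprod (mpoly_ring R V) (\<lambda>j. indexed_var (z j) [^]\<^bsub>mpoly_ring R V\<^esub> (\<alpha> j :: nat)) J"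
    by (rule P.finprod_insert) (use insert in auto)
  also have "\<dots> = mpoly_monom R \<one> (replicate_mset (\<alpha> j) (z j)) \<otimes>\<^bsub>mpoly_ring R V\<^esub>
      mpoly_monom R \<one> (\<Sum>j\<in>J. replicate_mset (\<alpha> j) (z j))"
    using insert by (simp add: mpoly_var_pow)
  also have "\<dots> = mpoly_monom R \<one> (\<Sum>j\<in>insert j J. replicate_mset (\<alpha> j) (z j))"
    using insert by (simp add: mpoly_monom_mult)
  finally show ?case .
qed

end

lemma (in alternating_form) pf_four:
  "pf [i, j, k, l] = b i j \<otimes> b k l \<oplus> \<ominus> (b i k \<otimes> b j l \<oplus> \<ominus> (b i l \<otimes> b j k))"
  by simp

section \<open>The failing prime and its minimal generators\<close>

context pivot_chart begin

text \<open>The contraction of the prime generated by \<open>\<mm>\<close> and the variables \<open>T\<^sub>e\<close>: the generic point of the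
  locus where the matrix has the rank of the pivot.\<close>

definition center :: "'c set \<Rightarrow> ((nat \<times> nat) multiset \<Rightarrow> 'a) set"
  where "center \<mm> = {f \<in> carrier R. \<theta> f \<in> coeff_prime A E \<mm> E}"

lemma center_prime: "primeideal \<mm> A \<Longrightarrow> primeideal (center \<mm>) R"
  unfolding center_def by (rule coeff_prime_chart)

text \<open>Every variable of \<open>\<theta> f\<close> lies in \<open>E\<close>, so the empty
  monomial is the only one in its support that can avoid \<open>E\<close>.\<close>

lemma center_iff:
  assumes \<mm>: "ideal \<mm> A" and f: "f \<in> carrier R"
  shows "f \<in> center \<mm> \<longleftrightarrow> \<theta> f {#} \<in> \<mm>"
proof -
  interpret m: ideal \<mm> A by fact
  have tf: "\<theta> f \<in> carrier T" using f by (rule \<theta>.hom_closed)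
  have z: "\<theta> f m = \<zero>\<^bsub>A\<^esub>" if "set_mset m \<inter> E = {}" "m \<noteq> {#}" for m
  proof (rule ccontr)
    assume "\<theta> f m \<noteq> \<zero>\<^bsub>A\<^esub>"
    then have "set_mset m \<subseteq> E" using A.mpoly_support_vars[OF tf] by blast
    then have "set_mset m = {}" using that(1) by blast
    then show False using that(2) by (simp only: set_mset_eq_empty_iff)
  qed
  have z0: "\<zero>\<^bsub>A\<^esub> \<in> \<mm>" using additive_subgroup.zero_closed[OF m.additive_subgroup_axioms] .
  show ?thesis
  proof
    assume "f \<in> center \<mm>"
    then have "\<forall>m. set_mset m \<inter> E = {} \<longrightarrow> \<theta> f m \<in> \<mm>" unfolding center_def coeff_prime_def by blast
    moreover have "set_mset {#} \<inter> E = {}" by auto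
    ultimately show "\<theta> f {#} \<in> \<mm>" by blast
  next
    assume 0: "\<theta> f {#} \<in> \<mm>"
    have "\<theta> f m \<in> \<mm>" if "set_mset m \<inter> E = {}" for m
    proof (cases "m = {#}")
      case True
      show ?thesis unfolding True by (rule 0)
    next
      case False
      show ?thesis unfolding z[OF that False] by (rule z0)
    qed
    then show "f \<in> center \<mm>" unfolding center_def coeff_prime_def using f tf by blast
  qed
qed

lemma theta_d_mult_coeff:
  assumes "f \<in> carrier R"
  shows "\<theta> (F.d \<otimes>\<^bsub>R\<^esub> f) m = iota F.d \<otimes>\<^bsub>A\<^esub> \<theta> f m"
proof -
  have "\<theta> (F.d \<otimes>\<^bsub>R\<^esub> f) = cAi F.d \<otimes>\<^bsub>T\<^esub> \<theta> f"
    by (simp only: \<theta>.hom_mult[OF F.pf_closed assms] theta_d)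
  then show ?thesis
    by (simp only: A.mpoly_mult_eq)
      (rule A.mpoly_mult_const[OF iota.hom_closed[OF F.pf_closed] A.mpoly_coeff_closed[OF \<theta>.hom_closed[OF assms]]])
qed

lemma theta_d_pow_coeff:
  assumes "f \<in> carrier R"
  shows "\<theta> (F.d [^]\<^bsub>R\<^esub> (k :: nat) \<otimes>\<^bsub>R\<^esub> f) m = iota F.d [^]\<^bsub>A\<^esub> k \<otimes>\<^bsub>A\<^esub> \<theta> f m"
proof (induction k)
  case 0
  have "\<theta> f m \<in> carrier A" by (rule A.mpoly_coeff_closed[OF \<theta>.hom_closed[OF assms]])
  then show ?case by (simp only: F.nat_pow_0 A.nat_pow_0 F.l_one[OF assms] A.l_one)
next
  case (Suc k)
  have c: "\<theta> f m \<in> carrier A" by (rule A.mpoly_coeff_closed[OF \<theta>.hom_closed[OF assms]])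
  have d: "iota F.d \<in> carrier A" by (rule iota.hom_closed[OF F.pf_closed])
  have "F.d [^]\<^bsub>R\<^esub> Suc k \<otimes>\<^bsub>R\<^esub> f = F.d \<otimes>\<^bsub>R\<^esub> (F.d [^]\<^bsub>R\<^esub> k \<otimes>\<^bsub>R\<^esub> f)"
    using assms F.pf_closed[of K] by (simp only: F.nat_pow_Suc F.m_assoc F.m_lcomm F.nat_pow_closed F.m_closed)
  then have "\<theta> (F.d [^]\<^bsub>R\<^esub> Suc k \<otimes>\<^bsub>R\<^esub> f) m = iota F.d \<otimes>\<^bsub>A\<^esub> (iota F.d [^]\<^bsub>A\<^esub> k \<otimes>\<^bsub>A\<^esub> \<theta> f m)"
    using theta_d_mult_coeff[of "F.d [^]\<^bsub>R\<^esub> k \<otimes>\<^bsub>R\<^esub> f" m] assms F.pf_closed[of K]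
    by (simp only: Suc F.nat_pow_closed F.m_closed)
  also have "\<dots> = iota F.d [^]\<^bsub>A\<^esub> Suc k \<otimes>\<^bsub>A\<^esub> \<theta> f m"
    using c d by (simp only: A.nat_pow_Suc A.m_assoc A.m_lcomm A.nat_pow_closed A.m_closed)
  finally show ?case .
qed

lemma iota_d_notin:
  assumes "primeideal \<mm> A"
  shows "iota F.d \<notin> \<mm>"
proof
  interpret m: primeideal \<mm> A by fact
  assume "iota F.d \<in> \<mm>"
  then have "iota F.d \<otimes>\<^bsub>A\<^esub> u \<in> \<mm>" using u_closed by (rule m.I_r_closed)
  then show False unfolding u_inverse using m.one_notin by blast
qed

text \<open>Stands in for the square of the ideal of T. Unlike a power of
  \<open>center \<mm>\<close>, it visibly allows cancelling the pivot, whose image is an invertible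
  constant.\<close>

definition order_two :: "((nat \<times> nat) multiset \<Rightarrow> 'a) set"
  where "order_two = {f \<in> carrier R. \<theta> f \<in> {g \<in> carrier T. \<forall>m. size m < 2 \<longrightarrow> g m = \<zero>\<^bsub>A\<^esub>}}"

lemma order_two_ideal: "ideal order_two R"
  unfolding order_two_def by (rule \<theta>.ideal_vimage_cring[OF A.mpoly_order_ideal])

lemma order_two_iff: "f \<in> carrier R \<Longrightarrow> f \<in> order_two \<longleftrightarrow> (\<forall>m. size m < 2 \<longrightarrow> \<theta> f m = \<zero>\<^bsub>A\<^esub>)"
  unfolding order_two_def using \<theta>.hom_closed by blast

lemma order_two_cancel:
  assumes f: "f \<in> carrier R" and "F.d \<otimes>\<^bsub>R\<^esub> f \<in> order_two"
  shows "f \<in> order_two"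
  unfolding order_two_iff[OF f]
proof (intro allI impI)
  fix m :: "(nat \<times> nat) multiset" assume "size m < 2"
  have "F.d \<otimes>\<^bsub>R\<^esub> f \<in> carrier R" using f F.pf_closed by (rule F.m_closed[rotated])
  from order_two_iff[OF this] assms(2) \<open>size m < 2\<close>
  have 0: "iota F.d \<otimes>\<^bsub>A\<^esub> \<theta> f m = \<zero>\<^bsub>A\<^esub>" using theta_d_mult_coeff[OF f, of m] by metis
  have c: "\<theta> f m \<in> carrier A" "iota F.d \<in> carrier A"
    by (rule A.mpoly_coeff_closed[OF \<theta>.hom_closed[OF f]], rule iota.hom_closed[OF F.pf_closed])
  have "\<theta> f m = (iota F.d \<otimes>\<^bsub>A\<^esub> u) \<otimes>\<^bsub>A\<^esub> \<theta> f m" unfolding u_inverse using A.l_one[OF c(1)] ..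
  also have "\<dots> = u \<otimes>\<^bsub>A\<^esub> (iota F.d \<otimes>\<^bsub>A\<^esub> \<theta> f m)" using c u_closed by (simp only: A.m_ac A.m_closed)
  also have "\<dots> = \<zero>\<^bsub>A\<^esub>" unfolding 0 using u_closed by (rule A.r_null)
  finally show "\<theta> f m = \<zero>\<^bsub>A\<^esub>" .
qed

lemma theta_pf_four:
  assumes "i < j" "j < k" "k < l" "l < n" "{i, j, k, l} \<inter> set K = {}"
  shows "\<theta> (F.Y.pf [i, j, k, l]) m = (if m = {#(i, j), (k, l)#} then \<one>\<^bsub>A\<^esub> else \<zero>\<^bsub>A\<^esub>) \<oplus>\<^bsub>A\<^esub>
    \<ominus>\<^bsub>A\<^esub> ((if m = {#(i, k), (j, l)#} then \<one>\<^bsub>A\<^esub> else \<zero>\<^bsub>A\<^esub>) \<oplus>\<^bsub>A\<^esub>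
      \<ominus>\<^bsub>A\<^esub> (if m = {#(i, l), (j, k)#} then \<one>\<^bsub>A\<^esub> else \<zero>\<^bsub>A\<^esub>))"
proof -
  let ?v = "\<lambda>i j. ring.indexed_var A (i, j)"
  have e: "(i, j) \<in> E" "(k, l) \<in> E" "(i, k) \<in> E" "(j, l) \<in> E" "(i, l) \<in> E" "(j, k) \<in> E"
    using assms by (auto simp: E_def)
  have c: "?v i j \<in> carrier T" "?v k l \<in> carrier T" "?v i k \<in> carrier T" "?v j l \<in> carrier T" "?v i l \<in> carrier T" "?v j k \<in> carrier T"
    using e by (simp_all only: A.mpoly_var_closed)
  have "\<theta> (F.Y.pf [i, j, k, l]) = ?v i j \<otimes>\<^bsub>T\<^esub> ?v k l \<oplus>\<^bsub>T\<^esub> \<ominus>\<^bsub>T\<^esub> (?v i k \<otimes>\<^bsub>T\<^esub> ?v j l \<oplus>\<^bsub>T\<^esub> \<ominus>\<^bsub>T\<^esub> (?v i l \<otimes>\<^bsub>T\<^esub> ?v j k))"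
    unfolding F.Y.pf_four
    by (simp only: \<theta>.hom_add \<theta>.hom_mult \<theta>.hom_a_inv F.y_closed F.m_closed F.a_closed F.a_inv_closed theta_y[OF e(1)]
      theta_y[OF e(2)] theta_y[OF e(3)] theta_y[OF e(4)] theta_y[OF e(5)] theta_y[OF e(6)])
  then show ?thesis
    by (simp only: A.mpoly_add_coeff A.mpoly_minus T.m_closed T.a_closed T.a_inv_closed c A.var_mult_var_coeff)
qed

lemma theta_pf_four_low:
  assumes "i < j" "j < k" "k < l" "l < n" "{i, j, k, l} \<inter> set K = {}" "size m < 2"
  shows "\<theta> (F.Y.pf [i, j, k, l]) m = \<zero>\<^bsub>A\<^esub>"
proof -
  have "m \<noteq> {#a, c#}" for a c using assms(6) by auto
  then show ?thesis unfolding theta_pf_four[OF assms(1-5)]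
    by (simp only: if_False A.l_zero A.minus_zero A.zero_closed A.a_inv_closed)
qed

lemma theta_pf_four_diag:
  assumes "i < j" "j < k" "k < l" "l < n" "{i, j, k, l} \<inter> set K = {}"
    and "i' < j'" "j' < k'" "k' < l'"
  shows "\<theta> (F.Y.pf [i, j, k, l]) {#(i', j'), (k', l')#} = (if [i, j, k, l] = [i', j', k', l'] then \<one>\<^bsub>A\<^esub> else \<zero>\<^bsub>A\<^esub>)"
proof -
  have dbl: "{#a, c#} = {#a', c'#} \<longleftrightarrow> a = a' \<and> c = c' \<or> a = c' \<and> c = a'" for a c a' c' :: "nat \<times> nat"
    by (auto simp: add_eq_conv_ex)
  \<comment> \<open>In a marked monomial one index pair lies entirely before the other. In the
    remaining two products of a Pfaffian the pairs interleave or are nested.\<close>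
  have n1: "{#(i', j'), (k', l')#} \<noteq> {#(i, k), (j, l)#}" and n2: "{#(i', j'), (k', l')#} \<noteq> {#(i, l), (j, k)#}"
    unfolding dbl using assms by auto
  have eq: "{#(i', j'), (k', l')#} = {#(i, j), (k, l)#} \<longleftrightarrow> [i, j, k, l] = [i', j', k', l']"
    unfolding dbl using assms by auto
  show ?thesis
  proof (cases "[i, j, k, l] = [i', j', k', l']")
    case True
    show ?thesis unfolding theta_pf_four[OF assms(1-5)] eq if_P[OF True] if_not_P[OF n1] if_not_P[OF n2]
      by (simp only: A.r_zero A.minus_zero A.zero_closed A.one_closed)
  next
    case False
    show ?thesis unfolding theta_pf_four[OF assms(1-5)] eq if_not_P[OF False] if_not_P[OF n1] if_not_P[OF n2]
      by (simp only: A.r_zero A.minus_zero A.zero_closed A.one_closed)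
  qed
qed

text \<open>The monomial \<open>T\<^sub>i\<^sub>j T\<^sub>k\<^sub>l\<close> of the \<open>4 \<times> 4\<close> Pfaffian of the rows \<open>i < j < k < l\<close> occurs in no other
  one, which makes these Pfaffians independent modulo the maximal ideal.\<close>

definition mark :: "nat set \<Rightarrow> (nat \<times> nat) multiset"
  where "mark L = (let xs = sorted_list_of_set L in {#(xs ! 0, xs ! 1), (xs ! 2, xs ! 3)#})"

lemma four_subset:
  assumes "L \<subseteq> {..<n} - set K" "card L = 4"
  obtains i j k l where "sorted_list_of_set L = [i, j, k, l]" "i < j" "j < k" "k < l" "l < n"
    "{i, j, k, l} \<inter> set K = {}" "mark L = {#(i, j), (k, l)#}"
proof -
  have fin: "finite L" using assms(1) finite_subset by blast
  have len: "length (sorted_list_of_set L) = 4" using assms by simp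
  obtain i j k l where xs: "sorted_list_of_set L = [i, j, k, l]"
  proof -
    have "\<exists>i j k l. xs = [i, j, k, l]" if "length xs = 4" for xs :: "nat list"
      using that by (auto simp: numeral_eq_Suc length_Suc_conv)
    from this[OF len] show ?thesis using that by blast
  qed
  have "sorted_wrt (<) (sorted_list_of_set L)" by simp
  then have lt: "i < j" "j < k" "k < l" unfolding xs by auto
  have "set [i, j, k, l] = L" using fin by (simp flip: xs)
  then have "l < n" "{i, j, k, l} \<inter> set K = {}" using assms(1) by auto
  moreover have "mark L = {#(i, j), (k, l)#}" unfolding mark_def xs Let_def by (simp add: numeral_2_eq_2 numeral_3_eq_3)
  ultimately show ?thesis using that xs lt by blast
qed

lemma theta_pf_mark:
  assumes L: "L \<subseteq> {..<n} - set K" "card L = 4" and L': "L' \<subseteq> {..<n} - set K" "card L' = 4"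
  shows "\<theta> (F.Y.pf (sorted_list_of_set L)) (mark L') = (if L = L' then \<one>\<^bsub>A\<^esub> else \<zero>\<^bsub>A\<^esub>)"
proof -
  obtain i j k l where 1: "sorted_list_of_set L = [i, j, k, l]" "i < j" "j < k" "k < l" "l < n"
    "{i, j, k, l} \<inter> set K = {}" by (rule four_subset[OF L])
  obtain i' j' k' l' where 2: "sorted_list_of_set L' = [i', j', k', l']" "i' < j'" "j' < k'" "k' < l'"
    "mark L' = {#(i', j'), (k', l')#}" by (rule four_subset[OF L'])
  have fin: "finite L" "finite L'" using L L' finite_subset by blast+
  have eq: "L = L' \<longleftrightarrow> sorted_list_of_set L = sorted_list_of_set L'"
    using fin by (metis set_sorted_list_of_set)
  show ?thesis unfolding eq unfolding 1(1) 2(1,5) by (rule theta_pf_four_diag[OF 1(2-6) 2(2-4)])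
qed

lemma pf_in_order_two:
  assumes "distinct L" "set L \<subseteq> {..<n} - set K" "length L = 4"
  shows "F.Y.pf L \<in> order_two"
proof -
  have c: "card (set L) = 4" using assms by (simp add: distinct_card)
  obtain i j k l where 1: "sorted_list_of_set (set L) = [i, j, k, l]" "i < j" "j < k" "k < l" "l < n"
    "{i, j, k, l} \<inter> set K = {}" by (rule four_subset[OF assms(2) c])
  have "F.Y.pf (sorted_list_of_set (set L)) \<in> order_two"
    unfolding order_two_iff[OF F.Y.pf_closed] unfolding 1(1) using theta_pf_four_low[OF 1(2-6)] by blast
  moreover have "mset L = mset (sorted_list_of_set (set L))"
    using assms(1) set_eq_iff_mset_eq_distinct[of L "sorted_list_of_set (set L)"] by simp
  ultimately show ?thesis by (rule F.Y.pf_mset_in_ideal[OF order_two_ideal, rotated])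
qed

text \<open>After pivoting, the generators reduce to 4 by 4 Pfaffians of T, which are quadratic in
  its entries.\<close>

lemma pfaffian_ideal_order_two:
  assumes "2 * t = length K + 4"
  shows "pfaffian_ideal (generic_alt_ring S n) (2 * t) (generic_alt_mat S n) \<subseteq> order_two"
proof (rule pfaffian_ideal_subset[OF order_two_ideal _ assms])
  show "z \<in> order_two" if "z \<in> carrier R" "F.d \<otimes>\<^bsub>R\<^esub> z \<in> order_two" for z using that by (rule order_two_cancel)
qed (auto intro: pf_in_order_two simp del: pf_list.simps)

lemma order_two_center:
  assumes "ideal \<mm> A"
  shows "order_two \<subseteq> center \<mm>"
proof
  interpret m: ideal \<mm> A by fact
  fix f assume f: "f \<in> order_two"
  then have fR: "f \<in> carrier R" unfolding order_two_def by blast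
  have "\<theta> f {#} = \<zero>\<^bsub>A\<^esub>" using f unfolding order_two_iff[OF fR] by (metis size_empty zero_less_numeral)
  then show "f \<in> center \<mm>" unfolding center_iff[OF assms fR]
    using additive_subgroup.zero_closed[OF m.additive_subgroup_axioms] by (simp only:)
qed

text \<open>Linear algebra takes the place of Nakayama's lemma. If \<open>G\<close> generated
  \<open>I\<close> locally, then comparing the coefficients at the marked monomials would factor a
  diagonal matrix of size \<open>card U\<close>, with diagonal entries outside \<open>\<mm>\<close>,
  through the smaller size \<open>card G\<close>. A vector that is nonzero modulo
  \<open>\<mm>\<close> and annihilates the first factor modulo \<open>\<mm>\<close> is a
  contradiction.\<close>

lemma center_not_locally_generated:
  assumes \<mm>: "primeideal \<mm> A" and t: "2 * t = length K + 4" and K: "set K \<subseteq> {..<n}" "distinct K"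
    and N: "N < (n - length K) choose 4"
  shows "\<not> locally_generated R (center \<mm>) (pfaffian_ideal (generic_alt_ring S n) (2 * t) (generic_alt_mat S n)) N"
proof
  let ?I = "pfaffian_ideal (generic_alt_ring S n) (2 * t) (generic_alt_mat S n)"
  let ?D = "{..<n} - set K"
  interpret m: primeideal \<mm> A by fact
  interpret I: ideal ?I R by (rule pfaffian_ideal_ideal)
  assume "locally_generated R (center \<mm>) ?I N"
  then obtain G where G: "G \<subseteq> ?I" "finite G" "card G \<le> N" "\<And>x. x \<in> ?I \<Longrightarrow> \<exists>s\<in>carrier R - center \<mm>. s \<otimes>\<^bsub>R\<^esub> x \<in> Idl\<^bsub>R\<^esub> G"
    unfolding locally_generated_def by blast
  have GR: "G \<subseteq> carrier R" using G(1) I.Icarr by blast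
  define U where "U = {L. L \<subseteq> ?D \<and> card L = 4}"
  have finU: "finite U" unfolding U_def by (rule finite_subset[of _ "Pow ?D"]) auto
  have "card ?D = n - length K" using K by (simp add: card_Diff_subset distinct_card)
  then have "card U = (n - length K) choose 4" unfolding U_def using n_subsets[of ?D 4] by simp
  then have card: "card G < card U" using G(3) N by simp
  \<comment> \<open>For four entries \<open>pf_Schur\<close> reads d^4 Pf(K, L) = d d^2 Pf_T(L), so
    the cube of \<open>d\<close> puts the Pfaffian of T into \<open>I\<close> without any
    cancellation.\<close>
  define w where "w L = F.d [^]\<^bsub>R\<^esub> (3 :: nat) \<otimes>\<^bsub>R\<^esub> F.Y.pf (sorted_list_of_set L)" for L
  have wR: "w L \<in> carrier R" for L unfolding w_def by (rule F.m_closed[OF F.nat_pow_closed[OF F.pf_closed] F.Y.pf_closed])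
  have wI: "w L \<in> ?I" if L: "L \<in> U" for L
  proof -
    have fin: "finite L" using L finite_subset unfolding U_def by blast
    have len: "length (sorted_list_of_set L) = 4" using L unfolding U_def by simp
    have "F.pf (K @ sorted_list_of_set L) \<in> ?I"
      by (rule pf_in_pfaffian_ideal) (use L fin K t in \<open>auto simp: U_def\<close>)
    then have "F.d [^]\<^bsub>R\<^esub> length (sorted_list_of_set L) \<otimes>\<^bsub>R\<^esub> F.pf (K @ sorted_list_of_set L) \<in> ?I"
      by (rule I.I_l_closed[OF _ F.nat_pow_closed[OF F.pf_closed]])
    also have "F.d [^]\<^bsub>R\<^esub> length (sorted_list_of_set L) \<otimes>\<^bsub>R\<^esub> F.pf (K @ sorted_list_of_set L)
      = F.d \<otimes>\<^bsub>R\<^esub> (F.d [^]\<^bsub>R\<^esub> (2 :: nat) \<otimes>\<^bsub>R\<^esub> F.Y.pf (sorted_list_of_set L))"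
    proof -
      have 2: "(4 :: nat) div 2 = 2" by simp
      show ?thesis unfolding F.pf_Schur unfolding len 2 ..
    qed
    also have "\<dots> = w L"
      unfolding w_def using F.pf_closed[of K] F.Y.pf_closed[of "sorted_list_of_set L"]
      by (simp only: numeral_3_eq_3 numeral_2_eq_2 F.nat_pow_Suc F.m_ac F.m_closed F.nat_pow_closed)
    finally show ?thesis .
  qed
  define Z where "Z L z \<longleftrightarrow> fst z \<in> carrier R - center \<mm> \<and> (\<forall>a\<in>G. snd z a \<in> carrier R)
    \<and> fst z \<otimes>\<^bsub>R\<^esub> w L = finsum R (\<lambda>a. snd z a \<otimes>\<^bsub>R\<^esub> a) G" for L z
  have "\<exists>z. Z L z" if L: "L \<in> U" for L
  proof -
    obtain s where s: "s \<in> carrier R - center \<mm>" "s \<otimes>\<^bsub>R\<^esub> w L \<in> Idl\<^bsub>R\<^esub> G" using G(4)[OF wI[OF L]] by blast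
    obtain g where g: "\<forall>a\<in>G. g a \<in> carrier R" "s \<otimes>\<^bsub>R\<^esub> w L = finsum R (\<lambda>a. g a \<otimes>\<^bsub>R\<^esub> a) G"
      using F.Idl_finite_combinations[OF G(2) GR s(2)] by blast
    have "Z L (s, g)" unfolding Z_def fst_conv snd_conv using s(1) g by (intro conjI)
    then show ?thesis by (rule exI)
  qed
  then have "\<forall>L\<in>U. \<exists>z. Z L z" by (rule ballI)
  from bchoice[OF this] obtain z where z: "\<And>L. L \<in> U \<Longrightarrow> Z L (z L)" by blast
  define s where "s L = fst (z L)" for L
  define g where "g L = snd (z L)" for L
  have s: "s L \<in> carrier R - center \<mm>" if "L \<in> U" for L using z[OF that] unfolding Z_def s_def by (elim conjE)
  have g: "g L a \<in> carrier R" if "L \<in> U" "a \<in> G" for L a using z[OF that(1)] that(2) unfolding Z_def g_def by (elim conjE) (erule bspec)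
  have sg: "s L \<otimes>\<^bsub>R\<^esub> w L = finsum R (\<lambda>a. g L a \<otimes>\<^bsub>R\<^esub> a) G" if "L \<in> U" for L using z[OF that] unfolding Z_def s_def g_def by (elim conjE)
  \<comment> \<open>The constant term in the chart: by \<open>center_iff\<close>, an element of
    \<open>R\<close> lies outside the center exactly when its \<kappa> lies outside
    \<open>\<mm>\<close>.\<close>
  define \<kappa> where "\<kappa> f = \<theta> f {#}" for f
  have tc: "\<theta> f m \<in> carrier A" if "f \<in> carrier R" for f m by (rule A.mpoly_coeff_closed[OF \<theta>.hom_closed[OF that]])
  have \<kappa>c: "\<kappa> f \<in> carrier A" if "f \<in> carrier R" for f unfolding \<kappa>_def by (rule tc[OF that])
  have lead: "\<theta> (f \<otimes>\<^bsub>R\<^esub> a) m = \<kappa> f \<otimes>\<^bsub>A\<^esub> \<theta> a m" if "f \<in> carrier R" "a \<in> ?I" "size m = 2" for f a m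
  proof -
    have aR: "a \<in> carrier R" using that(2) I.Icarr by blast
    have low: "\<theta> a m' = \<zero>\<^bsub>A\<^esub>" if "size m' < size m" for m'
    proof -
      have "a \<in> order_two" using pfaffian_ideal_order_two[OF t] \<open>a \<in> ?I\<close> by blast
      moreover have "size m' < 2" using that \<open>size m = 2\<close> by simp
      ultimately show ?thesis using order_two_iff[OF aR] by blast
    qed
    show ?thesis unfolding \<theta>.hom_mult[OF that(1) aR] A.mpoly_mult_eq \<kappa>_def
      by (rule A.mpoly_mult_lowest) (rule tc[OF that(1)], rule tc[OF aR], rule low)
  qed
  have size_mark: "size (mark L) = 2" for L by (simp add: mark_def Let_def)
  let ?e = "iota F.d [^]\<^bsub>A\<^esub> (3 :: nat)"
  have ec: "?e \<in> carrier A" by (rule A.nat_pow_closed[OF iota.hom_closed[OF F.pf_closed]])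
  have en: "?e \<notin> \<mm>" by (rule m.pow_notin[OF iota.hom_closed[OF F.pf_closed] iota_d_notin[OF \<mm>]])
  have wmark: "\<theta> (w L) (mark L') = (if L = L' then ?e else \<zero>\<^bsub>A\<^esub>)" if "L \<in> U" "L' \<in> U" for L L'
  proof -
    have "\<theta> (F.Y.pf (sorted_list_of_set L)) (mark L') = (if L = L' then \<one>\<^bsub>A\<^esub> else \<zero>\<^bsub>A\<^esub>)"
      by (rule theta_pf_mark) (use that in \<open>auto simp: U_def\<close>)
    then show ?thesis unfolding w_def theta_d_pow_coeff[OF F.Y.pf_closed]
      using ec by (cases "L = L'") (simp_all only: simp_thms if_True if_False A.r_one A.r_null)
  qed
  have rel: "\<kappa> (s L) \<otimes>\<^bsub>A\<^esub> (if L = L' then ?e else \<zero>\<^bsub>A\<^esub>) = finsum A (\<lambda>a. \<kappa> (g L a) \<otimes>\<^bsub>A\<^esub> \<theta> a (mark L')) G"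
    if L: "L \<in> U" "L' \<in> U" for L L'
  proof -
    have "\<kappa> (s L) \<otimes>\<^bsub>A\<^esub> (if L = L' then ?e else \<zero>\<^bsub>A\<^esub>) = \<theta> (s L \<otimes>\<^bsub>R\<^esub> w L) (mark L')"
    proof -
      have "s L \<in> carrier R" using s[OF L(1)] by blast
      show ?thesis unfolding lead[OF \<open>s L \<in> carrier R\<close> wI[OF L(1)] size_mark] wmark[OF L] ..
    qed
    also have "\<theta> (s L \<otimes>\<^bsub>R\<^esub> w L) = finsum T (\<lambda>a. \<theta> (g L a \<otimes>\<^bsub>R\<^esub> a)) G"
    proof -
      have "(\<lambda>a. g L a \<otimes>\<^bsub>R\<^esub> a) \<in> G \<rightarrow> carrier R" using g[OF L(1)] GR F.m_closed by blast
      from \<theta>.hom_finsum[OF this] show ?thesis unfolding sg[OF L(1)] comp_def .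
    qed
    also have "\<dots> (mark L') = finsum A (\<lambda>a. \<theta> (g L a \<otimes>\<^bsub>R\<^esub> a) (mark L')) G"
      by (rule A.mpoly_finsum[OF G(2)]) (rule \<theta>.hom_closed[OF F.m_closed], use g[OF L(1)] GR in auto)
    also have "\<dots> = finsum A (\<lambda>a. \<kappa> (g L a) \<otimes>\<^bsub>A\<^esub> \<theta> a (mark L')) G"
    proof (rule A.add.finprod_cong')
      fix a assume a: "a \<in> G"
      show "\<theta> (g L a \<otimes>\<^bsub>R\<^esub> a) (mark L') = \<kappa> (g L a) \<otimes>\<^bsub>A\<^esub> \<theta> a (mark L')"
        by (rule lead[OF g[OF L(1) a] _ size_mark]) (use a G(1) in blast)
    next
      show "(\<lambda>a. \<kappa> (g L a) \<otimes>\<^bsub>A\<^esub> \<theta> a (mark L')) \<in> G \<rightarrow> carrier A"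
      proof
        fix a assume a: "a \<in> G"
        then have "a \<in> carrier R" using GR by blast
        then show "\<kappa> (g L a) \<otimes>\<^bsub>A\<^esub> \<theta> a (mark L') \<in> carrier A" by (intro A.m_closed \<kappa>c tc g[OF L(1) a])
      qed
    qed (rule refl)
    finally show ?thesis .
  qed
  \<comment> \<open>There are more marked Pfaffians than generators, so some combination of the rows
    of \<open>\<kappa> (g L a)\<close> vanishes modulo \<open>\<mm>\<close>.\<close>
  obtain v where v: "\<And>L. L \<in> U \<Longrightarrow> v L \<in> carrier A" "\<exists>L\<in>U. v L \<notin> \<mm>"
    "\<And>a. a \<in> G \<Longrightarrow> finsum A (\<lambda>L. \<kappa> (g L a) \<otimes>\<^bsub>A\<^esub> v L) U \<in> \<mm>"
    using m.homogeneous_system[OF G(2) finU card, of "\<lambda>a L. \<kappa> (g L a)"] \<kappa>c g by blast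
  have "v L' \<in> \<mm>" if L': "L' \<in> U" for L'
  proof -
    have \<kappa>s: "\<kappa> (s L) \<in> carrier A" if "L \<in> U" for L using s[OF that] \<kappa>c by blast
    have \<kappa>g: "\<kappa> (g L a) \<in> carrier A" if "L \<in> U" "a \<in> G" for L a using g[OF that] \<kappa>c by blast
    have ta: "\<theta> a (mark L') \<in> carrier A" if "a \<in> G" for a using tc that GR by blast
    have "finsum A (\<lambda>L. v L \<otimes>\<^bsub>A\<^esub> (\<kappa> (s L) \<otimes>\<^bsub>A\<^esub> (if L = L' then ?e else \<zero>\<^bsub>A\<^esub>))) U
      = finsum A (\<lambda>L. if L' = L then v L \<otimes>\<^bsub>A\<^esub> (\<kappa> (s L) \<otimes>\<^bsub>A\<^esub> ?e) else \<zero>\<^bsub>A\<^esub>) U"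
    proof (rule A.add.finprod_cong'[OF refl])
      show "(\<lambda>L. if L' = L then v L \<otimes>\<^bsub>A\<^esub> (\<kappa> (s L) \<otimes>\<^bsub>A\<^esub> ?e) else \<zero>\<^bsub>A\<^esub>) \<in> U \<rightarrow> carrier A"
      proof
        fix L assume L: "L \<in> U"
        have "v L \<otimes>\<^bsub>A\<^esub> (\<kappa> (s L) \<otimes>\<^bsub>A\<^esub> ?e) \<in> carrier A" by (intro A.m_closed v(1)[OF L] \<kappa>s[OF L] ec)
        then show "(if L' = L then v L \<otimes>\<^bsub>A\<^esub> (\<kappa> (s L) \<otimes>\<^bsub>A\<^esub> ?e) else \<zero>\<^bsub>A\<^esub>) \<in> carrier A"
          using A.zero_closed by (simp only: simp_thms split: if_split)
      qed
      fix L assume L: "L \<in> U"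
      show "v L \<otimes>\<^bsub>A\<^esub> (\<kappa> (s L) \<otimes>\<^bsub>A\<^esub> (if L = L' then ?e else \<zero>\<^bsub>A\<^esub>))
        = (if L' = L then v L \<otimes>\<^bsub>A\<^esub> (\<kappa> (s L) \<otimes>\<^bsub>A\<^esub> ?e) else \<zero>\<^bsub>A\<^esub>)"
      proof (cases "L = L'")
        case True
        show ?thesis unfolding True by (simp only: simp_thms if_True)
      next
        case False
        then have F: "L' \<noteq> L" by blast
        show ?thesis unfolding if_not_P[OF False] if_not_P[OF F] A.r_null[OF \<kappa>s[OF L]] by (rule A.r_null[OF v(1)[OF L]])
      qed
    qed
    also have "\<dots> = v L' \<otimes>\<^bsub>A\<^esub> (\<kappa> (s L') \<otimes>\<^bsub>A\<^esub> ?e)"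
      by (rule A.add.finprod_singleton[OF L' finU]) (intro funcsetI A.m_closed v(1) \<kappa>s ec; assumption)
    finally have 1: "v L' \<otimes>\<^bsub>A\<^esub> (\<kappa> (s L') \<otimes>\<^bsub>A\<^esub> ?e)
      = finsum A (\<lambda>L. v L \<otimes>\<^bsub>A\<^esub> (\<kappa> (s L) \<otimes>\<^bsub>A\<^esub> (if L = L' then ?e else \<zero>\<^bsub>A\<^esub>))) U" ..
    also have "\<dots> = finsum A (\<lambda>L. finsum A (\<lambda>a. \<theta> a (mark L') \<otimes>\<^bsub>A\<^esub> (\<kappa> (g L a) \<otimes>\<^bsub>A\<^esub> v L)) G) U"
    proof (rule A.add.finprod_cong')
      fix L assume L: "L \<in> U"
      have "v L \<otimes>\<^bsub>A\<^esub> (\<kappa> (s L) \<otimes>\<^bsub>A\<^esub> (if L = L' then ?e else \<zero>\<^bsub>A\<^esub>)) = v L \<otimes>\<^bsub>A\<^esub> finsum A (\<lambda>a. \<kappa> (g L a) \<otimes>\<^bsub>A\<^esub> \<theta> a (mark L')) G"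
        unfolding rel[OF L L'] ..
      also have "\<dots> = finsum A (\<lambda>a. v L \<otimes>\<^bsub>A\<^esub> (\<kappa> (g L a) \<otimes>\<^bsub>A\<^esub> \<theta> a (mark L'))) G"
        by (rule A.finsum_rdistr[OF G(2) v(1)[OF L]]) (intro funcsetI A.m_closed \<kappa>g[OF L] ta; assumption)
      also have "\<dots> = finsum A (\<lambda>a. \<theta> a (mark L') \<otimes>\<^bsub>A\<^esub> (\<kappa> (g L a) \<otimes>\<^bsub>A\<^esub> v L)) G"
      proof (rule A.add.finprod_cong')
        fix a assume a: "a \<in> G"
        show "v L \<otimes>\<^bsub>A\<^esub> (\<kappa> (g L a) \<otimes>\<^bsub>A\<^esub> \<theta> a (mark L')) = \<theta> a (mark L') \<otimes>\<^bsub>A\<^esub> (\<kappa> (g L a) \<otimes>\<^bsub>A\<^esub> v L)"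
          using v(1)[OF L] \<kappa>g[OF L a] ta[OF a] by (simp only: A.m_ac A.m_closed)
      next
        show "(\<lambda>a. \<theta> a (mark L') \<otimes>\<^bsub>A\<^esub> (\<kappa> (g L a) \<otimes>\<^bsub>A\<^esub> v L)) \<in> G \<rightarrow> carrier A"
          by (intro funcsetI A.m_closed v(1)[OF L] \<kappa>g[OF L] ta; assumption)
      qed (rule refl)
      finally show "v L \<otimes>\<^bsub>A\<^esub> (\<kappa> (s L) \<otimes>\<^bsub>A\<^esub> (if L = L' then ?e else \<zero>\<^bsub>A\<^esub>))
        = finsum A (\<lambda>a. \<theta> a (mark L') \<otimes>\<^bsub>A\<^esub> (\<kappa> (g L a) \<otimes>\<^bsub>A\<^esub> v L)) G" .
    next
      show "(\<lambda>L. finsum A (\<lambda>a. \<theta> a (mark L') \<otimes>\<^bsub>A\<^esub> (\<kappa> (g L a) \<otimes>\<^bsub>A\<^esub> v L)) G) \<in> U \<rightarrow> carrier A"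
        by (intro funcsetI A.finsum_closed A.m_closed v(1) \<kappa>g ta; assumption)
    qed (rule refl)
    also have "\<dots> = finsum A (\<lambda>a. finsum A (\<lambda>L. \<theta> a (mark L') \<otimes>\<^bsub>A\<^esub> (\<kappa> (g L a) \<otimes>\<^bsub>A\<^esub> v L)) U) G"
      by (rule A.finsum_swap[OF finU G(2)]) (intro A.m_closed v(1) \<kappa>g ta; assumption)
    also have "\<dots> \<in> \<mm>"
    proof (rule m.finsum_mem)
      fix a assume a: "a \<in> G"
      have "finsum A (\<lambda>L. \<theta> a (mark L') \<otimes>\<^bsub>A\<^esub> (\<kappa> (g L a) \<otimes>\<^bsub>A\<^esub> v L)) U = \<theta> a (mark L') \<otimes>\<^bsub>A\<^esub> finsum A (\<lambda>L. \<kappa> (g L a) \<otimes>\<^bsub>A\<^esub> v L) U"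
        by (rule A.finsum_rdistr[symmetric, OF finU ta[OF a]]) (intro funcsetI A.m_closed v(1) \<kappa>g a; assumption)
      then show "finsum A (\<lambda>L. \<theta> a (mark L') \<otimes>\<^bsub>A\<^esub> (\<kappa> (g L a) \<otimes>\<^bsub>A\<^esub> v L)) U \<in> \<mm>"
        using m.I_l_closed[OF v(3)[OF a] ta[OF a]] by (simp only:)
    qed
    finally have "v L' \<otimes>\<^bsub>A\<^esub> (\<kappa> (s L') \<otimes>\<^bsub>A\<^esub> ?e) \<in> \<mm>" .
    moreover have "\<kappa> (s L') \<notin> \<mm>" using s[OF L'] center_iff[OF m.is_ideal, of "s L'"] unfolding \<kappa>_def by blast
    ultimately show ?thesis
      using m.mult_mem_iff[OF v(1)[OF L'] A.m_closed[OF \<kappa>s[OF L'] ec]] m.mult_mem_iff[OF \<kappa>s[OF L'] ec] en by blast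
  qed
  then show False using v(2) by blast
qed

end

lemma prime_chain_subset:
  assumes "\<And>i. i < N \<Longrightarrow> P i \<subset> P (Suc i)" "i \<le> j" "j \<le> N"
  shows "P i \<subseteq> (P j :: 'a set)"
  using assms(2,3)
proof (induction j rule: dec_induct)
  case (step j)
  then have "P i \<subseteq> P j" "P j \<subset> P (Suc j)" using assms(1)[of j] by auto
  then show ?case by blast
qed simp

lemma height_ge_mono:
  assumes "height_ge R p k" "j \<le> k"
  shows "height_ge R p j"
proof -
  obtain P where P: "\<forall>i\<le>k. primeideal (P i) R" "\<forall>i<k. P i \<subset> P (Suc i)" "P k \<subseteq> p"
    using assms(1) unfolding height_ge_def by blast
  have "P j \<subseteq> P k" by (rule prime_chain_subset[of k]) (use P assms(2) in auto)
  then show ?thesis unfolding height_ge_def using P assms(2) by (intro exI[of _ P]) auto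
qed

lemma locally_generated_mono: "locally_generated R p I k \<Longrightarrow> k \<le> l \<Longrightarrow> locally_generated R p I l"
  unfolding locally_generated_def by (meson order.trans)

section \<open>Upper bound for the height of the failing prime\<close>

context pivot_chart begin

lemma theta_pivot_poly:
  assumes "f \<in> carrier (mpoly_ring S (V - E))"
  shows "\<theta> f = cAi f"
proof -
  have sub: "g \<in> carrier R" if "g \<in> carrier (mpoly_ring S (V - E))" for g
    using that unfolding S.mpoly_carrier S.indexed_pset_iff by blast
  show ?thesis using assms
  proof (induction rule: S.mpoly_induct)
    case (const k)
    show ?case by (rule ev.eval_const[OF const])
  next
    case (add f g)
    have e: "f \<oplus>\<^bsub>mpoly_ring S (V - E)\<^esub> g = f \<oplus>\<^bsub>R\<^esub> g" by (simp only: S.mpoly_add)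
    show ?case unfolding e
      by (simp only: \<theta>.hom_add[OF sub[OF add(1)] sub[OF add(2)]] cAi.hom_add[OF sub[OF add(1)] sub[OF add(2)]] add(3,4))
  next
    case (var f i)
    let ?x = "ring.indexed_var S i"
    have iV: "i \<in> V" "i \<notin> E" using var(2) by (simp_all only: Diff_iff simp_thms)
    have x: "?x \<in> carrier R" by (rule S.mpoly_var_closed[OF iV(1)])
    have e: "?x \<otimes>\<^bsub>mpoly_ring S (V - E)\<^esub> f = ?x \<otimes>\<^bsub>R\<^esub> f" by (simp only: S.mpoly_mult_eq)
    have tx: "\<theta> ?x = cAi ?x" by (rule theta_var_pivot[OF iV])
    show ?case unfolding e
      by (simp only: \<theta>.hom_mult[OF x sub[OF var(1)]] cAi.hom_mult[OF x sub[OF var(1)]] tx var(3))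
  qed
qed

lemma center_pivot_poly_iff:
  assumes "ideal \<mm> A" "f \<in> carrier (mpoly_ring S (V - E))"
  shows "f \<in> center \<mm> \<longleftrightarrow> iota f \<in> \<mm>"
proof -
  have f: "f \<in> carrier R" using assms(2) unfolding S.mpoly_carrier S.indexed_pset_iff by blast
  show ?thesis unfolding center_iff[OF assms(1) f] theta_pivot_poly[OF assms(2)] A.indexed_const_coeff ..
qed

text \<open>Minimality of \<open>q\<close> makes every prime of a longer chain meet S in
  \<open>q\<close>, so the argument is that for polynomials over the domain S / q. The descent ends
  with a polynomial in the variables outside \<open>E\<close> that is nonzero modulo
  \<open>q\<close>. The chart treats these variables as constants, so membership in the center would
  put all its coefficients into \<open>q\<close>.\<close>

lemma center_height:
  assumes \<mm>: "primeideal \<mm> A" and q: "primeideal q S"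
    and qmin: "\<And>P. primeideal P S \<Longrightarrow> P \<subseteq> q \<Longrightarrow> P = q"
    and iota_mem: "\<And>f. f \<in> carrier R \<Longrightarrow> iota f \<in> \<mm> \<longleftrightarrow> (\<forall>m. f m \<in> q)"
  shows "\<not> height_ge R (center \<mm>) (Suc (card E))"
proof
  interpret m: primeideal \<mm> A by fact
  interpret q: primeideal q S by fact
  assume "height_ge R (center \<mm>) (Suc (card E))"
  define N where "N = Suc (card E)"
  obtain P where P: "\<And>i. i \<le> N \<Longrightarrow> primeideal (P i) R" "\<And>i. i < N \<Longrightarrow> P i \<subset> P (Suc i)" "P N \<subseteq> center \<mm>"
    using \<open>height_ge _ _ _\<close> unfolding height_ge_def N_def by blast
  have finV: "finite V" by (rule finite_subset[of _ "{..<n} \<times> {..<n}"]) (auto simp: upper_positions_def)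
  have finE: "finite E" using E_sub finV by (rule finite_subset)
  define c where "c = card V"
  have cE: "card (V - E) = c - card E" unfolding c_def by (rule card_Diff_subset[OF finE E_sub])
  have Nc: "N \<le> Suc c" unfolding N_def c_def using card_mono[OF finV E_sub] by simp
  \<comment> \<open>The contraction of \<open>P i\<close> to S lies in \<open>q\<close> because
    \<open>P i\<close> lies in the center; being prime, it equals \<open>q\<close> by
    minimality.\<close>
  have const_in: "S.indexed_const k \<in> P i" if k: "k \<in> q" and i: "i \<le> N" for k i
  proof -
    interpret C: ring_hom_cring S R "ring.indexed_const S" by (rule S.indexed_const_hom)
    have pr: "primeideal {k \<in> carrier S. ring.indexed_const S k \<in> P i} S" by (rule C.prime_vimage[OF P(1)[OF i]])
    have "{k \<in> carrier S. ring.indexed_const S k \<in> P i} \<subseteq> q"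
    proof
      fix k assume "k \<in> {k \<in> carrier S. ring.indexed_const S k \<in> P i}"
      then have k: "k \<in> carrier S" "ring.indexed_const S k \<in> P i" by auto
      have "P i \<subseteq> P N" by (rule prime_chain_subset[of N]) (use P(2) i in auto)
      then have "ring.indexed_const S k \<in> center \<mm>" using k P(3) by blast
      then have "iota (ring.indexed_const S k) \<in> \<mm>"
        using center_pivot_poly_iff[OF m.is_ideal S.mpoly_const_closed[OF k(1)]] by blast
      then have "\<forall>m :: (nat \<times> nat) multiset. ring.indexed_const S k m \<in> q" using iota_mem[OF S.mpoly_const_closed[OF k(1)]] by blast
      then have "ring.indexed_const S k ({#} :: (nat \<times> nat) multiset) \<in> q" by blast
      then show "k \<in> q" by (simp only: S.indexed_const_coeff)
    qed
    from qmin[OF pr this] k show ?thesis by blast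
  qed
  have coeffs_in: "f \<in> P i" if "f \<in> carrier R" "\<And>m. f m \<in> q" "i \<le> N" for f i
    by (rule S.mpoly_in_ideal_of_coeffs[OF primeideal.axioms(1)[OF P(1)[OF that(3)]] that(1) const_in[OF that(2,3)]])
  have "\<forall>i. \<exists>a. i < N \<longrightarrow> a \<in> P (Suc i) \<and> a \<notin> P i" using P(2) by blast
  from choice[OF this] obtain a where a: "\<And>i. i < N \<Longrightarrow> a i \<in> P (Suc i) \<and> a i \<notin> P i" by blast
  obtain h where h: "bij_betw h {..<c - card E} (V - E)"
    using ex_bij_betw_nat_finite[of "V - E"] finV cE by (auto simp: atLeast0LessThan)
  \<comment> \<open>The chain supplies \<open>N = card E + 1\<close> elements and the variables
    outside \<open>E\<close> another \<open>c - card E\<close>. That is one more than the number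
    \<open>c\<close> of variables, hence the indices 0 to \<open>c\<close>.\<close>
  define w where "w i = (if i < N then a i else ring.indexed_var S (h (i - N)))" for i
  have hV: "h (j - N) \<in> V - E" if "j \<in> {N..c}" for j
    by (rule bij_betw_apply[OF h]) (use that in \<open>auto simp: N_def\<close>)
  have aR: "a i \<in> carrier R" if "i < N" for i
    using a[OF that] ideal.Icarr[OF primeideal.axioms(1)[OF P(1)[of "Suc i"]]] that by simp
  have wR: "w i \<in> carrier R" if "i \<le> c" for i
  proof (cases "i < N")
    case True
    then show ?thesis unfolding w_def using aR by simp
  next
    case False
    then have "h (i - N) \<in> V" using hV[of i] that by simp
    then show ?thesis unfolding w_def using False by simp
  qed
  obtain B v where v: "\<forall>\<alpha>\<in>{..c} \<rightarrow>\<^sub>E {..<B}. v \<alpha> \<in> carrier S" "\<exists>\<alpha>\<in>{..c} \<rightarrow>\<^sub>E {..<B}. v \<alpha> \<notin> q"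
    "\<forall>m. finsum R (\<lambda>\<alpha>. ring.indexed_const S (v \<alpha>) \<otimes>\<^bsub>R\<^esub>
          finprod R (\<lambda>i. w i [^]\<^bsub>R\<^esub> (\<alpha> i :: nat)) {..c}) ({..c} \<rightarrow>\<^sub>E {..<B :: nat}) m \<in> q"
  proof -
    have "\<exists>B v. (\<forall>\<alpha>\<in>{..c} \<rightarrow>\<^sub>E {..<B}. v \<alpha> \<in> carrier S) \<and> (\<exists>\<alpha>\<in>{..c} \<rightarrow>\<^sub>E {..<B}. v \<alpha> \<notin> q)
      \<and> (\<forall>m. finsum R (\<lambda>\<alpha>. ring.indexed_const S (v \<alpha>) \<otimes>\<^bsub>R\<^esub>
          finprod R (\<lambda>i. w i [^]\<^bsub>R\<^esub> (\<alpha> i :: nat)) {..c}) ({..c} \<rightarrow>\<^sub>E {..<B :: nat}) m \<in> q)"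
      by (rule q.algebraic_dependence[OF finV c_def[symmetric]]) (rule wR)
    then show ?thesis by (elim exE conjE) (rule that)
  qed
  let ?\<Lambda> = "{..c} \<rightarrow>\<^sub>E {..<B}"
  \<comment> \<open>Terms with \<open>v \<alpha>\<close> in \<open>q\<close> already lie in
    \<open>P 0\<close>. Removing them leaves a sum in \<open>P 0\<close> whose coefficients are all
    outside \<open>q\<close>.\<close>
  define L where "L = {\<alpha> \<in> ?\<Lambda>. v \<alpha> \<notin> q}"
  have fin\<Lambda>: "finite ?\<Lambda>" by (intro finite_PiE) auto
  have subL: "L \<subseteq> ?\<Lambda>" by (auto simp: L_def)
  have finL: "finite L" by (rule finite_subset[OF subL fin\<Lambda>])
  have vS: "v \<alpha> \<in> carrier S" if "\<alpha> \<in> ?\<Lambda>" for \<alpha> using v(1) that by blast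
  define W where "W \<alpha> = finprod R (\<lambda>i. w i [^]\<^bsub>R\<^esub> (\<alpha> i :: nat)) {..c}" for \<alpha>
  have WR: "W \<alpha> \<in> carrier R" for \<alpha> unfolding W_def by (rule F.finprod_closed) (use wR in auto)
  define t where "t \<alpha> = ring.indexed_const S (v \<alpha>) \<otimes>\<^bsub>R\<^esub> W \<alpha>" for \<alpha>
  have tR: "t \<alpha> \<in> carrier R" if "\<alpha> \<in> ?\<Lambda>" for \<alpha>
    unfolding t_def by (rule F.m_closed[OF S.mpoly_const_closed[OF vS[OF that]] WR])
  have sum_in: "finsum R t L \<in> P 0"
  proof -
    interpret P0: primeideal "P 0" R using P(1)[of 0] by simp
    have total: "finsum R t ?\<Lambda> \<in> P 0"
    proof (rule coeffs_in)
      have "t = (\<lambda>\<alpha>. ring.indexed_const S (v \<alpha>) \<otimes>\<^bsub>R\<^esub> finprod R (\<lambda>i. w i [^]\<^bsub>R\<^esub> (\<alpha> i :: nat)) {..c})"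
        by (rule ext) (rule t_def[unfolded W_def])
      then show "finsum R t ?\<Lambda> m \<in> q" for m using v(3) by (simp only:)
      show "finsum R t ?\<Lambda> \<in> carrier R" by (intro F.finsum_closed funcsetI tR; assumption)
    qed simp
    have rest: "finsum R t (?\<Lambda> - L) \<in> P 0"
    proof (rule P0.finsum_mem)
      fix \<alpha> assume "\<alpha> \<in> ?\<Lambda> - L"
      then have "v \<alpha> \<in> q" by (auto simp: L_def)
      then show "t \<alpha> \<in> P 0" unfolding t_def by (intro P0.I_r_closed const_in WR) (assumption | rule le0)+
    qed
    have "finsum R t (L \<union> (?\<Lambda> - L)) = finsum R t L \<oplus>\<^bsub>R\<^esub> finsum R t (?\<Lambda> - L)"
      by (rule F.add.finprod_Un_disjoint) (use finL fin\<Lambda> tR subL in auto)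
    also have "L \<union> (?\<Lambda> - L) = ?\<Lambda>" using subL by blast
    finally have eq: "finsum R t ?\<Lambda> = finsum R t L \<oplus>\<^bsub>R\<^esub> finsum R t (?\<Lambda> - L)" .
    have "finsum R t L \<in> carrier R" by (rule F.finsum_closed) (use tR subL in auto)
    from P0.add_mem_cancel[OF this rest] show ?thesis using total unfolding eq by blast
  qed
  have "(finsum R (\<lambda>\<alpha>. ring.indexed_const S (v \<alpha>) \<otimes>\<^bsub>R\<^esub> finprod R (\<lambda>j. w j [^]\<^bsub>R\<^esub> (\<alpha> j :: nat)) {0..c}) L) \<notin> P 0"
  proof (rule F.lex_descent[where N=N and P=P and w=w and c=c and L=L and i=0])
    show "primeideal (P i) R" if "i \<le> N" for i using P(1) that .
    show "P i \<subseteq> P (Suc i)" if "i < N" for i using P(2)[OF that] by blast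
    show "w i \<in> P (Suc i)" "w i \<notin> P i" if "i < N" for i using a[OF that] that unfolding w_def by auto
    show "w i \<in> carrier R" if "i \<le> c" for i using wR that .
    show "ring.indexed_const S (v \<alpha>) \<in> carrier R" if "\<alpha> \<in> L" for \<alpha>
      by (rule S.mpoly_const_closed[OF vS]) (use subL that in blast)
    show "L \<noteq> {}" using v(2) by (auto simp: L_def)
    show "\<alpha> = \<beta>" if "\<alpha> \<in> L" "\<beta> \<in> L" "\<And>j. j \<in> {0..c} \<Longrightarrow> \<alpha> j = \<beta> j" for \<alpha> \<beta>
      by (rule PiE_ext[of _ "{..c}" "\<lambda>_. {..<B}"]) (use that subL in auto)
    fix \<Lambda> assume \<Lambda>: "\<Lambda> \<subseteq> L" "finite \<Lambda>" "\<Lambda> \<noteq> {}"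
      and inj: "\<And>\<alpha> \<beta>. \<alpha> \<in> \<Lambda> \<Longrightarrow> \<beta> \<in> \<Lambda> \<Longrightarrow> (\<And>j. j \<in> {N..c} \<Longrightarrow> \<alpha> j = \<beta> j) \<Longrightarrow> \<alpha> = \<beta>"
    let ?f = "finsum R (\<lambda>\<alpha>. ring.indexed_const S (v \<alpha>) \<otimes>\<^bsub>R\<^esub> finprod R (\<lambda>j. w j [^]\<^bsub>R\<^esub> (\<alpha> j :: nat)) {N..c}) \<Lambda>"
    \<comment> \<open>From \<open>N\<close> on, the product is a monomial in the variables outside
      \<open>E\<close>. The exponents in \<Lambda> are already separated by these positions, so no
      two terms of \<open>?f\<close> share a monomial and each \<open>v \<alpha>\<close> survives as
      a coefficient.\<close>
    define \<mu> where "\<mu> \<alpha> = (\<Sum>j\<in>{N..c}. replicate_mset (\<alpha> j) (h (j - N)))" for \<alpha> :: "nat \<Rightarrow> nat"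
    have v\<Lambda>: "v \<alpha> \<in> carrier S" if "\<alpha> \<in> \<Lambda>" for \<alpha> using vS subL \<Lambda>(1) that by blast
    have \<mu>V: "set_mset (\<mu> \<alpha>) \<subseteq> V - E" for \<alpha>
    proof
      fix e assume "e \<in># \<mu> \<alpha>"
      then have "e \<in> (\<Union>j\<in>{N..c}. set_mset (replicate_mset (\<alpha> j) (h (j - N))))"
        unfolding \<mu>_def by (simp only: set_mset_sum[OF finite_atLeastAtMost])
      then obtain j where "j \<in> {N..c}" "e \<in># replicate_mset (\<alpha> j) (h (j - N))" by (elim UN_E)
      then show "e \<in> V - E" using hV[of j] by (auto split: if_splits)
    qed
    have count: "count (\<mu> \<alpha>) (h (j - N)) = \<alpha> j" if j: "j \<in> {N..c}" for \<alpha> j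
    proof -
      have hinj: "h (i - N) = h (j - N) \<longleftrightarrow> i = j" if "i \<in> {N..c}" for i
      proof -
        have "i - N < c - card E" "j - N < c - card E" "i - N = j - N \<longleftrightarrow> i = j"
          using that j unfolding N_def atLeastAtMost_iff by linarith+
        then show ?thesis
          using inj_on_eq_iff[OF bij_betw_imp_inj_on[OF h], of "i - N" "j - N"] by (simp only: lessThan_iff)
      qed
      have "count (\<mu> \<alpha>) (h (j - N)) = (\<Sum>i\<in>{N..c}. if i = j then \<alpha> i else 0)"
        unfolding \<mu>_def count_sum
        by (rule sum.cong[OF refl]) (simp only: count_replicate_mset hinj eq_commute[of "h (j - N)"])
      then show ?thesis using j by simp
    qed
    have \<mu>inj: "\<alpha> = \<beta>" if "\<alpha> \<in> \<Lambda>" "\<beta> \<in> \<Lambda>" "\<mu> \<alpha> = \<mu> \<beta>" for \<alpha> \<beta>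
      by (rule inj[OF that(1,2)]) (metis count that(3))
    have mon: "ring.indexed_const S (v \<alpha>) \<otimes>\<^bsub>R\<^esub> finprod R (\<lambda>j. w j [^]\<^bsub>R\<^esub> (\<alpha> j :: nat)) {N..c} = mpoly_monom S (v \<alpha>) (\<mu> \<alpha>)"
      if "\<alpha> \<in> \<Lambda>" for \<alpha>
    proof -
      have "finprod R (\<lambda>j. w j [^]\<^bsub>R\<^esub> \<alpha> j) {N..c} = finprod R (\<lambda>j. ring.indexed_var S (h (j - N)) [^]\<^bsub>R\<^esub> \<alpha> j) {N..c}"
        by (rule F.finprod_cong') (use hV in \<open>auto simp: w_def\<close>)
      also have "\<dots> = mpoly_monom S \<one>\<^bsub>S\<^esub> (\<mu> \<alpha>)" unfolding \<mu>_def by (rule S.mpoly_prod_var_pow) (use hV in auto)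
      finally show ?thesis
        using S.mpoly_monom_mult[OF v\<Lambda>[OF that] S.one_closed, where a="{#}" and c="\<mu> \<alpha>" and V=V] v\<Lambda>[OF that]
        by (simp add: S.indexed_const_eq_monom)
    qed
    have monR: "mpoly_monom S (v \<alpha>) (\<mu> \<alpha>) \<in> carrier R" if "\<alpha> \<in> \<Lambda>" for \<alpha>
      by (rule S.mpoly_monom_closed[OF v\<Lambda>[OF that]]) (use \<mu>V in blast)
    have f: "?f = finsum R (\<lambda>\<alpha>. mpoly_monom S (v \<alpha>) (\<mu> \<alpha>)) \<Lambda>"
      by (rule F.add.finprod_cong') (use mon monR in auto)
    have coeff: "?f m = finsum S (\<lambda>\<alpha>. mpoly_monom S (v \<alpha>) (\<mu> \<alpha>) m) \<Lambda>" for m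
      unfolding f by (rule S.mpoly_finsum[OF \<Lambda>(2) monR])
    have fR: "?f \<in> carrier R" unfolding f by (rule F.finsum_closed) (use monR in auto)
    have fZ: "?f \<in> carrier (mpoly_ring S (V - E))"
    proof -
      have "set_mset m \<subseteq> V - E" if "?f m \<noteq> \<zero>\<^bsub>S\<^esub>" for m
      proof (rule ccontr)
        assume "\<not> set_mset m \<subseteq> V - E"
        then have ne: "m \<noteq> \<mu> \<alpha>" for \<alpha> using \<mu>V by blast
        have "finsum S (\<lambda>\<alpha>. mpoly_monom S (v \<alpha>) (\<mu> \<alpha>) m) \<Lambda> = finsum S (\<lambda>\<alpha>. \<zero>\<^bsub>S\<^esub>) \<Lambda>"
          by (rule S.add.finprod_cong') (use ne in \<open>auto simp: mpoly_monom_def\<close>)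
        then show False using that unfolding coeff by simp
      qed
      then show ?thesis using fR unfolding S.mpoly_carrier S.indexed_pset_iff by blast
    qed
    show "?f \<notin> P N"
    proof
      assume "?f \<in> P N"
      then have "?f \<in> center \<mm>" using P(3) by blast
      then have "iota ?f \<in> \<mm>" using center_pivot_poly_iff[OF m.is_ideal fZ] by blast
      then have all: "\<forall>m. ?f m \<in> q" using iota_mem[OF fR] by blast
      obtain \<beta> where b: "\<beta> \<in> \<Lambda>" using \<Lambda>(3) by blast
      have "?f (\<mu> \<beta>) = finsum S (\<lambda>\<alpha>. mpoly_monom S (v \<alpha>) (\<mu> \<alpha>) (\<mu> \<beta>)) \<Lambda>"
        by (rule coeff)
      also have "\<dots> = finsum S (\<lambda>\<alpha>. if \<beta> = \<alpha> then v \<alpha> else \<zero>\<^bsub>S\<^esub>) \<Lambda>"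
      proof (rule S.add.finprod_cong'[OF refl])
        show "(\<lambda>\<alpha>. if \<beta> = \<alpha> then v \<alpha> else \<zero>\<^bsub>S\<^esub>) \<in> \<Lambda> \<rightarrow> carrier S"
          by (rule funcsetI) (simp only: v\<Lambda> S.zero_closed split: if_split, blast)
        show "mpoly_monom S (v \<alpha>) (\<mu> \<alpha>) (\<mu> \<beta>) = (if \<beta> = \<alpha> then v \<alpha> else \<zero>\<^bsub>S\<^esub>)"
          if "\<alpha> \<in> \<Lambda>" for \<alpha>
        proof -
          have "\<mu> \<beta> = \<mu> \<alpha> \<longleftrightarrow> \<beta> = \<alpha>" using \<mu>inj[OF b that] by blast
          then show ?thesis by (simp only: mpoly_monom_def)
        qed
      qed
      also have "\<dots> = v \<beta>"
        by (rule S.add.finprod_singleton[OF b \<Lambda>(2)]) (intro funcsetI v\<Lambda>; assumption)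
      finally have eq: "?f (\<mu> \<beta>) = v \<beta>" .
      have "v \<beta> \<in> q" using all[THEN spec, of "\<mu> \<beta>"] unfolding eq .
      moreover have "\<beta> \<in> L" using b \<Lambda>(1) by blast
      ultimately show False unfolding L_def by blast
    qed
  qed (use finL Nc in auto)
  then show False using sum_in unfolding t_def W_def atMost_atLeast0 by blast
qed

end

section \<open>Existence of the failing prime\<close>

text \<open>Entries of the standard symplectic matrix: in the expansion along row
  \<open>2 * a\<close> only the first term survives.\<close>

lemma (in cring) pf_list_standard:
  assumes b: "\<And>i j. b i j \<in> carrier R"
    and one: "\<And>a. a < r \<Longrightarrow> b (2 * a) (2 * a + 1) = \<one>"
    and zero: "\<And>a z. a < r \<Longrightarrow> 2 * a + 1 < z \<Longrightarrow> z < 2 * r \<Longrightarrow> b (2 * a) z = \<zero>"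
  shows "a \<le> r \<Longrightarrow> pf_list R b [2 * a..<2 * r] = \<one>"
proof (induction a rule: inc_induct)
  case base
  show ?case by simp
next
  case (step a)
  let ?zs = "[2 * Suc a..<2 * r]"
  have l: "[2 * a..<2 * r] = 2 * a # (2 * a + 1) # ?zs" using step(2) by (simp add: upt_conv_Cons)
  have "ctr (b (2 * a)) (\<lambda>u. pf_list R b ((2 * a + 1) # u)) ?zs = \<zero>"
  proof (rule ctr_zero_row)
    show "b (2 * a) z = \<zero>" if "z \<in> set ?zs" for z using zero[of a z] step(2) that by auto
    show "pf_list R b ((2 * a + 1) # u) \<in> carrier R" for u by (rule pf_list_closed_on) (rule b)
  qed
  then have "pf_list R b [2 * a..<2 * r] = b (2 * a) (2 * a + 1) \<otimes> pf_list R b ?zs \<oplus> \<ominus> \<zero>"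
    unfolding l pf_list.simps(2)[of R b "2 * a"] row_contract.simps(2) by (simp only:)
  then show ?case using one[of a] step by simp
qed

text \<open>Specializing the variables to the standard symplectic matrix sends the pivot to 1,
  whereas a polynomial with all coefficients in \<open>q\<close> would be sent into
  \<open>q\<close>.\<close>

lemma (in generic_pivot) standard_pf_notin:
  assumes K: "K = [0..<2 * r]" "2 * r \<le> n" and q: "primeideal q S"
  shows "F.d \<notin> coeff_prime S V q {}"
proof
  interpret q: primeideal q S by fact
  have id: "ring_hom_cring S S (\<lambda>k. k)" by (rule ring_hom_cringI[OF S.is_cring S.is_cring ring_hom_memI]) auto
  let ?v = "\<lambda>(i, j). if even i \<and> j = Suc i then \<one>\<^bsub>S\<^esub> else \<zero>\<^bsub>S\<^esub>"
  have v: "?v (2 * a, 2 * a + 1) = \<one>\<^bsub>S\<^esub>" "2 * a + 1 < z \<Longrightarrow> ?v (2 * a, z) = \<zero>\<^bsub>S\<^esub>" for a z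
    by simp_all
  interpret e: mpoly_evaluation S S "\<lambda>k. k" V ?v
  proof (intro mpoly_evaluation.intro mpoly_evaluation_axioms.intro)
    show "cring S" "cring S" by (rule S.is_cring)+
    show "ring_hom_cring S S (\<lambda>k. k)" by (rule id)
    show "?v i \<in> carrier S" if "i \<in> V" for i by (cases i) (simp only: prod.case split: if_split, simp only: S.one_closed S.zero_closed simp_thms)
  qed
  interpret e: ring_hom_cring R S "mpoly_eval S S (\<lambda>k. k) ?v" by (rule e.eval_hom)
  let ?e = "mpoly_eval S S (\<lambda>k. k) ?v"
  have ev: "?e (x i j) = ?v (i, j)" if "i < j" "j < n" for i j
  proof -
    have V: "(i, j) \<in> V" unfolding upper_positions_def using that by blast
    have "x i j = S.indexed_var (i, j)" unfolding var_form_def by (simp only: V if_True)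
    then show ?thesis by (simp only: e.eval_var[OF V])
  qed
  have "?e F.d = pf_list S (\<lambda>i j. ?e (x i j)) [2 * 0..<2 * r]"
    unfolding K(1) mult_0_right by (rule e.hom_pf_list[OF F.b_closed])
  also have "\<dots> = \<one>\<^bsub>S\<^esub>"
  proof (rule S.pf_list_standard)
    show "?e (x i j) \<in> carrier S" for i j by (rule e.hom_closed[OF F.b_closed])
    show "?e (x (2 * a) (2 * a + 1)) = \<one>\<^bsub>S\<^esub>" if "a < r" for a
    proof (rule trans[OF ev v(1)])
      show "2 * a < 2 * a + 1" "2 * a + 1 < n" using that K(2) by linarith+
    qed
    show "?e (x (2 * a) z) = \<zero>\<^bsub>S\<^esub>" if "a < r" "2 * a + 1 < z" "z < 2 * r" for a z
    proof (rule trans[OF ev v(2)])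
      show "2 * a < z" "z < n" using that K(2) by linarith+
    qed (rule that(2))
    show "0 \<le> r" by (rule le0)
  qed
  finally have one: "?e F.d = \<one>\<^bsub>S\<^esub>" .
  assume d: "F.d \<in> coeff_prime S V q {}"
  have "?e F.d \<in> q"
    unfolding mpoly_eval_def
  proof (rule q.finsum_mem)
    fix m assume "m \<in> {m. F.d m \<noteq> \<zero>\<^bsub>S\<^esub>}"
    then have "set_mset m \<subseteq> V" using S.mpoly_support_vars[OF F.pf_closed] by blast
    moreover have "F.d m \<in> q" using d by (simp add: coeff_prime_def)
    ultimately show "F.d m \<otimes>\<^bsub>S\<^esub> mset_prod S ?v m \<in> q" by (intro q.I_r_closed e.mset_prod_v)
  qed
  then show False unfolding one using q.one_notin by blast
qed

text \<open>The chart is taken over the localization at the extension of a minimal prime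
  \<open>q\<close>, which is \<open>coeff_prime\<close> without variables. There the pivot on the
  first \<open>2 * t - 4\<close> indices is a unit, and the image of a polynomial lies in the
  maximal ideal exactly when all its coefficients lie in \<open>q\<close>, as
  \<open>center_height\<close> requires.\<close>

lemma (in cring) pfaffian_ideal_bad_prime:
  assumes nz: "carrier R \<noteq> {\<zero>}" and t: "2 \<le> t" "2 * t + 3 \<le> n"
  defines "P \<equiv> generic_alt_ring R n"
  defines "I \<equiv> pfaffian_ideal P (2 * t) (generic_alt_mat R n)"
  defines "N \<equiv> (n - 2 * t + 4) choose 2"
  assumes N: "N < (n - 2 * t + 4) choose 4"
  shows "\<exists>p. primeideal p P \<and> I \<subseteq> p \<and> \<not> height_ge P p (Suc N) \<and> \<not> locally_generated P p I N"
proof -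
  have P: "P = mpoly_ring R (upper_positions n)" by (simp add: P_def generic_alt_ring_def)
  obtain q where q: "primeideal q R" "\<And>P. primeideal P R \<Longrightarrow> P \<subseteq> q \<Longrightarrow> P = q"
    using exists_minimal_prime[OF nz] by blast
  define r where "r = t - 2"
  define K where "K = [0..<2 * r]"
  have K: "set K \<subseteq> {..<n}" "distinct K" "length K = 2 * r" using t by (auto simp: K_def r_def)
  have nr: "n - length K = n - 2 * t + 4" "2 * t = length K + 4" using t K(3) by (auto simp: r_def)
  interpret G: generic_pivot R n K ..
  let ?Q = "coeff_prime R (upper_positions n) q {}"
  have Q: "primeideal ?Q P" unfolding P by (rule primeideal.coeff_prime[OF q(1)])
  interpret L: localization_at_prime ?Q P using Q by (simp add: localization_at_prime_def)
  have "pf_list G.R G.x K \<notin> ?Q"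
    by (rule G.standard_pf_notin[OF K_def _ q(1)]) (use t in \<open>simp add: r_def\<close>)
  then have dW: "pf_list G.R G.x K \<in> carrier P - ?Q" unfolding P using G.F.pf_closed by blast
  let ?L = "local_ring_at P ?Q" and ?iota = "\<lambda>a. fraction P (carrier P - ?Q) a \<one>\<^bsub>P\<^esub>" and ?m = "local_ideal_at P ?Q ?Q"
  interpret C: pivot_chart R n K ?L ?iota "fraction P (carrier P - ?Q) \<one>\<^bsub>P\<^esub> (pf_list G.R G.x K)"
  proof (intro pivot_chart.intro pivot_chart_axioms.intro)
    show "generic_pivot R" ..
    show "cring ?L" by (rule L.L_cring)
    show "ring_hom_cring (mpoly_ring R (upper_positions n)) ?L ?iota" using L.iota_hom unfolding P .
    show "fraction P (carrier P - ?Q) \<one>\<^bsub>P\<^esub> (pf_list G.R G.x K) \<in> carrier ?L"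
      by (rule L.frac_closed[OF _ dW]) (simp add: P G.F.one_closed)
    show "?iota (pf_list G.R G.x K) \<otimes>\<^bsub>?L\<^esub> fraction P (carrier P - ?Q) \<one>\<^bsub>P\<^esub> (pf_list G.R G.x K) = \<one>\<^bsub>?L\<^esub>"
      by (rule L.frac_inverse[OF dW])
  qed
  have m: "primeideal ?m ?L" by (rule L.local_prime[OF Q subset_refl])
  have iota_mem: "?iota f \<in> ?m \<longleftrightarrow> (\<forall>m. f m \<in> q)" if "f \<in> carrier G.R" for f
    using L.prime_mem_iff[OF Q subset_refl _ L.W_one, of f] that by (simp add: P coeff_prime_def)
  have "primeideal (C.center ?m) G.R" by (rule C.center_prime[OF m])
  moreover have "I \<subseteq> C.center ?m"
    using C.pfaffian_ideal_order_two[OF nr(2)] C.order_two_center[OF primeideal.axioms(1)[OF m]]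
    unfolding I_def P_def generic_alt_ring_def by (rule subset_trans)
  moreover have "\<not> height_ge G.R (C.center ?m) (Suc N)"
    using C.center_height[OF m q iota_mem] unfolding G.card_E[OF K(2,1)] nr(1) N_def .
  moreover have "\<not> locally_generated G.R (C.center ?m) I N"
    using C.center_not_locally_generated[OF m nr(2) K(1,2), of N] N unfolding nr(1) I_def P_def generic_alt_ring_def by blast
  ultimately show ?thesis unfolding P by blast
qed

section \<open>The condition on \<open>G\<^sub>s\<close>\<close>

lemma choose_three_ge: "4 \<le> m \<Longrightarrow> m \<le> m choose 3"
proof (induction m rule: dec_induct)
  case base
  show ?case by (simp add: binomial_eq_0_iff numeral_eq_Suc)
next
  case (step m)
  have "0 < m choose 2" using step by (simp add: zero_less_binomial_iff)
  moreover have "Suc m choose 3 = (m choose 2) + (m choose 3)" using binomial_Suc_Suc[of m 2] by (simp add: numeral_eq_Suc)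
  ultimately show ?case using step by linarith
qed

text \<open>For \<open>m = 6\<close> both numbers are 15, so 7 is the first case. Passing from
  \<open>m\<close> to \<open>m + 1\<close> adds \<open>m\<close> on the left and
  \<open>m choose 3\<close> on the right.\<close>

lemma choose_two_less_four: "7 \<le> m \<Longrightarrow> m choose 2 < m choose 4"
proof (induction m rule: dec_induct)
  case base
  show ?case by (simp add: numeral_eq_Suc)
next
  case (step m)
  have "Suc m choose 4 = (m choose 3) + (m choose 4)" using binomial_Suc_Suc[of m 3] by (simp add: numeral_eq_Suc)
  moreover have "Suc m choose 2 = m + (m choose 2)" using binomial_Suc_Suc[of m 1] by (simp add: numeral_eq_Suc)
  ultimately show ?case using step choose_three_ge[of m] by linarith
qed

text \<open>By symmetry the cases besides \<open>k = 2\<close> give the values 1, \<open>m\<close>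
  and \<open>m choose 2\<close>; in the middle one \<open>m \<ge> 3\<close>.\<close>

lemma choose_le_choose_two:
  assumes "k = 2 \<or> m - k \<le> 2" "2 \<le> k" "k \<le> m"
  shows "m choose k \<le> m choose 2"
proof -
  consider "k = 2" | "m = k" | "m = Suc k" | "m = Suc (Suc k)" using assms by linarith
  then show ?thesis
  proof cases
    case 2
    have "1 \<le> m choose 2" using assms zero_less_binomial[of 2 m] by linarith
    then show ?thesis unfolding 2 binomial_n_n .
  next
    case 3
    have "m \<le> m choose 2" using 3 assms
    proof -
      have "2 * m \<le> m * (m - 1)" using mult_le_mono1[of 2 "m - 1" m] 3 assms(2) by (simp add: mult.commute)
      then have "2 * m div 2 \<le> m * (m - 1) div 2" by (rule div_le_mono)
      then show ?thesis unfolding choose_two by simp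
    qed
    then show ?thesis using 3 binomial_symmetric[of k m] by simp
  next
    case 4
    then show ?thesis using binomial_symmetric[of k m] by simp
  qed simp
qed

theorem corollary3p5:
  fixes S :: "('a, 'b) ring_scheme" and n t :: nat
  assumes "cring S" and "noetherian_ring S" and "carrier S \<noteq> {\<zero>\<^bsub>S\<^esub>}"
    and "2 \<le> 2 * t" and "2 * t \<le> n"
  defines "R \<equiv> generic_alt_ring S n"
  defines "I \<equiv> pfaffian_ideal R (2 * t) (generic_alt_mat S n)"
  shows "(satisfies_G_inf R I \<longleftrightarrow>
            2 * t = 2 \<or> 2 * t = n \<or> 2 * t = n - 2 \<or> 2 * t = n - 1)
       \<and> (\<not> (2 * t = 2 \<or> 2 * t = n \<or> 2 * t = n - 2 \<or> 2 * t = n - 1) \<longrightarrow>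
            satisfies_G R I ((n - 2 * t + 4) choose 2)
          \<and> (\<forall>s. satisfies_G R I s \<longrightarrow> s \<le> (n - 2 * t + 4) choose 2))"
proof -
  interpret S: cring S by fact
  interpret G: generic_pivot S n "[]" ..
  have I: "ideal I R" using G.pfaffian_ideal_ideal[of t] unfolding I_def R_def generic_alt_ring_def .
  let ?N = "(n - 2 * t + 4) choose 2"
  let ?C = "2 * t = 2 \<or> 2 * t = n \<or> 2 * t = n - 2 \<or> 2 * t = n - 1"
  have main: "\<exists>r<t. height_ge R p ((n - 2 * r) choose 2) \<and> locally_generated R p I ((n - 2 * r) choose (2 * t - 2 * r))"
    if "primeideal p R" "I \<subseteq> p" for p
    using S.pfaffian_ideal_height_and_gens[OF assms(4,5)] that unfolding I_def R_def by blast
  have good: "satisfies_G R I s" if ?C for s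
  proof (rule satisfies_G_I[OF I])
    fix p assume "primeideal p R" "I \<subseteq> p"
    then obtain r where r: "r < t" "height_ge R p ((n - 2 * r) choose 2)" "locally_generated R p I ((n - 2 * r) choose (2 * t - 2 * r))"
      using main by blast
    \<comment> \<open>Pivoting preserves the difference \<open>n - 2 * t\<close>, and
      \<open>2 * t = 2\<close> forces \<open>r = 0\<close>.\<close>
    have "(n - 2 * r) choose (2 * t - 2 * r) \<le> (n - 2 * r) choose 2"
      by (rule choose_le_choose_two) (use that r(1) assms(4,5) in linarith)+
    then show "height_ge R p s \<or> (\<exists>k. height_ge R p k \<and> locally_generated R p I k)"
      using r locally_generated_mono by blast
  qed
  have bad: "satisfies_G R I ?N" "\<And>s. satisfies_G R I s \<Longrightarrow> s \<le> ?N" if "\<not> ?C"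
  proof -
    have t: "2 \<le> t" "2 * t + 3 \<le> n" using that assms(4,5) by linarith+
    show "satisfies_G R I ?N"
    proof (rule satisfies_G_I[OF I])
      fix p assume "primeideal p R" "I \<subseteq> p"
      then obtain r where r: "r < t" "height_ge R p ((n - 2 * r) choose 2)" "locally_generated R p I ((n - 2 * r) choose (2 * t - 2 * r))"
        using main by blast
      \<comment> \<open>For \<open>r = t - 1\<close> the ideal is locally generated by the entries
        of T, as many as the height bound. Otherwise \<open>r \<le> t - 2\<close>, and the height is
        too large for the prime to be tested.\<close>
      show "height_ge R p ?N \<or> (\<exists>k. height_ge R p k \<and> locally_generated R p I k)"
      proof (cases "r = t - 1")
        case True
        then have "2 * t - 2 * r = 2" using t by linarith
        then show ?thesis using r by auto
      next
        case False
        then have "n - 2 * t + 4 \<le> n - 2 * r" using r(1) t by linarith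
        then have "?N \<le> (n - 2 * r) choose 2" by (rule binomial_right_mono)
        then show ?thesis using height_ge_mono[OF r(2)] by blast
      qed
    qed
    have "?N < (n - 2 * t + 4) choose 4" by (rule choose_two_less_four) (use t in linarith)
    then obtain p where p: "primeideal p R" "I \<subseteq> p" "\<not> height_ge R p (Suc ?N)" "\<not> locally_generated R p I ?N"
      using S.pfaffian_ideal_bad_prime[OF assms(3) t] unfolding I_def R_def by blast
    show "s \<le> ?N" if "satisfies_G R I s" for s
      by (rule satisfies_G_bound[OF I p that])
  qed
  have "\<not> satisfies_G_inf R I" if "\<not> ?C"
    using bad(2)[OF that, of "Suc ?N"] unfolding satisfies_G_inf_def by auto
  then show ?thesis using good bad unfolding satisfies_G_inf_def by blast
qed

end
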